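(* Let $K\ge 1$ be fixed, let $\omega_1,\dots,\omega_K>0$ and $a,b,c\in\mathbb{R}$ be constants, and let $\mu=(\mu_1,\dots,\mu_K)^T\in\mathbb{R}^K$ satisfy $|\mu_k|\neq\omega_k$ for all $k$. Let $r=\sum_{k=1}^K 1\{|\mu_k|>\omega_k\}$ and assume $r\ge 1$. Let $$I(\mu^*,\mu_0;\mu)=-\frac12\sum_{k:|\mu_k|>\omega_k}(a\mu_k+b)\big((a-2)\mu_k+b\big)-\frac12\sum_{k:|\mu_k|<\omega_k}c(c-2\mu_k),$$ and assume that $I(\mu^*,\mu_0;\mu)>0$. Let $N_B$ be the shrinkage-based SRRS scheme with threshold $B$ and parameters $a,b,c,\omega_1,\dots,\omega_K$. Then, as $B\to\infty$, $$D_\mu(N_B)\le\frac{\log B}{I(\mu^*,\mu_0;\mu)}+\frac{r a^2}{2I(\mu^*,\mu_0;\mu)}\log\Big(\frac{\log B}{I(\mu^*,\mu_0;\mu)}\Big)+o(r\log\log B).$$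
   Context: Observations: $X_{k,n}$, $k=1,\dots,K$, $n=1,2,\dots$, are independent real random variables. For $\nu\in\{1,2,\dots\}$ and $\mu\in\mathbb{R}^K$, under $\mathbf{P}_{\mu,\nu}$ (expectation $\mathbf{E}_{\mu,\nu}$), $X_{k,n}\sim N(0,1)$ for $n<\nu$ and $X_{k,n}\sim N(\mu_k,1)$ for $n\ge\nu$; the pre-change mean is $\mu_0=0$. Let $\mathcal{F}_n$ be the $\sigma$-algebra generated by $X_{k,i}$, $1\le k\le K$, $i\le n$. For a stopping time $T$ with respect to $(\mathcal{F}_n)$, the worst-case detection delay is $$D_\mu(T)=\sup_{1\le\nu<\infty}\operatorname{ess\,sup}\,\mathbf{E}_{\mu,\nu}\big(T-\nu+1\mid T\ge\nu,\mathcal{F}_{\nu-1}\big).$$ Shrinkage-based SRRS scheme: let $f_\theta$ be the density of $N(\theta,1)$. For $\ell>m\ge1$ let $\bar X_{k,m,\ell}=\frac{X_{k,m}+\cdots+X_{k,\ell-1}}{\ell-m}$, and let $\hat\mu_{k,m,\ell}=a\bar X_{k,m,\ell}+b$ if $|\bar X_{k,m,\ell}|\ge\omega_k$, and $\hat\mu_{k,m,\ell}=c$ if $|\bar X_{k,m,\ell}|<\omega_k$. Put $\Lambda_{n,n}=1$ for all $n\ge1$ and $$\Lambda_{n,m}=\Lambda_{n-1,m}\prod_{k=1}^K\frac{f_{\hat\mu_{k,m,n}}(X_{k,n})}{f_{0}(X_{k,n})}\quad(n>m),\qquad R_n=\sum_{m=1}^n\Lambda_{n,m},\qquad N_B=\inf\{n\ge1:R_n\ge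 B\}.$$ The quantity $I(\mu^*,\mu_0;\mu)$ equals $-\frac12\sum_{k=1}^K\mu_k^*(\mu_k^*-2\mu_k)$, where $\mu_k^*=a\mu_k+b$ if $|\mu_k|>\omega_k$ and $\mu_k^*=c$ if $|\mu_k|<\omega_k$ (the limit of $\hat\mu_{k,m,\ell}$ as $\ell\to\infty$ after the change). *)

theory Defs
  imports "HOL-Probability.Probability" "HOL-Library.Landau_Symbols"
begin

text \<open>
  Streams are numbered \<open>1..K\<close> and times \<open>1, 2, \<dots>\<close>; \<open>X k n\<close> is the observation of stream \<open>k\<close> at
  time \<open>n\<close>. All laws \<open>P \<nu>\<close>, one for each change-point \<open>\<nu> \<ge> 1\<close>, live on the measurable space
  underlying \<open>M\<close>; only the \<open>\<sigma>\<close>-algebra of \<open>M\<close> is used, not its measure.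
\<close>

definition change_point_model ::
  "'w measure \<Rightarrow> (nat \<Rightarrow> 'w measure) \<Rightarrow> nat \<Rightarrow> (nat \<Rightarrow> real) \<Rightarrow> (nat \<Rightarrow> nat \<Rightarrow> 'w \<Rightarrow> real) \<Rightarrow> bool" where
  "change_point_model M P K \<mu> X \<longleftrightarrow>
     (\<forall>\<nu>\<ge>1. prob_space (P \<nu>) \<and> sets (P \<nu>) = sets M \<and>
        prob_space.indep_vars (P \<nu>) (\<lambda>_. borel) (\<lambda>(k, n). X k n) ({1..K} \<times> {1..}) \<and>
        (\<forall>k\<in>{1..K}. \<forall>n\<ge>1.
           distributed (P \<nu>) lborel (X k n) (normal_density (if n < \<nu> then 0 else \<mu> k) 1)))"

definition obs_filtration ::
  "'w measure \<Rightarrow> nat \<Rightarrow> (nat \<Rightarrow> nat \<Rightarrow> 'w \<Rightarrow> real) \<Rightarrow> nat \<Rightarrow> 'w measure" where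
  "obs_filtration M K X n =
     sigma (space M) {X k i -` A \<inter> space M | k i A. k \<in> {1..K} \<and> i \<in> {1..n} \<and> A \<in> sets borel}"

text \<open>
  Conditioning on both the event \<open>T \<ge> \<nu>\<close> and \<open>F (\<nu> - 1)\<close> is the conditional expectation
  given \<open>F (\<nu> - 1)\<close> under the law \<open>P \<nu>\<close> conditioned on \<open>T \<ge> \<nu>\<close>. If that event is null, the
  conditioned measure is the zero measure and the term for \<open>\<nu>\<close> is \<open>0\<close>. The truncated difference
  \<open>T + 1 - \<nu>\<close> is the true one on the event, and it is \<open>\<infinity>\<close> where \<open>T = \<infinity>\<close>. The definition is only
  meaningful for \<open>T\<close> a stopping time with respect to \<open>F\<close>.
\<close>

definition detection_delay ::
  "(nat \<Rightarrow> 'w measure) \<Rightarrow> (nat \<Rightarrow> 'w measure) \<Rightarrow> ('w \<Rightarrow> enat) \<Rightarrow> ennreal" where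
  "detection_delay P F T =
     (SUP \<nu>\<in>{1..}.
        let Q = uniform_measure (P \<nu>) {\<omega> \<in> space (P \<nu>). enat \<nu> \<le> T \<omega>}
        in esssup Q (nn_cond_exp Q (F (\<nu> - 1)) (\<lambda>\<omega>. ennreal_of_enat (T \<omega> + 1 - enat \<nu>))))"

text \<open>The scheme is defined on a single array \<open>x\<close> of observations.\<close>

definition window_mean :: "(nat \<Rightarrow> nat \<Rightarrow> real) \<Rightarrow> nat \<Rightarrow> nat \<Rightarrow> nat \<Rightarrow> real" where
  "window_mean x k m l = (\<Sum>i=m..<l. x k i) / real (l - m)"

definition shrink_est ::
  "real \<Rightarrow> real \<Rightarrow> real \<Rightarrow> (nat \<Rightarrow> real) \<Rightarrow> (nat \<Rightarrow> nat \<Rightarrow> real) \<Rightarrow> nat \<Rightarrow> nat \<Rightarrow> nat \<Rightarrow> real" where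
  "shrink_est a b c \<omega> x k m l =
     (if \<bar>window_mean x k m l\<bar> \<ge> \<omega> k then a * window_mean x k m l + b else c)"

text \<open>\<open>srrs_lr a b c \<omega> K x n m\<close> is \<open>\<Lambda>\<^bsub>n,m\<^esub>\<close>; its value \<open>1\<close> for \<open>n < m\<close> is a dummy.\<close>

primrec srrs_lr ::
  "real \<Rightarrow> real \<Rightarrow> real \<Rightarrow> (nat \<Rightarrow> real) \<Rightarrow> nat \<Rightarrow> (nat \<Rightarrow> nat \<Rightarrow> real) \<Rightarrow> nat \<Rightarrow> nat \<Rightarrow> real" where
  "srrs_lr a b c \<omega> K x 0 m = 1"
| "srrs_lr a b c \<omega> K x (Suc n) m =
     (if Suc n \<le> m then 1
      else srrs_lr a b c \<omega> K x n m *
           (\<Prod>k=1..K. normal_density (shrink_est a b c \<omega> x k m (Suc n)) 1 (x k (Suc n)) /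
                     normal_density 0 1 (x k (Suc n))))"

definition srrs_stat ::
  "real \<Rightarrow> real \<Rightarrow> real \<Rightarrow> (nat \<Rightarrow> real) \<Rightarrow> nat \<Rightarrow> (nat \<Rightarrow> nat \<Rightarrow> real) \<Rightarrow> nat \<Rightarrow> real" where
  "srrs_stat a b c \<omega> K x n = (\<Sum>m=1..n. srrs_lr a b c \<omega> K x n m)"

definition srrs_time ::
  "real \<Rightarrow> real \<Rightarrow> real \<Rightarrow> (nat \<Rightarrow> real) \<Rightarrow> nat \<Rightarrow> real \<Rightarrow> (nat \<Rightarrow> nat \<Rightarrow> real) \<Rightarrow> enat" where
  "srrs_time a b c \<omega> K B x = (INF n\<in>{n. n \<ge> 1 \<and> srrs_stat a b c \<omega> K x n \<ge> B}. enat n)"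

definition srrs_information ::
  "real \<Rightarrow> real \<Rightarrow> real \<Rightarrow> (nat \<Rightarrow> real) \<Rightarrow> nat \<Rightarrow> (nat \<Rightarrow> real) \<Rightarrow> real" where
  "srrs_information a b c \<omega> K \<mu> =
     - 1/2 * (\<Sum>k | k \<in> {1..K} \<and> \<bar>\<mu> k\<bar> > \<omega> k. (a * \<mu> k + b) * ((a - 2) * \<mu> k + b))
     - 1/2 * (\<Sum>k | k \<in> {1..K} \<and> \<bar>\<mu> k\<bar> < \<omega> k. c * (c - 2 * \<mu> k))"

end

theory Submission
  imports Defs "HOL-Real_Asymp.Real_Asymp"
begin

text \<open>
  Fix a change-point \<open>\<nu>\<close>. The statistic \<open>R\<close> is a sum of positive terms, so the scheme stops at the
  latest when the single likelihood ratio \<open>\<Lambda>\<close> started at \<open>\<nu>\<close> reaches \<open>B\<close>. That passage involves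
  observations from \<open>\<nu>\<close> on only. It is therefore independent of what happened before \<open>\<nu>\<close>, and its law is
  the same for every \<open>\<nu>\<close>: the supremum over \<open>\<nu>\<close> and the essential supremum in the delay disappear, and
  what remains is to bound the mean of the time \<open>N\<close> at which a random sum \<open>S\<close>, the logarithm of
  \<open>\<Lambda>\<close>, exceeds \<open>H = ln B\<close> (lemmas \<open>delay_le\<close>, \<open>esssup_nn_cond_exp_le\<close>, \<open>detection_delay_le\<close>).

  The increments of \<open>S\<close> would be independent with mean \<open>I\<close> if the estimates were equal to their limits.
  Let \<open>Y j\<close> be the centred mean of the first \<open>j\<close> observations of a stream. The estimate misses its limit
  by \<open>a * Y j\<close> in a stream whose mean is above the threshold and by nothing in the other streams, up to an
  error that vanishes unless \<open>Y j\<close> is far from \<open>0\<close> and is hence of order \<open>(Y j) ^ 4\<close>. Because of this the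
  \<open>j\<close>-th increment loses a multiple of \<open>Y j\<close> plus \<open>a\<^sup>2 / 2 * (Y j)\<^sup>2\<close>. As \<open>(Y j)\<^sup>2\<close> has mean \<open>1 / j\<close>,
  the quadratic losses of the \<open>r\<close> streams up to time \<open>N\<close> add up to \<open>r * a\<^sup>2 / 2 * ln N\<close>; Wald's identity
  turns this into the second term of the bound. Everything else is of smaller order than \<open>ln (ln B)\<close>:

  \<^item> The overshoot \<open>S N - H\<close> is at most one increment. Its Gaussian part is a maximum over \<open>O(H)\<close> Gaussian
    variables, which has mean of order \<open>sqrt (ln H)\<close> (\<open>mean_le_step_at_stopping\<close>).
  \<^item> The linear losses have mean zero at fixed times but not at \<open>N\<close>. With \<open>V\<close> the sum of the noise up to
    \<open>N\<close>, summation by parts turns their sum into \<open>harm N * V\<close> minus a martingale. Since \<open>V\<close> has mean \<open>0\<close>,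
    \<open>harm N\<close> may be replaced by \<open>harm N - harm q\<close> with \<open>q\<close> near \<open>H / I\<close>; now \<open>N - q\<close> and \<open>V\<close> are of order
    \<open>sqrt H\<close> in mean square while \<open>harm\<close> has slope of order \<open>1 / H\<close>, so the product has bounded mean
    (\<open>linear_drift_bound\<close>).
  \<^item> These estimates need \<open>N\<close> to be comparable to \<open>H\<close>. So crossings before \<open>s = H / (2 * I)\<close> are ignored and
    the wait is cut off at \<open>L = 2 * H / I\<close>. By Chebyshev's inequality \<open>S\<close> is below \<open>H\<close> at time \<open>L\<close> with
    probability \<open>O(1 / L)\<close> only. In that event the argument is repeated with a likelihood ratio started
    after the block of length \<open>L + 1\<close>, and so on; the blocks are independent, and the resulting geometric
    series contributes \<open>O(1)\<close> to the delay.
\<close>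

section \<open>Algebras generated by blocks of coordinates\<close>

definition coord_algebra :: "'w measure \<Rightarrow> ('i \<Rightarrow> 'w \<Rightarrow> real) \<Rightarrow> 'i set \<Rightarrow> 'w measure" where
  "coord_algebra M X J = sigma (space M) (\<Union>i\<in>J. {X i -` A \<inter> space M | A. A \<in> sets borel})"

lemma space_coord_algebra [simp]: "space (coord_algebra M X J) = space M"
  unfolding coord_algebra_def by (rule space_measure_of) auto

lemma sets_coord_algebra:
  "sets (coord_algebra M X J) =
     sigma_sets (space M) (\<Union>i\<in>J. {X i -` A \<inter> space M | A. A \<in> sets borel})"
  unfolding coord_algebra_def by (rule sets_measure_of) auto

lemma measurable_coord: "i \<in> J \<Longrightarrow> X i \<in> borel_measurable (coord_algebra M X J)"
  by (rule measurableI) (auto simp: sets_coord_algebra intro!: sigma_sets.Basic)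

lemma sets_coord_algebra_mono:
  "J \<subseteq> J' \<Longrightarrow> sets (coord_algebra M X J) \<subseteq> sets (coord_algebra M X J')"
  unfolding sets_coord_algebra by (rule sigma_sets_mono') auto

lemma measurable_coord_algebra_mono:
  assumes "f \<in> measurable (coord_algebra M X J) N" "J \<subseteq> J'"
  shows "f \<in> measurable (coord_algebra M X J') N"
  using assms(1) sets_coord_algebra_mono[OF assms(2), of M X]
  by (auto simp: measurable_def)

lemma sets_coord_algebra_subset:
  assumes "\<And>i. i \<in> J \<Longrightarrow> X i \<in> borel_measurable M"
  shows "sets (coord_algebra M X J) \<subseteq> sets M"
  unfolding sets_coord_algebra
  by (rule sets.sigma_sets_subset) (use assms in \<open>auto intro: measurable_sets\<close>)

lemma measurable_from_coord_algebra:
  assumes "f \<in> measurable (coord_algebra M X J) N" "\<And>i. i \<in> J \<Longrightarrow> X i \<in> borel_measurable M"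
  shows "f \<in> measurable M N"
  using assms(1) sets_coord_algebra_subset[of J X M, OF assms(2)]
  by (auto simp: measurable_def)

context prob_space
begin

lemma indep_set_coord_algebra:
  assumes X: "indep_vars (\<lambda>_. borel) X I" and J: "J \<subseteq> I" "J' \<subseteq> I" "J \<inter> J' = {}"
  shows "indep_set (sets (coord_algebra M X J)) (sets (coord_algebra M X J'))"
proof -
  let ?E = "\<lambda>i. {X i -` A \<inter> space M | A. A \<in> sets borel}"
  let ?J = "case_bool J J'"
  have "indep_sets ?E I"
    using X by (auto simp: indep_vars_def2)
  then have "indep_sets ?E (\<Union>t\<in>UNIV. ?J t)"
    by (rule indep_sets_mono_index[rotated]) (use J in \<open>auto split: bool.splits\<close>)
  then have "indep_sets (\<lambda>t. sigma_sets (space M) (\<Union>i\<in>?J t. ?E i)) UNIV"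
  proof (rule indep_sets_collect_sigma)
    show "disjoint_family_on ?J UNIV"
      using J by (auto simp: disjoint_family_on_def split: bool.splits)
    show "Int_stable (?E i)" for i
    proof (rule Int_stableI)
      fix U V assume "U \<in> ?E i" "V \<in> ?E i"
      then obtain A B where *: "A \<in> sets borel" "B \<in> sets borel"
        "U = X i -` A \<inter> space M" "V = X i -` B \<inter> space M" by auto
      show "U \<inter> V \<in> ?E i"
        using * by (intro CollectI exI[of _ "A \<inter> B"]) auto
    qed
  qed
  moreover have "(\<lambda>t. sigma_sets (space M) (\<Union>i\<in>?J t. ?E i)) =
      case_bool (sets (coord_algebra M X J)) (sets (coord_algebra M X J'))"
    by (auto simp: sets_coord_algebra fun_eq_iff split: bool.splits)
  ultimately show ?thesis
    by (simp add: indep_set_def)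
qed

lemma prob_Int_coord_algebra:
  assumes "indep_vars (\<lambda>_. borel) X I" "J \<subseteq> I" "J' \<subseteq> I" "J \<inter> J' = {}"
    and "A \<in> sets (coord_algebra M X J)" "B \<in> sets (coord_algebra M X J')"
  shows "prob (A \<inter> B) = prob A * prob B"
  using indep_set_coord_algebra[OF assms(1-4)] assms(5,6) by (auto simp: indep_sets2_eq)

lemma indep_var_coord_algebra:
  fixes f g :: "'a \<Rightarrow> real"
  assumes X: "indep_vars (\<lambda>_. borel) X I" and J: "J \<subseteq> I" "J' \<subseteq> I" "J \<inter> J' = {}"
    and f: "f \<in> borel_measurable (coord_algebra M X J)"
    and g: "g \<in> borel_measurable (coord_algebra M X J')"
  shows "indep_var borel f borel g"
  unfolding indep_var_eq
proof (intro conjI)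
  have rv: "X i \<in> borel_measurable M" if "i \<in> I" for i
    using X that by (auto simp: indep_vars_def)
  show "random_variable borel f" "random_variable borel g"
    using measurable_from_coord_algebra[OF f] measurable_from_coord_algebra[OF g] rv J by auto
  have sub: "sigma_sets (space M) {h -` A \<inter> space M | A. A \<in> sets borel} \<subseteq> sets (coord_algebra M X H)"
    if "h \<in> borel_measurable (coord_algebra M X H)" for h :: "'a \<Rightarrow> real" and H
    using sets.sigma_sets_subset[of "{h -` A \<inter> space M | A. A \<in> sets borel}" "coord_algebra M X H"]
      that measurable_sets[OF that] by auto
  show "indep_set (sigma_sets (space M) {f -` A \<inter> space M | A. A \<in> sets borel})
     (sigma_sets (space M) {g -` A \<inter> space M | A. A \<in> sets borel})"
    unfolding indep_set_def
    by (rule indep_sets_mono_sets[OF indep_set_coord_algebra[OF X J, unfolded indep_set_def]])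
      (use sub[OF f] sub[OF g] in \<open>simp split: bool.split\<close>)
qed

lemma
  fixes f g :: "'a \<Rightarrow> real"
  assumes "indep_vars (\<lambda>_. borel) X I" "J \<subseteq> I" "J' \<subseteq> I" "J \<inter> J' = {}"
    and "f \<in> borel_measurable (coord_algebra M X J)"
    and "g \<in> borel_measurable (coord_algebra M X J')"
    and "integrable M f" "integrable M g"
  shows integrable_mult_coord_algebra: "integrable M (\<lambda>w. f w * g w)"
    and expectation_mult_coord_algebra: "expectation (\<lambda>w. f w * g w) = expectation f * expectation g"
  using indep_var_integrable[OF indep_var_coord_algebra[OF assms(1-6)] assms(7,8)]
    indep_var_lebesgue_integral[OF indep_var_coord_algebra[OF assms(1-6)] assms(7,8)] by auto

end

section \<open>The shrinkage estimate and the log likelihood ratio of an array\<close>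

text \<open>
  The estimate, as a function of the sample mean \<open>u\<close>, agrees near \<open>m\<close> with an affine function of slope
  \<open>a\<close> or \<open>0\<close>, since \<open>m\<close> is not on the threshold. Away from \<open>m\<close> the difference \<open>h\<close> from that function
  grows at most linearly, and as it is \<open>0\<close> for small \<open>u - m\<close>, any power of \<open>u - m\<close> dominates it. The
  fourth power is used because its means have a finite sum over the sample sizes. The left-hand side of
  the second inequality is the drift that one stream loses by using the estimate instead of its limit \<open>t\<close>.
\<close>

lemma shrinkage_error_bound:
  fixes a b c w m :: real
  assumes w: "w > 0" and off: "\<bar>m\<bar> \<noteq> w"
  defines "t \<equiv> (if \<bar>m\<bar> > w then a * m + b else c)"
  shows "\<exists>C\<ge>0. \<forall>u. \<bar>(if \<bar>u\<bar> \<ge> w then a * u + b else c) - t\<bar> \<le> C * \<bar>u - m\<bar> \<and>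
     (t - m) * ((if \<bar>u\<bar> \<ge> w then a * u + b else c) - t) + ((if \<bar>u\<bar> \<ge> w then a * u + b else c) - t)\<^sup>2 / 2
       \<le> (if \<bar>m\<bar> > w then a * (t - m) * (u - m) + a\<^sup>2 / 2 * (u - m)\<^sup>2 else 0) + C * (u - m) ^ 4"
proof -
  define d where "d = \<bar>\<bar>m\<bar> - w\<bar>"
  define s where "s = (if \<bar>m\<bar> > w then a else 0)"
  define A where "A = \<bar>a\<bar> * \<bar>m\<bar> + \<bar>b\<bar> + \<bar>c\<bar> + \<bar>t\<bar>"
  define C1 where "C1 = A / d + 2 * \<bar>a\<bar>"
  define C2 where "C2 = (\<bar>t - m\<bar> * C1) / d^3 + (\<bar>a\<bar> * C1 + C1\<^sup>2 / 2) / d\<^sup>2"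
  define C where "C = C1 + \<bar>a\<bar> + C2"
  have d: "d > 0" using off by (auto simp: d_def)
  have A: "A \<ge> 0" by (auto simp: A_def)
  have C1: "C1 \<ge> 0" using A d by (auto simp: C1_def)
  have C2: "C2 \<ge> 0" using C1 d by (auto simp: C2_def)
  have s: "\<bar>s\<bar> \<le> \<bar>a\<bar>" by (auto simp: s_def)
  have "\<bar>e - t\<bar> \<le> C * \<bar>y\<bar> \<and> (t - m) * (e - t) + (e - t)\<^sup>2 / 2 \<le> s * (t - m) * y + s\<^sup>2 / 2 * y\<^sup>2 + C * y ^ 4"
    if e: "e = (if \<bar>u\<bar> \<ge> w then a * u + b else c)" and y: "y = u - m" for e u y
  proof -
    \<comment> \<open>\<open>h\<close> is what remains of the error after its linear part; it vanishes unless \<open>u\<close> is far from \<open>m\<close>.\<close>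
    define h where "h = e - t - s * y"
    have et: "e - t = s * y + h" by (simp add: h_def)
    have near: "h = 0" if "\<bar>y\<bar> < d"
    proof -
      have "\<bar>u\<bar> \<ge> w \<longleftrightarrow> \<bar>m\<bar> > w" using that off y d_def by (auto simp: abs_if split: if_splits)
      then show ?thesis by (auto simp: h_def e t_def s_def y algebra_simps)
    qed
    have hA: "\<bar>h\<bar> \<le> A + 2 * \<bar>a\<bar> * \<bar>y\<bar>"
    proof -
      have "\<bar>e\<bar> \<le> \<bar>a\<bar> * \<bar>m\<bar> + \<bar>a\<bar> * \<bar>y\<bar> + \<bar>b\<bar> + \<bar>c\<bar>"
      proof -
        have "a * u = a * m + a * y" by (simp add: y algebra_simps)
        moreover have "\<bar>a * m + a * y\<bar> \<le> \<bar>a\<bar> * \<bar>m\<bar> + \<bar>a\<bar> * \<bar>y\<bar>"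
          by (metis abs_mult abs_triangle_ineq)
        moreover have "0 \<le> \<bar>a\<bar> * \<bar>m\<bar>" "0 \<le> \<bar>a\<bar> * \<bar>y\<bar>" by auto
        ultimately have "\<bar>a * u + b\<bar> \<le> \<bar>a\<bar> * \<bar>m\<bar> + \<bar>a\<bar> * \<bar>y\<bar> + \<bar>b\<bar> + \<bar>c\<bar>"
          "\<bar>c\<bar> \<le> \<bar>a\<bar> * \<bar>m\<bar> + \<bar>a\<bar> * \<bar>y\<bar> + \<bar>b\<bar> + \<bar>c\<bar>" by linarith+
        then show ?thesis by (simp add: e)
      qed
      moreover have "\<bar>s * y\<bar> \<le> \<bar>a\<bar> * \<bar>y\<bar>" using s by (simp add: abs_mult mult_right_mono)
      ultimately show ?thesis unfolding h_def A_def by linarith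
    qed
    have hC: "\<bar>h\<bar> \<le> C1 * \<bar>y\<bar>"
    proof (cases "\<bar>y\<bar> < d")
      case False
      then have "A \<le> A / d * \<bar>y\<bar>" using d A by (simp add: field_simps mult_left_mono)
      then show ?thesis using hA by (simp add: C1_def algebra_simps)
    qed (use near C1 in auto)
    have "\<bar>e - t\<bar> \<le> \<bar>s * y\<bar> + \<bar>h\<bar>" unfolding et by linarith
    also have "\<dots> \<le> \<bar>a\<bar> * \<bar>y\<bar> + C1 * \<bar>y\<bar>"
      using hC s by (intro add_mono) (auto simp: abs_mult mult_right_mono)
    also have "\<dots> \<le> C * \<bar>y\<bar>" using C2 by (auto simp: C_def algebra_simps)
    finally have 1: "\<bar>e - t\<bar> \<le> C * \<bar>y\<bar>" .
    have 2: "(t - m) * h + s * y * h + h\<^sup>2 / 2 \<le> C * y ^ 4"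
    proof (cases "\<bar>y\<bar> < d")
      case True
      then show ?thesis using near C1 C2 by (auto simp: C_def)
    next
      case False
      have h2: "h\<^sup>2 \<le> (C1 * \<bar>y\<bar>)\<^sup>2" using hC by (intro power2_le_iff_abs_le[THEN iffD2]) auto
      have "(t - m) * h \<le> \<bar>t - m\<bar> * \<bar>h\<bar>" by (metis abs_ge_self abs_mult)
      also have "\<dots> \<le> \<bar>t - m\<bar> * (C1 * \<bar>y\<bar>)" using hC by (intro mult_left_mono) auto
      finally have a1: "(t - m) * h \<le> \<bar>t - m\<bar> * C1 * \<bar>y\<bar>" by (simp add: mult.assoc)
      have "s * y * h \<le> \<bar>s\<bar> * \<bar>y\<bar> * \<bar>h\<bar>" by (metis abs_ge_self abs_mult)
      also have "\<dots> \<le> \<bar>a\<bar> * \<bar>y\<bar> * (C1 * \<bar>y\<bar>)" using hC s by (intro mult_mono) auto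
      finally have a2: "s * y * h \<le> \<bar>a\<bar> * C1 * y\<^sup>2" by (simp add: power2_eq_square algebra_simps)
      have a3: "h\<^sup>2 / 2 \<le> C1\<^sup>2 / 2 * y\<^sup>2" using h2 by (simp add: power_mult_distrib)
      have "d ^ 3 \<le> \<bar>y\<bar> ^ 3" "d\<^sup>2 \<le> y\<^sup>2"
        using False d power_mono[of d "\<bar>y\<bar>" 3] power_mono[of d "\<bar>y\<bar>" 2] by simp_all
      then have "\<bar>y\<bar> * d ^ 3 \<le> \<bar>y\<bar> * \<bar>y\<bar> ^ 3" "y\<^sup>2 * d\<^sup>2 \<le> y\<^sup>2 * y\<^sup>2"
        using mult_left_mono[of "d ^ 3" "\<bar>y\<bar> ^ 3" "\<bar>y\<bar>"] mult_left_mono[of "d\<^sup>2" "y\<^sup>2" "y\<^sup>2"]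
        by simp_all
      moreover have "\<bar>y\<bar> * \<bar>y\<bar> ^ 3 = y ^ 4"
        by (simp add: abs_if power4_eq_xxxx power3_eq_cube)
      moreover have "y\<^sup>2 * y\<^sup>2 = y ^ 4" by (simp add: power4_eq_xxxx power2_eq_square)
      ultimately have b': "\<bar>y\<bar> \<le> y^4 / d^3" "y\<^sup>2 \<le> y^4 / d\<^sup>2"
        using d by (simp_all add: pos_le_divide_eq)
      have "(t - m) * h + s * y * h + h\<^sup>2 / 2 \<le> \<bar>t - m\<bar> * C1 * \<bar>y\<bar> + (\<bar>a\<bar> * C1 + C1\<^sup>2 / 2) * y\<^sup>2"
        using a1 a2 a3 by (simp add: algebra_simps)
      also have "\<dots> \<le> \<bar>t - m\<bar> * C1 * (y^4 / d^3) + (\<bar>a\<bar> * C1 + C1\<^sup>2 / 2) * (y^4 / d\<^sup>2)"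
        using b' C1 by (intro add_mono mult_left_mono) auto
      also have "\<dots> = C2 * y^4" by (simp add: C2_def field_simps)
      also have "\<dots> \<le> C * y^4" using C1 by (intro mult_right_mono) (auto simp: C_def)
      finally show ?thesis .
    qed
    have "(t - m) * (e - t) + (e - t)\<^sup>2 / 2 =
        s * (t - m) * y + s\<^sup>2 / 2 * y\<^sup>2 + ((t - m) * h + s * y * h + h\<^sup>2 / 2)"
      unfolding et by (simp add: power2_eq_square field_simps)
    then show ?thesis using 1 2 by linarith
  qed
  note * = this[OF refl refl]
  have eq: "(if \<bar>m\<bar> > w then a * (t - m) * y + a\<^sup>2 / 2 * y\<^sup>2 else 0) = s * (t - m) * y + s\<^sup>2 / 2 * y\<^sup>2" for y
    by (simp add: s_def)
  have "C \<ge> 0" using C1 C2 by (simp add: C_def)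
  then show ?thesis unfolding eq using * by (intro exI[of _ C] conjI allI) (rule conjunct1 conjunct2, blast)+
qed

locale shrinkage =
  fixes a b c :: real and \<omega> \<mu> :: "nat \<Rightarrow> real" and K :: nat
  assumes threshold_pos: "k \<in> {1..K} \<Longrightarrow> \<omega> k > 0"
    and off_threshold: "k \<in> {1..K} \<Longrightarrow> \<bar>\<mu> k\<bar> \<noteq> \<omega> k"
begin

definition target :: "nat \<Rightarrow> real" where
  "target k = (if \<bar>\<mu> k\<bar> > \<omega> k then a * \<mu> k + b else c)"

definition est :: "(nat \<Rightarrow> nat \<Rightarrow> real) \<Rightarrow> nat \<Rightarrow> nat \<Rightarrow> real" where
  "est y k j = shrink_est a b c \<omega> y k 0 j"

text \<open>
  The logarithm of the density ratio of \<open>N(m, 1)\<close> and \<open>N(0, 1)\<close> at \<open>z\<close> is \<open>m * z - m\<^sup>2 / 2\<close>. Arrays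
  start at index \<open>0\<close>; the observation there is only used for estimation, so the sum starts at \<open>1\<close>.
\<close>

definition llr_step :: "(nat \<Rightarrow> nat \<Rightarrow> real) \<Rightarrow> nat \<Rightarrow> real" where
  "llr_step y j = (\<Sum>k=1..K. est y k j * y k j - (est y k j)\<^sup>2 / 2)"

definition llr :: "(nat \<Rightarrow> nat \<Rightarrow> real) \<Rightarrow> nat \<Rightarrow> real" where
  "llr y n = (\<Sum>j=1..n. llr_step y j)"

definition info :: real where
  "info = (\<Sum>k=1..K. target k * \<mu> k - (target k)\<^sup>2 / 2)"

text \<open>
  The error of the sample mean of the first \<open>j\<close> observations; all losses of the scheme are expressed by it.
\<close>

definition dev :: "(nat \<Rightarrow> nat \<Rightarrow> real) \<Rightarrow> nat \<Rightarrow> nat \<Rightarrow> real" where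
  "dev y k j = (\<Sum>i<j. y k i - \<mu> k) / j"

lemma info_eq: "srrs_information a b c \<omega> K \<mu> = info"
proof -
  have split: "(\<Sum>k=1..K. f k) = (\<Sum>k | k \<in> {1..K} \<and> \<bar>\<mu> k\<bar> > \<omega> k. f k) + (\<Sum>k | k \<in> {1..K} \<and> \<bar>\<mu> k\<bar> < \<omega> k. f k)"
    for f :: "nat \<Rightarrow> real"
  proof -
    have eq: "{1..K} = {k. k \<in> {1..K} \<and> \<bar>\<mu> k\<bar> > \<omega> k} \<union> {k. k \<in> {1..K} \<and> \<bar>\<mu> k\<bar> < \<omega> k}"
    proof (intro set_eqI)
      fix k show "k \<in> {1..K} \<longleftrightarrow> k \<in> {k. k \<in> {1..K} \<and> \<bar>\<mu> k\<bar> > \<omega> k} \<union> {k. k \<in> {1..K} \<and> \<bar>\<mu> k\<bar> < \<omega> k}"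
        using off_threshold[of k] linorder_less_linear[of "\<bar>\<mu> k\<bar>" "\<omega> k"] by blast
    qed
    show ?thesis by (subst eq, subst sum.union_disjoint) auto
  qed
  have "(\<Sum>k | k \<in> {1..K} \<and> \<bar>\<mu> k\<bar> > \<omega> k. target k * \<mu> k - (target k)\<^sup>2 / 2) =
      - 1/2 * (\<Sum>k | k \<in> {1..K} \<and> \<bar>\<mu> k\<bar> > \<omega> k. (a * \<mu> k + b) * ((a - 2) * \<mu> k + b))"
    unfolding sum_distrib_left
    by (intro sum.cong) (auto simp: target_def power2_eq_square algebra_simps)
  moreover have "(\<Sum>k | k \<in> {1..K} \<and> \<bar>\<mu> k\<bar> < \<omega> k. target k * \<mu> k - (target k)\<^sup>2 / 2) =
      - 1/2 * (\<Sum>k | k \<in> {1..K} \<and> \<bar>\<mu> k\<bar> < \<omega> k. c * (c - 2 * \<mu> k))"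
    unfolding sum_distrib_left
    by (intro sum.cong) (auto simp: target_def power2_eq_square algebra_simps)
  ultimately show ?thesis
    unfolding info_def srrs_information_def split by linarith
qed

lemma srrs_lr_eq_exp_llr: "srrs_lr a b c \<omega> K y n 0 = exp (llr y n)"
proof (induction n)
  case (Suc n)
  have ratio: "normal_density m 1 z / normal_density 0 1 z = exp (m * z - m\<^sup>2 / 2)" for m z
  proof -
    have "exp (- (z - m)\<^sup>2 / 2) / exp (- z\<^sup>2 / 2) = exp (m * z - m\<^sup>2 / 2)"
      by (simp add: power2_eq_square algebra_simps diff_divide_distrib add_divide_distrib flip: exp_diff)
    then show ?thesis by (simp add: normal_density_def)
  qed
  have "(\<Prod>k=1..K. normal_density (shrink_est a b c \<omega> y k 0 (Suc n)) 1 (y k (Suc n)) /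
      normal_density 0 1 (y k (Suc n))) = exp (llr_step y (Suc n))"
    unfolding llr_step_def exp_sum[OF finite_atLeastAtMost] ratio est_def ..
  then show ?case using Suc by (simp add: llr_def exp_add)
qed (simp add: llr_def)

text \<open>
  A likelihood ratio started at \<open>\<nu>\<close> is one started at \<open>0\<close> for the array that begins at \<open>\<nu>\<close>; this makes
  all starting times instances of a single random sum.
\<close>

lemma srrs_lr_shift:
  "srrs_lr a b c \<omega> K y (\<nu> + n) \<nu> = exp (llr (\<lambda>k i. y k (\<nu> + i)) n)"
proof -
  have w: "shrink_est a b c \<omega> y k \<nu> (\<nu> + j) = shrink_est a b c \<omega> (\<lambda>k i. y k (\<nu> + i)) k 0 j" for k j
  proof -
    have "(\<Sum>i=\<nu>..<\<nu> + j. y k i) = (\<Sum>i=0..<j. y k (\<nu> + i))"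
      using sum.shift_bounds_nat_ivl[of "y k" 0 \<nu> j] by (simp add: add.commute)
    then show ?thesis by (simp add: shrink_est_def window_mean_def)
  qed
  have 0: "srrs_lr a b c \<omega> K y \<nu> \<nu> = 1"
    by (cases \<nu>) auto
  have "srrs_lr a b c \<omega> K y (\<nu> + n) \<nu> = srrs_lr a b c \<omega> K (\<lambda>k i. y k (\<nu> + i)) n 0"
  proof (induction n)
    case (Suc n)
    then show ?case using w[of _ "Suc n"] by simp
  qed (use 0 in simp)
  then show ?thesis by (simp add: srrs_lr_eq_exp_llr)
qed

lemma est_error_bound:
  obtains C where "C > 0"
    and "\<And>k y j. k \<in> {1..K} \<Longrightarrow> j \<ge> 1 \<Longrightarrow> \<bar>est y k j - target k\<bar> \<le> C * \<bar>dev y k j\<bar>"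
    and "\<And>k y j. k \<in> {1..K} \<Longrightarrow> j \<ge> 1 \<Longrightarrow>
      (target k - \<mu> k) * (est y k j - target k) + (est y k j - target k)\<^sup>2 / 2
        \<le> (if \<bar>\<mu> k\<bar> > \<omega> k then a * (target k - \<mu> k) * dev y k j + a\<^sup>2 / 2 * (dev y k j)\<^sup>2 else 0)
          + C * (dev y k j) ^ 4"
proof -
  have wm: "window_mean y k 0 j - \<mu> k = dev y k j" if "j \<ge> 1" for y k j
    using that by (simp add: window_mean_def dev_def sum_subtractf atLeast0LessThan field_simps)
  define good where "good k C \<longleftrightarrow> (\<forall>y j. j \<ge> 1 \<longrightarrow> \<bar>est y k j - target k\<bar> \<le> C * \<bar>dev y k j\<bar> \<and>
     (target k - \<mu> k) * (est y k j - target k) + (est y k j - target k)\<^sup>2 / 2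
        \<le> (if \<bar>\<mu> k\<bar> > \<omega> k then a * (target k - \<mu> k) * dev y k j + a\<^sup>2 / 2 * (dev y k j)\<^sup>2 else 0)
          + C * (dev y k j) ^ 4)" for k C
  have "\<exists>C\<ge>0. good k C" if "k \<in> {1..K}" for k
  proof -
    from shrinkage_error_bound[OF threshold_pos[OF that] off_threshold[OF that], of a b c, folded target_def]
    obtain C where "C \<ge> 0" and C: "\<And>u. \<bar>(if \<bar>u\<bar> \<ge> \<omega> k then a * u + b else c) - target k\<bar> \<le> C * \<bar>u - \<mu> k\<bar> \<and>
     (target k - \<mu> k) * ((if \<bar>u\<bar> \<ge> \<omega> k then a * u + b else c) - target k) + ((if \<bar>u\<bar> \<ge> \<omega> k then a * u + b else c) - target k)\<^sup>2 / 2
       \<le> (if \<bar>\<mu> k\<bar> > \<omega> k then a * (target k - \<mu> k) * (u - \<mu> k) + a\<^sup>2 / 2 * (u - \<mu> k)\<^sup>2 else 0) + C * (u - \<mu> k) ^ 4"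
      by blast
    have "good k C"
      unfolding good_def
    proof (intro allI impI)
      fix y and j :: nat assume "j \<ge> 1"
      from C[of "window_mean y k 0 j"] show "\<bar>est y k j - target k\<bar> \<le> C * \<bar>dev y k j\<bar> \<and>
     (target k - \<mu> k) * (est y k j - target k) + (est y k j - target k)\<^sup>2 / 2
        \<le> (if \<bar>\<mu> k\<bar> > \<omega> k then a * (target k - \<mu> k) * dev y k j + a\<^sup>2 / 2 * (dev y k j)\<^sup>2 else 0)
          + C * (dev y k j) ^ 4"
        unfolding est_def shrink_est_def wm[OF \<open>j \<ge> 1\<close>] .
    qed
    then show ?thesis using \<open>C \<ge> 0\<close> by blast
  qed
  then obtain c where c: "\<And>k. k \<in> {1..K} \<Longrightarrow> c k \<ge> 0 \<and> good k (c k)" by metis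
  define C where "C = 1 + (\<Sum>k=1..K. c k)"
  have "c k \<le> C" if "k \<in> {1..K}" for k
    unfolding C_def using member_le_sum[of k "{1..K}" c] c that by auto
  then have good: "good k C" if "k \<in> {1..K}" for k
    using c[OF that] unfolding good_def
    by (meson add_left_mono mult_right_mono order_trans abs_ge_zero that zero_le_even_power even_numeral)
  have "C > 0" unfolding C_def using c by (auto intro!: add_pos_nonneg sum_nonneg)
  with good show ?thesis unfolding good_def by (intro that[of C]) blast+
qed

end

section \<open>Upper bounds for means\<close>

context prob_space
begin

text \<open>
  Integrability and an upper bound for the mean, combined so that estimates of large expressions can be
  built up term by term.
\<close>

definition mean_le :: "('a \<Rightarrow> real) \<Rightarrow> real \<Rightarrow> bool" where
  "mean_le f c \<longleftrightarrow> integrable M f \<and> expectation f \<le> c"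

lemma mean_leI: "integrable M f \<Longrightarrow> expectation f \<le> c \<Longrightarrow> mean_le f c"
  by (simp add: mean_le_def)

lemma mean_le_const: "mean_le (\<lambda>w. c) c"
  by (simp add: mean_le_def prob_space)

lemma mean_le_weaken: "mean_le f c \<Longrightarrow> c \<le> d \<Longrightarrow> mean_le f d"
  by (simp add: mean_le_def)

lemma mean_le_add: "mean_le f c \<Longrightarrow> mean_le g d \<Longrightarrow> mean_le (\<lambda>w. f w + g w) (c + d)"
  by (simp add: mean_le_def)

lemma mean_le_cmult: "mean_le f c \<Longrightarrow> t \<ge> 0 \<Longrightarrow> mean_le (\<lambda>w. t * f w) (t * c)"
  by (auto simp: mean_le_def intro: mult_left_mono)

lemma mean_le_sum:
  "(\<And>i. i \<in> A \<Longrightarrow> mean_le (f i) (c i)) \<Longrightarrow> mean_le (\<lambda>w. \<Sum>i\<in>A. f i w) (\<Sum>i\<in>A. c i)"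
  by (auto simp: mean_le_def intro: sum_mono)

lemma mean_le_mono:
  assumes "mean_le g c" "f \<in> borel_measurable M"
    and "\<And>w. w \<in> space M \<Longrightarrow> 0 \<le> f w" "\<And>w. w \<in> space M \<Longrightarrow> f w \<le> g w"
  shows "mean_le f c"
proof -
  have g: "integrable M g" using assms(1) by (simp add: mean_le_def)
  have "integrable M f"
    by (rule Bochner_Integration.integrable_bound[OF g assms(2)])
      (use assms(3,4) in \<open>auto intro!: AE_I2 simp: order_trans[OF _ abs_ge_self]\<close>)
  moreover from this have "expectation f \<le> expectation g"
    using g assms(4) by (intro integral_mono) auto
  ultimately show ?thesis using assms(1) by (auto simp: mean_le_def)
qed

lemma mean_le_square_add:
  assumes "f \<in> borel_measurable M" "g \<in> borel_measurable M"
    and "mean_le (\<lambda>w. (f w)\<^sup>2) c" "mean_le (\<lambda>w. (g w)\<^sup>2) d"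
  shows "mean_le (\<lambda>w. (f w + g w)\<^sup>2) (2 * c + 2 * d)"
proof (rule mean_le_mono)
  show "mean_le (\<lambda>w. 2 * (f w)\<^sup>2 + 2 * (g w)\<^sup>2) (2 * c + 2 * d)"
    by (intro mean_le_add mean_le_cmult assms) auto
  show "(f w + g w)\<^sup>2 \<le> 2 * (f w)\<^sup>2 + 2 * (g w)\<^sup>2" for w
    using zero_le_power2[of "f w - g w"] by (simp add: power2_eq_square algebra_simps)
qed (use assms in auto)

lemma mean_le_square_sum:
  fixes f :: "'i \<Rightarrow> 'a \<Rightarrow> real"
  assumes "\<And>i. i \<in> A \<Longrightarrow> f i \<in> borel_measurable M"
    and "\<And>i. i \<in> A \<Longrightarrow> mean_le (\<lambda>w. (f i w)\<^sup>2) (c i)"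
  shows "mean_le (\<lambda>w. (\<Sum>i\<in>A. f i w)\<^sup>2) (real (card A) * (\<Sum>i\<in>A. c i))"
proof (rule mean_le_mono)
  show "mean_le (\<lambda>w. real (card A) * (\<Sum>i\<in>A. (f i w)\<^sup>2)) (real (card A) * (\<Sum>i\<in>A. c i))"
    by (intro mean_le_cmult mean_le_sum assms) auto
  show "(\<Sum>i\<in>A. f i w)\<^sup>2 \<le> real (card A) * (\<Sum>i\<in>A. (f i w)\<^sup>2)" for w
    using sum_squared_le_sum_of_squares[of "\<lambda>i. f i w" A] by (simp add: mult.commute)
qed (use assms(1) in \<open>auto intro!: borel_measurable_power borel_measurable_sum\<close>)

end

section \<open>Moments of the observations\<close>

context shrinkage
begin

lemma measurable_est:
  assumes "\<And>i. i < j \<Longrightarrow> (\<lambda>w. f w k i) \<in> borel_measurable A"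
  shows "(\<lambda>w. est (f w) k j) \<in> borel_measurable A"
proof -
  have [measurable]: "(\<lambda>w. \<Sum>i=0..<j. f w k i) \<in> borel_measurable A"
    by (intro borel_measurable_sum) (use assms in auto)
  show ?thesis unfolding est_def shrink_est_def window_mean_def by measurable
qed

lemma measurable_llr_step:
  assumes "\<And>k i. k \<in> {1..K} \<Longrightarrow> i \<le> j \<Longrightarrow> (\<lambda>w. f w k i) \<in> borel_measurable A"
  shows "(\<lambda>w. llr_step (f w) j) \<in> borel_measurable A"
  unfolding llr_step_def
  by (intro borel_measurable_sum borel_measurable_diff borel_measurable_times borel_measurable_divide
      borel_measurable_power borel_measurable_const measurable_est assms) auto

lemma measurable_llr:
  assumes "\<And>k i. k \<in> {1..K} \<Longrightarrow> i \<le> n \<Longrightarrow> (\<lambda>w. f w k i) \<in> borel_measurable A"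
  shows "(\<lambda>w. llr (f w) n) \<in> borel_measurable A"
  unfolding llr_def by (intro borel_measurable_sum measurable_llr_step assms) auto

end

text \<open>
  The observations after the change: independent normal variables with unit variance, indexed from \<open>0\<close>.
\<close>

locale normal_streams = shrinkage a b c \<omega> \<mu> K + prob_space Q
  for a b c :: real and \<omega> \<mu> :: "nat \<Rightarrow> real" and K :: nat and Q :: "'w measure" +
  fixes x :: "nat \<Rightarrow> nat \<Rightarrow> 'w \<Rightarrow> real"
  assumes indep_obs: "indep_vars (\<lambda>_. borel) (\<lambda>(k, i). x k i) ({1..K} \<times> UNIV)"
    and normal_obs: "k \<in> {1..K} \<Longrightarrow> distributed Q lborel (x k i) (normal_density (\<mu> k) 1)"
begin

definition obs :: "'w \<Rightarrow> nat \<Rightarrow> nat \<Rightarrow> real" where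
  "obs w = (\<lambda>k i. x k i w)"

definition noise :: "nat \<Rightarrow> nat \<Rightarrow> 'w \<Rightarrow> real" where
  "noise k i w = x k i w - \<mu> k"

definition past :: "nat \<Rightarrow> 'w measure" where
  "past n = coord_algebra Q (\<lambda>(k, i). x k i) ({1..K} \<times> {..<n})"

lemma measurable_obs: "k \<in> {1..K} \<Longrightarrow> x k i \<in> borel_measurable Q"
  using normal_obs[of k i] by (auto dest: distributed_measurable)

lemma measurable_noise [measurable]: "k \<in> {1..K} \<Longrightarrow> noise k i \<in> borel_measurable Q"
  unfolding noise_def[abs_def] using measurable_obs by measurable

lemma measurable_obs_past:
  assumes "k \<in> {1..K}" "i < n" shows "x k i \<in> borel_measurable (past n)"
  using measurable_coord[of "(k, i)" "{1..K} \<times> {..<n}" "\<lambda>(k, i). x k i" Q] assms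
  by (simp add: past_def)

lemma measurable_noise_past:
  assumes "k \<in> {1..K}" "i < n" shows "noise k i \<in> borel_measurable (past n)"
  unfolding noise_def[abs_def] using measurable_obs_past[OF assms] by measurable

lemma measurable_past_mono:
  "f \<in> measurable (past m) N \<Longrightarrow> m \<le> n \<Longrightarrow> f \<in> measurable (past n) N"
  unfolding past_def by (erule measurable_coord_algebra_mono) auto

lemma measurable_from_past: "f \<in> measurable (past n) N \<Longrightarrow> f \<in> measurable Q N"
  unfolding past_def by (erule measurable_from_coord_algebra) (auto intro: measurable_obs)

lemma
  assumes k: "k \<in> {1..K}"
  shows integrable_noise_power: "integrable Q (\<lambda>w. noise k i w ^ n)"
    and expectation_noise: "expectation (noise k i) = 0"
    and expectation_noise_square: "expectation (\<lambda>w. (noise k i w)\<^sup>2) = 1"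
    and expectation_noise_cube: "expectation (\<lambda>w. noise k i w ^ 3) = 0"
    and expectation_noise_fourth: "expectation (\<lambda>w. noise k i w ^ 4) = 3"
proof -
  have D: "distributed Q lborel (x k i) (normal_density (\<mu> k) 1)" by (rule normal_obs[OF k])
  show "integrable Q (\<lambda>w. noise k i w ^ n)"
    using distributed_integrable[OF D, of "\<lambda>u. (u - \<mu> k) ^ n"] integrable_normal_moment[of 1 "\<mu> k" n]
    by (simp add: noise_def)
  have E: "expectation (\<lambda>w. noise k i w ^ n) = (\<integral>u. normal_density (\<mu> k) 1 u * (u - \<mu> k) ^ n \<partial>lborel)" for n
    using distributed_integral[OF D, of "\<lambda>u. (u - \<mu> k) ^ n"] by (simp add: noise_def)
  show "expectation (noise k i) = 0"
    using E[of 1] integral_normal_moment_odd[of 1 "\<mu> k" 0] by simp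
  show "expectation (\<lambda>w. (noise k i w)\<^sup>2) = 1"
    using E[of 2] integral_normal_moment_even[of 1 "\<mu> k" 1] by simp
  show "expectation (\<lambda>w. noise k i w ^ 3) = 0"
    using E[of 3] integral_normal_moment_odd[of 1 "\<mu> k" 1] by (simp add: numeral_3_eq_3)
  show "expectation (\<lambda>w. noise k i w ^ 4) = 3"
    using E[of 4] integral_normal_moment_even[of 1 "\<mu> k" 2] by (simp add: fact_numeral)
qed

lemma integrable_noise: "k \<in> {1..K} \<Longrightarrow> integrable Q (noise k i)"
  using integrable_noise_power[of k i 1] by simp

lemma mean_le_noise_square: "k \<in> {1..K} \<Longrightarrow> mean_le (\<lambda>w. (noise k i w)\<^sup>2) 1"
  by (simp add: mean_le_def integrable_noise_power expectation_noise_square)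

text \<open>
  Under the exponential tilt by \<open>t\<close> a normal density is shifted by \<open>t\<close> and multiplied by \<open>exp (t\<^sup>2 / 2)\<close>;
  the absolute value costs the factor \<open>2\<close>.
\<close>

lemma mean_le_exp_noise:
  assumes k: "k \<in> {1..K}"
  shows "mean_le (\<lambda>w. exp (t * \<bar>noise k i w\<bar>)) (2 * exp (t\<^sup>2 / 2))"
proof (rule mean_le_mono)
  have D: "distributed Q lborel (x k i) (normal_density (\<mu> k) 1)" by (rule normal_obs[OF k])
  have "mean_le (\<lambda>w. exp (t * noise k i w)) (exp (t\<^sup>2 / 2))" for t
  proof -
    have eq: "normal_density (\<mu> k) 1 u * exp (t * (u - \<mu> k)) = exp (t\<^sup>2 / 2) * normal_density (\<mu> k + t) 1 u" for u
    proof -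
      have "- (u - \<mu> k)\<^sup>2 / 2 + t * (u - \<mu> k) = t\<^sup>2 / 2 + - (u - (\<mu> k + t))\<^sup>2 / 2"
        by (simp add: power2_eq_square field_simps)
      then show ?thesis
        unfolding normal_density_def by (simp flip: exp_add)
    qed
    have "integrable lborel (\<lambda>u. normal_density (\<mu> k) 1 u * exp (t * (u - \<mu> k)))"
      unfolding eq by (intro integrable_mult_right integrable_normal_density) auto
    moreover have "(\<integral>u. normal_density (\<mu> k) 1 u * exp (t * (u - \<mu> k)) \<partial>lborel) = exp (t\<^sup>2 / 2)"
      unfolding eq by simp
    ultimately show ?thesis
      using distributed_integrable[OF D, of "\<lambda>u. exp (t * (u - \<mu> k))"]
        distributed_integral[OF D, of "\<lambda>u. exp (t * (u - \<mu> k))"]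
      by (simp add: noise_def mean_le_def)
  qed
  from mean_le_add[OF this[of t] this[of "-t"]]
  show "mean_le (\<lambda>w. exp (t * noise k i w) + exp (- t * noise k i w)) (2 * exp (t\<^sup>2 / 2))"
    by simp
  show "exp (t * \<bar>noise k i w\<bar>) \<le> exp (t * noise k i w) + exp (- t * noise k i w)" for w
    by (auto simp: abs_if)
qed (use k in measurable)

text \<open>
  Independence in the form that replaces martingale theory below: the noise at time \<open>i\<close> is independent of
  all functions of the observations before \<open>i\<close>.
\<close>

lemma
  assumes f: "f \<in> borel_measurable (past i)" "integrable Q f" and k: "k \<in> {1..K}"
  shows integrable_past_noise: "integrable Q (\<lambda>w. f w * noise k i w ^ n)"
    and expectation_past_noise:
      "expectation (\<lambda>w. f w * noise k i w ^ n) = expectation f * expectation (\<lambda>w. noise k i w ^ n)"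
proof -
  have g: "(\<lambda>w. noise k i w ^ n) \<in> borel_measurable (coord_algebra Q (\<lambda>(k, i). x k i) {(k, i)})"
    using measurable_coord[of "(k, i)" "{(k, i)}" "\<lambda>(k, i). x k i" Q]
    unfolding noise_def by (intro borel_measurable_power borel_measurable_diff borel_measurable_const) simp
  have J: "{1..K} \<times> {..<i} \<subseteq> {1..K} \<times> UNIV" "{(k, i)} \<subseteq> {1..K} \<times> UNIV" "({1..K} \<times> {..<i}) \<inter> {(k, i)} = {}"
    using k by auto
  show "integrable Q (\<lambda>w. f w * noise k i w ^ n)"
    by (rule integrable_mult_coord_algebra[OF indep_obs J f(1)[unfolded past_def] g f(2) integrable_noise_power[OF k]])
  show "expectation (\<lambda>w. f w * noise k i w ^ n) = expectation f * expectation (\<lambda>w. noise k i w ^ n)"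
    by (rule expectation_mult_coord_algebra[OF indep_obs J f(1)[unfolded past_def] g f(2) integrable_noise_power[OF k]])
qed

lemma dev_obs: "dev (obs w) k j = (\<Sum>i<j. noise k i w) / j"
  by (simp add: dev_def obs_def noise_def)

text \<open>
  Adding one independent standard normal variable to \<open>W\<close> raises its second moment by \<open>1\<close> and its fourth
  moment by \<open>6\<close> times the second moment plus \<open>3\<close>, because the odd moments of the new variable vanish.
\<close>

lemma
  assumes k: "k \<in> {1..K}"
  shows integrable_noise_sum_power: "integrable Q (\<lambda>w. (\<Sum>i<j. noise k i w) ^ n)"
    and expectation_noise_sum_square: "expectation (\<lambda>w. (\<Sum>i<j. noise k i w)\<^sup>2) = j"
    and expectation_noise_sum_fourth: "expectation (\<lambda>w. (\<Sum>i<j. noise k i w) ^ 4) = 3 * (real j)\<^sup>2"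
proof -
  let ?W = "\<lambda>j w. \<Sum>i<j. noise k i w"
  have past: "(\<lambda>w. ?W j w ^ n) \<in> borel_measurable (past j)" for j n
    by (intro borel_measurable_power borel_measurable_sum measurable_noise_past k) auto
  have int: "integrable Q (\<lambda>w. ?W j w ^ n)" for j n
  proof (induction j arbitrary: n)
    case (Suc j)
    have "integrable Q (\<lambda>w. \<Sum>l\<le>n. real (n choose l) * (?W j w ^ l * noise k j w ^ (n - l)))"
      by (intro Bochner_Integration.integrable_sum integrable_mult_right integrable_past_noise past Suc k)
    then show ?case by (simp add: binomial_ring mult.assoc)
  qed simp
  then show "integrable Q (\<lambda>w. (\<Sum>i<j. noise k i w) ^ n)" .
  have mix: "integrable Q (\<lambda>w. ?W j w ^ n * noise k j w ^ l)"
    "expectation (\<lambda>w. ?W j w ^ n * noise k j w ^ l) = expectation (\<lambda>w. ?W j w ^ n) * expectation (\<lambda>w. noise k j w ^ l)"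
    for j n l
    by (intro integrable_past_noise expectation_past_noise past int k)+
  note mom = expectation_noise[OF k] expectation_noise_square[OF k]
    expectation_noise_cube[OF k] expectation_noise_fourth[OF k]
  have 1: "expectation (?W j) = 0" for j
    using integrable_noise[OF k] expectation_noise[OF k] by simp
  show 2: "expectation (\<lambda>w. (?W j w)\<^sup>2) = j" for j
  proof (induction j)
    case (Suc j)
    have "(?W (Suc j) w)\<^sup>2 = (?W j w)\<^sup>2 + 2 * (?W j w ^ 1 * noise k j w ^ 1) + (noise k j w)\<^sup>2" for w
      by (simp add: power2_eq_square algebra_simps)
    then show ?case
      using Suc mix[of j 1 1] int integrable_noise_power[OF k] mom 1[of j]
      by simp
  qed simp
  show "expectation (\<lambda>w. ?W j w ^ 4) = 3 * (real j)\<^sup>2"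
  proof (induction j)
    case (Suc j)
    have "?W (Suc j) w ^ 4 = ?W j w ^ 4 + 4 * (?W j w ^ 3 * noise k j w ^ 1) + 6 * ((?W j w)\<^sup>2 * (noise k j w)\<^sup>2)
        + 4 * (?W j w ^ 1 * noise k j w ^ 3) + noise k j w ^ 4" for w
      by (simp add: power4_eq_xxxx power3_eq_cube power2_eq_square algebra_simps)
    then show ?case
      using Suc mix[of j 3 1] mix[of j 2 2] mix[of j 1 3] int integrable_noise_power[OF k] mom 1[of j] 2[of j]
      by (simp add: power2_eq_square algebra_simps)
  qed simp
qed

lemma
  assumes k: "k \<in> {1..K}" and j: "j \<ge> 1"
  shows mean_le_dev_square: "mean_le (\<lambda>w. (dev (obs w) k j)\<^sup>2) (1 / j)"
    and mean_le_dev_fourth: "mean_le (\<lambda>w. dev (obs w) k j ^ 4) (3 / (real j)\<^sup>2)"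
proof -
  have e: "real j / (real j)\<^sup>2 = 1 / j" "3 * (real j)\<^sup>2 / real j ^ 4 = 3 / (real j)\<^sup>2"
    using j by (simp_all add: power4_eq_xxxx power2_eq_square)
  show "mean_le (\<lambda>w. (dev (obs w) k j)\<^sup>2) (1 / j)"
    by (simp add: mean_le_def dev_obs power_divide integrable_noise_sum_power[OF k]
        expectation_noise_sum_square[OF k] e)
  show "mean_le (\<lambda>w. dev (obs w) k j ^ 4) (3 / (real j)\<^sup>2)"
    by (simp add: mean_le_def dev_obs power_divide integrable_noise_sum_power[OF k]
        expectation_noise_sum_fourth[OF k] e)
qed

lemma measurable_dev_past: "k \<in> {1..K} \<Longrightarrow> (\<lambda>w. dev (obs w) k j) \<in> borel_measurable (past j)"
  unfolding dev_obs
  by (intro borel_measurable_divide borel_measurable_sum measurable_noise_past borel_measurable_const) auto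

lemma measurable_est_past: "k \<in> {1..K} \<Longrightarrow> (\<lambda>w. est (obs w) k j) \<in> borel_measurable (past j)"
  by (intro measurable_est) (auto simp: obs_def intro: measurable_obs_past)

lemma measurable_llr_step_obs: "(\<lambda>w. llr_step (obs w) j) \<in> borel_measurable Q"
  by (intro measurable_llr_step) (auto simp: obs_def intro: measurable_obs)

lemma measurable_llr_obs: "(\<lambda>w. llr (obs w) j) \<in> borel_measurable Q"
  by (intro measurable_llr) (auto simp: obs_def intro: measurable_obs)

lemma measurable_llr_past: "j < n \<Longrightarrow> (\<lambda>w. llr (obs w) j) \<in> borel_measurable (past n)"
  by (intro measurable_llr) (auto simp: obs_def intro: measurable_obs_past)

end

section \<open>Harmonic sums\<close>

lemma harm_le: "n \<ge> 1 \<Longrightarrow> harm n \<le> 1 + ln (real n)"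
proof (induction n rule: nat_induct_at_least)
  case (Suc n)
  have "ln (real n / real (Suc n)) \<le> real n / real (Suc n) - 1"
    using Suc by (intro ln_le_minus_one) auto
  also have "\<dots> = - inverse (real (Suc n))" by (simp add: field_simps)
  finally have "inverse (real (Suc n)) \<le> ln (real (Suc n)) - ln (real n)"
    using Suc by (subst (asm) ln_div) auto
  then show ?case using Suc by (simp add: harm_Suc)
qed (simp add: harm_def)

lemma harm_diff_le:
  assumes "s \<ge> 1" "s \<le> m" "s \<le> n"
  shows "\<bar>harm m - harm n\<bar> \<le> \<bar>real m - real n\<bar> / real s"
proof -
  have *: "\<bar>harm m - harm n\<bar> \<le> \<bar>real m - real n\<bar> / real s" if "n \<le> m" "s \<le> n" for m n :: nat
    using that(1)
  proof (induction m rule: dec_induct)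
    case (step m)
    have "inverse (real (Suc m)) \<le> 1 / real s"
      using assms(1) that(2) step by (simp add: inverse_eq_divide frac_le)
    moreover have "inverse (real (Suc m)) \<ge> 0" by simp
    moreover have "harm n \<le> (harm m :: real)" using step by (simp add: harm_mono)
    moreover have "\<bar>real (Suc m) - real n\<bar> / real s = 1 / real s + \<bar>real m - real n\<bar> / real s"
      using step by (simp add: add_divide_distrib diff_divide_distrib)
    moreover have "harm (Suc m) = harm m + inverse (real (Suc m))" by (simp add: harm_Suc)
    ultimately show ?case using step by linarith
  qed simp
  show ?thesis
    using *[of n m] *[of m n] assms by (cases "n \<le> m") (simp_all add: abs_minus_commute)
qed

text \<open>
  Each summand is at most twice the increment of the square root, as the product of sum and difference of
  two consecutive square roots is \<open>1\<close>.
\<close>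

lemma sum_inverse_sqrt_le: "(\<Sum>j=1..n. 1 / sqrt (real j)) \<le> 2 * sqrt (real n)"
proof (induction n)
  case (Suc n)
  define s t where "s = sqrt (real (Suc n))" and "t = sqrt (real n)"
  have s: "s > 0" "t \<le> s" "s * s = t * t + 1" by (auto simp: s_def t_def)
  have "1 = (s + t) * (s - t)" using s by (simp add: algebra_simps)
  also have "\<dots> \<le> (2 * s) * (s - t)" using s by (intro mult_right_mono) auto
  finally have "1 / s \<le> 2 * (s - t)" using s by (simp add: field_simps)
  then show ?case using Suc by (simp add: s_def t_def)
qed simp

lemma sum_inverse_squares_le: "(\<Sum>j=1..n. 1 / (real j)\<^sup>2) \<le> 2"
proof -
  have "(\<Sum>j=1..n. 1 / (real j)\<^sup>2) \<le> 2 - 1 / real n" if "n \<ge> 1"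
    using that
  proof (induction n rule: nat_induct_at_least)
    case (Suc n)
    have "1 / (real (Suc n))\<^sup>2 \<le> 1 / (real n * real (Suc n))"
      unfolding power2_eq_square using Suc by (intro frac_le mult_right_mono) auto
    also have "\<dots> = 1 / real n - 1 / real (Suc n)" using Suc by (simp add: field_simps)
    finally show ?case using Suc by simp
  qed simp
  moreover have "1 / real n \<ge> 0" by simp
  ultimately show ?thesis by (cases "n \<ge> 1") (linarith, simp)
qed

section \<open>Stopped sums\<close>

context normal_streams
begin

text \<open>
  Whether \<open>\<tau>\<close> is at least \<open>j\<close> must be known before the observation \<open>j\<close> is made. This makes \<open>alive \<tau> j\<close>
  predictable, so that it can be multiplied with the noise at time \<open>j\<close> without changing the mean zero.
\<close>

definition bounded_stopping :: "('w \<Rightarrow> nat) \<Rightarrow> nat \<Rightarrow> bool" where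
  "bounded_stopping \<tau> L \<longleftrightarrow>
     (\<forall>w\<in>space Q. \<tau> w \<le> L) \<and> (\<forall>j. {w \<in> space Q. j \<le> \<tau> w} \<in> sets (past j))"

definition alive :: "('w \<Rightarrow> nat) \<Rightarrow> nat \<Rightarrow> 'w \<Rightarrow> real" where
  "alive \<tau> j w = (if j \<le> \<tau> w then 1 else 0)"

lemma bounded_stopping_le: "bounded_stopping \<tau> L \<Longrightarrow> w \<in> space Q \<Longrightarrow> \<tau> w \<le> L"
  by (simp add: bounded_stopping_def)

lemma space_past: "space (past n) = space Q"
  by (simp add: past_def)

lemma bounded_stopping_const: "bounded_stopping (\<lambda>w. n) n"
  unfolding bounded_stopping_def
proof (intro conjI ballI allI)
  fix j
  have "{w \<in> space Q. j \<le> n} = (if j \<le> n then space (past j) else {})"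
    by (simp add: space_past)
  then show "{w \<in> space Q. j \<le> n} \<in> sets (past j)"
    by (metis sets.top sets.empty_sets)
qed simp

lemma alive_square_le_1: "(alive \<tau> j w)\<^sup>2 \<le> 1"
  by (simp add: alive_def)

lemma measurable_alive_past:
  assumes "bounded_stopping \<tau> L" shows "alive \<tau> j \<in> borel_measurable (past j)"
  unfolding alive_def[abs_def]
  by (rule measurable_If) (use assms in \<open>simp_all add: bounded_stopping_def space_past\<close>)

lemma measurable_alive: "bounded_stopping \<tau> L \<Longrightarrow> alive \<tau> j \<in> borel_measurable Q"
  by (rule measurable_from_past[OF measurable_alive_past])

lemma sum_stopped:
  fixes g :: "nat \<Rightarrow> real"
  assumes "\<tau> w \<le> L"
  shows "(\<Sum>j=m..\<tau> w. g j) = (\<Sum>j=m..L. alive \<tau> j w * g j)"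
proof -
  have "(\<Sum>j=m..L. alive \<tau> j w * g j) = (\<Sum>j=m..\<tau> w. alive \<tau> j w * g j)"
    by (rule sum.mono_neutral_right) (use assms in \<open>auto simp: alive_def\<close>)
  also have "\<dots> = (\<Sum>j=m..\<tau> w. g j)" by (rule sum.cong) (auto simp: alive_def)
  finally show ?thesis ..
qed

lemma
  assumes \<tau>: "bounded_stopping \<tau> L" and k: "k \<in> {1..K}"
    and \<phi>: "\<phi> \<in> borel_measurable (past j)" "integrable Q \<phi>"
  shows integrable_alive_noise: "integrable Q (\<lambda>w. alive \<tau> j w * (\<phi> w * noise k j w))"
    and expectation_alive_noise: "expectation (\<lambda>w. alive \<tau> j w * (\<phi> w * noise k j w)) = 0"
proof -
  have m: "(\<lambda>w. alive \<tau> j w * \<phi> w) \<in> borel_measurable (past j)"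
    by (intro borel_measurable_times measurable_alive_past[OF \<tau>] \<phi>)
  have i: "integrable Q (\<lambda>w. alive \<tau> j w * \<phi> w)"
    by (rule Bochner_Integration.integrable_bound[OF \<phi>(2) measurable_from_past[OF m]])
      (auto simp: alive_def)
  show "integrable Q (\<lambda>w. alive \<tau> j w * (\<phi> w * noise k j w))"
    using integrable_past_noise[OF m i k, of 1] by (simp add: mult.assoc)
  show "expectation (\<lambda>w. alive \<tau> j w * (\<phi> w * noise k j w)) = 0"
    using expectation_past_noise[OF m i k, of 1] expectation_noise[OF k] by (simp add: mult.assoc)
qed

text \<open>
  Optional stopping: a sum of noise with predictable weights has mean zero at a bounded stopping time.
\<close>

lemma expectation_stopped_sum:
  assumes \<tau>: "bounded_stopping \<tau> L" and k: "k \<in> {1..K}"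
    and \<phi>: "\<And>j. j \<in> {m..L} \<Longrightarrow> \<phi> j \<in> borel_measurable (past j)" "\<And>j. j \<in> {m..L} \<Longrightarrow> integrable Q (\<phi> j)"
  shows "integrable Q (\<lambda>w. \<Sum>j=m..L. alive \<tau> j w * (\<phi> j w * noise k j w))"
    and "expectation (\<lambda>w. \<Sum>j=m..L. alive \<tau> j w * (\<phi> j w * noise k j w)) = 0"
proof -
  show "integrable Q (\<lambda>w. \<Sum>j=m..L. alive \<tau> j w * (\<phi> j w * noise k j w))"
    by (intro Bochner_Integration.integrable_sum integrable_alive_noise[OF \<tau> k \<phi>])
  show "expectation (\<lambda>w. \<Sum>j=m..L. alive \<tau> j w * (\<phi> j w * noise k j w)) = 0"
    by (subst Bochner_Integration.integral_sum)
      (auto intro!: integrable_alive_noise[OF \<tau> k \<phi>] sum.neutral expectation_alive_noise[OF \<tau> k \<phi>])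
qed

text \<open>
  Wald's second identity as an inequality: the mixed products in the square have mean zero, and each of
  the \<open>L + 1\<close> squares has mean at most \<open>1\<close>.
\<close>

lemma mean_le_stopped_square:
  assumes \<tau>: "bounded_stopping \<tau> L" and k: "k \<in> {1..K}"
  shows "mean_le (\<lambda>w. (\<Sum>j=0..L. alive \<tau> j w * noise k j w)\<^sup>2) (real L + 1)"
proof -
  let ?A = "\<lambda>n w. \<Sum>j<n. alive \<tau> j w * noise k j w"
  have m: "?A n \<in> borel_measurable (past n)" for n
    by (intro borel_measurable_sum borel_measurable_times measurable_noise_past k
        measurable_past_mono[OF measurable_alive_past[OF \<tau>]]) auto
  have "mean_le (\<lambda>w. (?A n w)\<^sup>2) (real n)" for n
  proof (induction n)
    case (Suc n)
    have i: "integrable Q (?A n)"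
      by (rule square_integrable_imp_integrable)
        (use Suc measurable_from_past[OF m[of n]] in \<open>auto simp: mean_le_def\<close>)
    have cross: "integrable Q (\<lambda>w. alive \<tau> n w * (?A n w * noise k n w))"
      "expectation (\<lambda>w. alive \<tau> n w * (?A n w * noise k n w)) = 0"
      by (intro integrable_alive_noise[OF \<tau> k m i] expectation_alive_noise[OF \<tau> k m i])+
    have sq: "mean_le (\<lambda>w. (alive \<tau> n w)\<^sup>2 * (noise k n w)\<^sup>2) 1"
    proof (rule mean_le_mono[OF mean_le_noise_square[OF k]])
      show "(alive \<tau> n w)\<^sup>2 * (noise k n w)\<^sup>2 \<le> (noise k n w)\<^sup>2" for w
        using mult_right_mono[OF alive_square_le_1, of "(noise k n w)\<^sup>2"] by simp
    qed (use measurable_alive[OF \<tau>] measurable_noise[OF k] in auto)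
    have "mean_le (\<lambda>w. (?A n w)\<^sup>2 + (2 * (alive \<tau> n w * (?A n w * noise k n w)) + (alive \<tau> n w)\<^sup>2 * (noise k n w)\<^sup>2))
        (real n + (2 * 0 + 1))"
      by (intro mean_le_add mean_le_cmult Suc sq mean_leI cross) (use cross in auto)
    moreover have "(?A (Suc n) w)\<^sup>2 = (?A n w)\<^sup>2 + (2 * (alive \<tau> n w * (?A n w * noise k n w)) + (alive \<tau> n w)\<^sup>2 * (noise k n w)\<^sup>2)" for w
      by (simp add: power2_eq_square algebra_simps)
    ultimately show ?case by (simp add: add.commute)
  qed (simp add: mean_le_const)
  from this[of "Suc L"] show ?thesis
    by (simp add: lessThan_Suc_atMost atMost_atLeast0 add.commute)
qed

section \<open>The increments of the log likelihood ratio\<close>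

text \<open>
  The drift that stream \<open>k\<close> loses at step \<open>j\<close> because the estimate is used instead of its limit.
\<close>

definition deficit :: "nat \<Rightarrow> nat \<Rightarrow> 'w \<Rightarrow> real" where
  "deficit k j w = (target k - \<mu> k) * (est (obs w) k j - target k) + (est (obs w) k j - target k)\<^sup>2 / 2"

text \<open>
  The part of an increment that would vanish if the estimates were equal to their limits.
\<close>

definition remainder :: "nat \<Rightarrow> 'w \<Rightarrow> real" where
  "remainder j w = (\<Sum>k=1..K. (est (obs w) k j - target k) * noise k j w - deficit k j w)"

lemma llr_step_eq:
  "llr_step (obs w) j = info + (\<Sum>k=1..K. est (obs w) k j * noise k j w - deficit k j w)"
  unfolding llr_step_def info_def deficit_def noise_def obs_def sum.distrib[symmetric]
  by (intro sum.cong refl) (simp add: power2_eq_square field_simps)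

lemma llr_step_eq_remainder:
  "llr_step (obs w) j = info + (\<Sum>k=1..K. target k * noise k j w) + remainder j w"
  unfolding llr_step_eq remainder_def add.assoc sum.distrib[symmetric]
  by (intro arg_cong2[of _ _ _ _ "(+)"] sum.cong refl) (simp add: algebra_simps)

lemma measurable_deficit: "k \<in> {1..K} \<Longrightarrow> deficit k j \<in> borel_measurable Q"
  unfolding deficit_def[abs_def] using measurable_from_past[OF measurable_est_past[of k j]] by measurable

lemma measurable_remainder: "remainder j \<in> borel_measurable Q"
  unfolding remainder_def[abs_def] using measurable_from_past[OF measurable_est_past] measurable_deficit
  by (intro borel_measurable_sum borel_measurable_diff borel_measurable_times measurable_noise
      borel_measurable_const) auto

lemma integrable_est: assumes "k \<in> {1..K}" "j \<ge> 1" shows "integrable Q (\<lambda>w. est (obs w) k j)"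
proof -
  obtain C where C: "C > 0" "\<And>y. \<bar>est y k j - target k\<bar> \<le> C * \<bar>dev y k j\<bar>"
    using est_error_bound assms by metis
  have d: "integrable Q (\<lambda>w. dev (obs w) k j)"
    unfolding dev_obs using integrable_noise[OF assms(1)] by auto
  have "integrable Q (\<lambda>w. est (obs w) k j - target k)"
  proof (rule Bochner_Integration.integrable_bound)
    show "integrable Q (\<lambda>w. C * dev (obs w) k j)" using d by auto
    show "(\<lambda>w. est (obs w) k j - target k) \<in> borel_measurable Q"
      using measurable_from_past[OF measurable_est_past[OF assms(1)]] by measurable
  qed (use C in \<open>auto simp: abs_mult\<close>)
  then have "integrable Q (\<lambda>w. (est (obs w) k j - target k) + target k)" by (intro Bochner_Integration.integrable_add) auto
  then show ?thesis by simp
qed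

text \<open>
  All terms of the remainder contain the estimation error, which is at most a multiple of the centred
  sample mean; that mean has variance \<open>1 / j\<close> and fourth moment \<open>3 / j\<^sup>2\<close>, and it is independent of the
  noise at time \<open>j\<close>.
\<close>

lemma mean_le_remainder_square:
  obtains C where "C > 0" "\<And>j. j \<ge> 1 \<Longrightarrow> mean_le (\<lambda>w. (remainder j w)\<^sup>2) (C / j)"
proof -
  obtain C where C: "C > 0" "\<And>k y j. k \<in> {1..K} \<Longrightarrow> j \<ge> 1 \<Longrightarrow> \<bar>est y k j - target k\<bar> \<le> C * \<bar>dev y k j\<bar>"
    using est_error_bound by metis
  define B where "B k = 3 * (C\<^sup>2 + ((target k - \<mu> k)\<^sup>2 * C\<^sup>2 + C^4 * 3))" for k
  have B: "B k \<ge> 0" for k by (simp add: B_def)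
  have one: "mean_le (\<lambda>w. ((est (obs w) k j - target k) * noise k j w - deficit k j w)\<^sup>2) (B k / j)"
    if k: "k \<in> {1..K}" and j: "j \<ge> 1" for k j
  proof -
    let ?y = "\<lambda>w. dev (obs w) k j" and ?z = "noise k j" and ?t = "target k - \<mu> k"
    have y2: "mean_le (\<lambda>w. (?y w)\<^sup>2) (1 / j)" by (rule mean_le_dev_square[OF k j])
    have yz: "mean_le (\<lambda>w. (?y w)\<^sup>2 * (?z w)\<^sup>2) (1 / j)"
    proof -
      have "(\<lambda>w. (?y w)\<^sup>2) \<in> borel_measurable (past j)"
        by (intro borel_measurable_power measurable_dev_past k)
      from integrable_past_noise[OF this _ k, of 2] expectation_past_noise[OF this _ k, of 2]
      show ?thesis using y2 by (simp add: mean_le_def expectation_noise_square[OF k])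
    qed
    have y4: "mean_le (\<lambda>w. (?y w)^4) (3 / j)"
      by (rule mean_le_weaken[OF mean_le_dev_fourth[OF k j]])
        (use j in \<open>auto simp: power2_eq_square intro!: divide_left_mono\<close>)
    have "mean_le (\<lambda>w. 3 * (C\<^sup>2 * ((?y w)\<^sup>2 * (?z w)\<^sup>2) + (?t\<^sup>2 * C\<^sup>2 * (?y w)\<^sup>2 + C^4 * (?y w)^4)))
        (3 * (C\<^sup>2 * (1 / j) + (?t\<^sup>2 * C\<^sup>2 * (1 / j) + C^4 * (3 / j))))"
      by (intro mean_le_cmult mean_le_add y2 yz y4) auto
    also have "3 * (C\<^sup>2 * (1 / j) + (?t\<^sup>2 * C\<^sup>2 * (1 / j) + C^4 * (3 / j))) = B k / j"
      by (simp add: B_def add_divide_distrib)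
    finally show ?thesis
    proof (rule mean_le_mono)
      fix w
      define d where "d = est (obs w) k j - target k"
      have d: "\<bar>d\<bar> \<le> C * \<bar>?y w\<bar>" using C(2)[OF k j] by (simp add: d_def)
      then have d2: "d\<^sup>2 \<le> C\<^sup>2 * (?y w)\<^sup>2"
        using power_mono[OF d, of 2] by (simp add: power_mult_distrib)
      then have d4: "d^4 \<le> C^4 * (?y w)^4"
        using power_mono[OF d, of 4] by (simp add: power_mult_distrib)
      have "(d * ?z w - (?t * d + d\<^sup>2 / 2))\<^sup>2 \<le> 3 * ((d * ?z w)\<^sup>2 + ((?t * d)\<^sup>2 + (d\<^sup>2 / 2)\<^sup>2))"
      proof -
        have "(p - (q + r))\<^sup>2 \<le> 3 * (p\<^sup>2 + (q\<^sup>2 + r\<^sup>2))" for p q r :: real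
          using zero_le_power2[of "p + q"] zero_le_power2[of "p + r"] zero_le_power2[of "q - r"]
          by (simp add: power2_eq_square algebra_simps)
        then show ?thesis .
      qed
      also have "\<dots> \<le> 3 * (C\<^sup>2 * ((?y w)\<^sup>2 * (?z w)\<^sup>2) + (?t\<^sup>2 * C\<^sup>2 * (?y w)\<^sup>2 + C^4 * (?y w)^4))"
      proof -
        have "(d * ?z w)\<^sup>2 \<le> C\<^sup>2 * ((?y w)\<^sup>2 * (?z w)\<^sup>2)"
          using mult_right_mono[OF d2, of "(?z w)\<^sup>2"] by (simp add: power_mult_distrib mult.assoc)
        moreover have "(?t * d)\<^sup>2 \<le> ?t\<^sup>2 * C\<^sup>2 * (?y w)\<^sup>2"
          using mult_left_mono[OF d2, of "?t\<^sup>2"] by (simp add: power_mult_distrib mult.assoc)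
        moreover have "(d\<^sup>2 / 2)\<^sup>2 \<le> C^4 * (?y w)^4"
        proof -
          have "(d\<^sup>2 / 2)\<^sup>2 = d^4 / 4" by (simp add: power_divide flip: power_mult)
          moreover have "0 \<le> d^4" by simp
          ultimately show ?thesis using d4 by linarith
        qed
        ultimately show ?thesis by (intro mult_left_mono add_mono) auto
      qed
      finally show "((est (obs w) k j - target k) * ?z w - deficit k j w)\<^sup>2
          \<le> 3 * (C\<^sup>2 * ((?y w)\<^sup>2 * (?z w)\<^sup>2) + (?t\<^sup>2 * C\<^sup>2 * (?y w)\<^sup>2 + C^4 * (?y w)^4))"
        by (simp add: deficit_def d_def)
    next
      show "(\<lambda>w. ((est (obs w) k j - target k) * noise k j w - deficit k j w)\<^sup>2) \<in> borel_measurable Q"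
        using measurable_from_past[OF measurable_est_past[OF k]] measurable_deficit[OF k] measurable_noise[OF k]
        by measurable
    qed auto
  qed
  define C' where "C' = real K * (\<Sum>k=1..K. B k) + 1"
  have "C' > 0" unfolding C'_def using B by (intro add_nonneg_pos mult_nonneg_nonneg sum_nonneg) auto
  moreover have "mean_le (\<lambda>w. (remainder j w)\<^sup>2) (C' / j)" if j: "j \<ge> 1" for j
  proof -
    have "mean_le (\<lambda>w. (remainder j w)\<^sup>2) (real (card {1..K}) * (\<Sum>k=1..K. B k / j))"
      unfolding remainder_def
      by (intro mean_le_square_sum one j borel_measurable_diff borel_measurable_times measurable_deficit
          measurable_noise borel_measurable_const measurable_from_past[OF measurable_est_past]) auto
    then show ?thesis
      by (rule mean_le_weaken) (use j in \<open>simp add: C'_def sum_divide_distrib[symmetric] field_simps\<close>)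
  qed
  ultimately show ?thesis by (rule that)
qed

end

section \<open>The first passage of the log likelihood ratio\<close>

context shrinkage
begin

text \<open>
  The first time from \<open>s\<close> on at which the level \<open>H\<close> is reached, or \<open>L\<close> if that does not happen earlier.
  The lower limit \<open>s\<close> keeps the time comparable to \<open>H\<close>; waiting longer than necessary is harmless for an
  upper bound.
\<close>

definition passage :: "real \<Rightarrow> nat \<Rightarrow> nat \<Rightarrow> (nat \<Rightarrow> nat \<Rightarrow> real) \<Rightarrow> nat" where
  "passage H s L y = (LEAST n. s \<le> n \<and> (H \<le> llr y n \<or> L \<le> n))"

lemma passage_props:
  assumes "s \<le> L"
  shows "s \<le> passage H s L y" and "passage H s L y \<le> L"
    and "H \<le> llr y (passage H s L y) \<or> passage H s L y = L"
proof -
  let ?P = "\<lambda>n. s \<le> n \<and> (H \<le> llr y n \<or> L \<le> n)"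
  have L: "?P L" using assms by auto
  show le: "passage H s L y \<le> L" unfolding passage_def by (rule Least_le) (rule L)
  from L have P: "?P (passage H s L y)" unfolding passage_def by (rule LeastI)
  from P show "s \<le> passage H s L y" by simp
  from P le show "H \<le> llr y (passage H s L y) \<or> passage H s L y = L" by auto
qed

lemma llr_before_passage:
  assumes "s \<le> n" "n < passage H s L y" shows "llr y n < H" "n < L"
  using not_less_Least[OF assms(2)[unfolded passage_def]] assms(1) by simp_all

lemma le_passage_iff:
  assumes "s \<le> L"
  shows "j \<le> passage H s L y \<longleftrightarrow> (\<forall>n\<in>{..<j}. s \<le> n \<longrightarrow> llr y n < H \<and> n < L)"
proof
  assume "j \<le> passage H s L y"
  then show "\<forall>n\<in>{..<j}. s \<le> n \<longrightarrow> llr y n < H \<and> n < L"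
    using llr_before_passage[of s _ H L y] by simp
next
  assume *: "\<forall>n\<in>{..<j}. s \<le> n \<longrightarrow> llr y n < H \<and> n < L"
  show "j \<le> passage H s L y"
  proof (rule ccontr)
    assume "\<not> j \<le> passage H s L y"
    then have "llr y (passage H s L y) < H \<and> passage H s L y < L"
      using * passage_props(1)[OF assms, of H y] by simp
    then show False using passage_props(3)[OF assms, of H y] by linarith
  qed
qed

lemma llr_Suc: "llr y (Suc n) = llr y n + llr_step y (Suc n)"
  by (simp add: llr_def)

text \<open>
  A crossing after \<open>s\<close> exceeds \<open>H\<close> by less than the last increment. At \<open>s\<close> itself the excess may be larger,
  but there the sum is expected to be at most \<open>H / 2\<close>, so \<open>H\<close> is exceeded only after a deviation \<open>v\<close> of
  more than \<open>H / 2\<close>, and \<open>v - H / 2\<close> is bounded by \<open>v\<^sup>2 / (2 * H)\<close>. Likewise, if the level has not been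
  reached at \<open>L\<close>, the gap to \<open>H\<close> is covered by the deviation from \<open>info * L\<close>.
\<close>

lemma passage_overshoot:
  fixes y :: "nat \<Rightarrow> nat \<Rightarrow> real"
  assumes s: "1 \<le> s" "s \<le> L" and H: "0 < H" "info * s \<le> H / 2" "H \<le> info * L"
  defines "n \<equiv> passage H s L y"
  shows "llr y n - H \<le> (llr y s - info * s)\<^sup>2 / (2 * H) + \<bar>llr_step y n\<bar>"
    and "\<bar>llr y n - H\<bar> \<le> \<bar>llr y n - info * n\<bar> + \<bar>llr_step y n\<bar>"
proof -
  have n: "s \<le> n" "n \<le> L" "H \<le> llr y n \<or> n = L"
    using passage_props[OF s(2), of H y] by (auto simp: n_def)
  have jump: "llr y n < H + \<bar>llr_step y n\<bar>" if "s < n"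
  proof -
    obtain m where m: "n = Suc m" using \<open>s < n\<close> by (cases n) auto
    have "llr y m < H" using that m by (intro llr_before_passage[of s m H L]) (auto simp: n_def)
    then show ?thesis by (simp add: m llr_Suc)
  qed
  define v where "v = llr y s - info * s"
  have "0 \<le> (v - H)\<^sup>2" by simp
  then have "2 * H * (v - H / 2) \<le> v\<^sup>2" by (simp add: power2_eq_square algebra_simps)
  then have v: "v - H / 2 \<le> v\<^sup>2 / (2 * H)" using H by (simp add: pos_le_divide_eq mult.commute)
  have v0: "0 \<le> v\<^sup>2 / (2 * H)" using H by simp
  show "llr y n - H \<le> (llr y s - info * s)\<^sup>2 / (2 * H) + \<bar>llr_step y n\<bar>"
  proof (cases "n = s")
    case True
    then have "llr y n - H \<le> v - H / 2" using H by (simp add: v_def)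
    then show ?thesis using v unfolding v_def by linarith
  next
    case False
    then show ?thesis using jump n v0 unfolding v_def by linarith
  qed
  show "\<bar>llr y n - H\<bar> \<le> \<bar>llr y n - info * n\<bar> + \<bar>llr_step y n\<bar>"
  proof (cases "H \<le> llr y n")
    case True
    show ?thesis
    proof (cases "n = s")
      case True
      then have "info * n \<le> H" using H by simp
      with \<open>H \<le> llr y n\<close> show ?thesis by linarith
    next
      case False
      then show ?thesis using jump n \<open>H \<le> llr y n\<close> by linarith
    qed
  next
    case False
    then have "H \<le> info * n" using n H by simp
    with False show ?thesis by linarith
  qed
qed

lemma sets_le_passage:
  assumes "s \<le> L" and "\<And>n. n < j \<Longrightarrow> (\<lambda>w. llr (f w) n) \<in> borel_measurable A"
  shows "{w \<in> space A. j \<le> passage H s L (f w)} \<in> sets A"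
  unfolding le_passage_iff[OF assms(1)]
proof (rule sets.sets_Collect_finite_All)
  fix n assume "n \<in> {..<j}"
  then have [measurable]: "(\<lambda>w. llr (f w) n) \<in> borel_measurable A" using assms(2) by simp
  show "{w \<in> space A. s \<le> n \<longrightarrow> llr (f w) n < H \<and> n < L} \<in> sets A" by measurable
qed simp

end

context normal_streams
begin

lemma bounded_stopping_passage:
  assumes "s \<le> L" shows "bounded_stopping (\<lambda>w. passage H s L (obs w)) L"
  unfolding bounded_stopping_def
proof (intro conjI ballI allI)
  fix j
  show "{w \<in> space Q. j \<le> passage H s L (obs w)} \<in> sets (past j)"
    using sets_le_passage[OF assms, of j obs "past j" H] measurable_llr_past by (simp add: space_past)
qed (rule passage_props(2)[OF assms])

lemma measurable_stopping:
  assumes "bounded_stopping \<tau> L" shows "\<tau> \<in> measurable Q (count_space UNIV)"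
proof (rule measurable_count_space_eq_countable[THEN iffD2], safe)
  fix j
  have ev: "{w \<in> space Q. i \<le> \<tau> w} \<in> events" for i
  proof -
    have "sets (past i) \<subseteq> events"
      unfolding past_def by (rule sets_coord_algebra_subset) (use measurable_obs in auto)
    then show ?thesis using assms unfolding bounded_stopping_def by blast
  qed
  have "\<tau> -` {j} \<inter> space Q = {w \<in> space Q. j \<le> \<tau> w} - {w \<in> space Q. Suc j \<le> \<tau> w}" by auto
  then show "\<tau> -` {j} \<inter> space Q \<in> events" using ev by auto
qed auto

lemma measurable_stopped:
  assumes "bounded_stopping \<tau> L" "\<And>n. f n \<in> borel_measurable Q"
  shows "(\<lambda>w. f (\<tau> w) w :: real) \<in> borel_measurable Q"
  by (rule measurable_compose_countable[of f, OF assms(2) measurable_stopping[OF assms(1)]])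

text \<open>
  The deviation of the stopped sum consists of stopped noise, whose second moment is of order \<open>L\<close>, and
  of the stopped remainders. The latter are treated without any cancellation: the root mean square of the
  \<open>j\<close>-th one is of order \<open>1 / sqrt j\<close>, and these bounds have a sum of order \<open>sqrt L\<close>.
\<close>

lemma mean_le_stopped_deviation:
  obtains C where "C > 0" "\<And>\<tau> L. L \<ge> 1 \<Longrightarrow> bounded_stopping \<tau> L \<Longrightarrow>
     mean_le (\<lambda>w. (llr (obs w) (\<tau> w) - info * \<tau> w)\<^sup>2) (C * real L)"
proof -
  obtain C where C: "C > 0" "\<And>j. j \<ge> 1 \<Longrightarrow> mean_le (\<lambda>w. (remainder j w)\<^sup>2) (C / j)"
    using mean_le_remainder_square by blast
  define G where "G = real K * (\<Sum>k=1..K. (target k)\<^sup>2 * 6)"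
  have G: "G \<ge> 0" unfolding G_def by (intro mult_nonneg_nonneg sum_nonneg) auto
  have "mean_le (\<lambda>w. (llr (obs w) (\<tau> w) - info * \<tau> w)\<^sup>2) ((2 * G + 8 * C) * real L)"
    if L: "L \<ge> 1" and \<tau>: "bounded_stopping \<tau> L" for \<tau> L
  proof -
    let ?V = "\<lambda>k w. \<Sum>j=0..L. alive \<tau> j w * noise k j w"
    let ?A = "\<lambda>w. \<Sum>k=1..K. target k * (?V k w + - noise k 0 w)"
    let ?R = "\<lambda>w. \<Sum>j=1..L. sqrt j * (remainder j w)\<^sup>2"
    have mV: "?V k \<in> borel_measurable Q" if "k \<in> {1..K}" for k
      by (intro borel_measurable_sum borel_measurable_times measurable_alive[OF \<tau>] measurable_noise that)
    have "mean_le (\<lambda>w. (?A w)\<^sup>2) (real (card {1..K}) * (\<Sum>k=1..K. (target k)\<^sup>2 * (2 * (real L + 1) + 2 * 1)))"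
    proof (rule mean_le_square_sum)
      fix k assume k: "k \<in> {1..K}"
      show "(\<lambda>w. target k * (?V k w + - noise k 0 w)) \<in> borel_measurable Q"
        using mV[OF k] measurable_noise[OF k] by measurable
      have "mean_le (\<lambda>w. (?V k w + - noise k 0 w)\<^sup>2) (2 * (real L + 1) + 2 * 1)"
        by (intro mean_le_square_add mV k mean_le_stopped_square[OF \<tau> k])
          (use mean_le_noise_square[OF k, of 0] measurable_noise[OF k] in auto)
      from mean_le_cmult[OF this, of "(target k)\<^sup>2"]
      show "mean_le (\<lambda>w. (target k * (?V k w + - noise k 0 w))\<^sup>2) ((target k)\<^sup>2 * (2 * (real L + 1) + 2 * 1))"
        by (simp only: power_mult_distrib zero_le_power2)
    qed
    then have A: "mean_le (\<lambda>w. (?A w)\<^sup>2) (G * L)"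
    proof (rule mean_le_weaken)
      have "(\<Sum>k=1..K. (target k)\<^sup>2 * (2 * (real L + 1) + 2 * 1)) \<le> (\<Sum>k=1..K. (target k)\<^sup>2 * 6 * L)"
        using L by (intro sum_mono) (auto simp: mult.assoc intro!: mult_left_mono)
      then have "real K * (\<Sum>k=1..K. (target k)\<^sup>2 * (2 * (real L + 1) + 2 * 1)) \<le> real K * (\<Sum>k=1..K. (target k)\<^sup>2 * 6 * L)"
        by (rule mult_left_mono) simp
      also have "\<dots> = G * L" by (simp add: G_def sum_distrib_right mult.assoc)
      finally show "real (card {1..K}) * (\<Sum>k=1..K. (target k)\<^sup>2 * (2 * (real L + 1) + 2 * 1)) \<le> G * L"
        by simp
    qed
    have "mean_le ?R (\<Sum>j=1..L. sqrt j * (C / j))"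
      by (intro mean_le_sum mean_le_cmult C(2)) auto
    moreover have "(\<Sum>j=1..L. sqrt j * (C / j)) = C * (\<Sum>j=1..L. 1 / sqrt j)"
      unfolding sum_distrib_left
    proof (rule sum.cong)
      fix j assume "j \<in> {1..L}"
      then have "sqrt j / j = 1 / sqrt j" by (simp add: real_div_sqrt field_simps)
      then show "sqrt j * (C / j) = C * (1 / sqrt j)" by (metis mult.commute times_divide_eq_right mult.left_commute)
    qed simp
    ultimately have R: "mean_le ?R (C * (2 * sqrt L))"
      using sum_inverse_sqrt_le[of L] C(1) by (auto intro: mean_le_weaken)
    have "mean_le (\<lambda>w. 2 * (?A w)\<^sup>2 + (4 * sqrt L) * ?R w) (2 * (G * L) + (4 * sqrt L) * (C * (2 * sqrt L)))"
      by (intro mean_le_add mean_le_cmult A R) auto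
    also have "2 * (G * L) + (4 * sqrt L) * (C * (2 * sqrt L)) = (2 * G + 8 * C) * L"
      by (simp add: algebra_simps)
    finally show ?thesis
    proof (rule mean_le_mono)
      show "(\<lambda>w. (llr (obs w) (\<tau> w) - info * \<tau> w)\<^sup>2) \<in> borel_measurable Q"
        by (rule measurable_stopped[OF \<tau>, of "\<lambda>n w. (llr (obs w) n - info * n)\<^sup>2"])
          (use measurable_llr_obs in measurable)
      fix w assume "w \<in> space Q"
      then have \<tau>w: "\<tau> w \<le> L" by (rule bounded_stopping_le[OF \<tau>])
      define r where "r = (\<Sum>j=1..\<tau> w. remainder j w)"
      have "llr (obs w) (\<tau> w) - info * \<tau> w = (\<Sum>j=1..\<tau> w. llr_step (obs w) j - info)"
        by (simp add: llr_def sum_subtractf)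
      also have "\<dots> = (\<Sum>j=1..\<tau> w. \<Sum>k=1..K. target k * noise k j w) + r"
        by (simp add: llr_step_eq_remainder r_def sum.distrib)
      also have "(\<Sum>j=1..\<tau> w. \<Sum>k=1..K. target k * noise k j w) = ?A w"
      proof (subst sum.swap, rule sum.cong)
        fix k
        have "?V k w = (\<Sum>j=0..\<tau> w. noise k j w)" by (rule sum_stopped[of \<tau> w L, OF \<tau>w, symmetric])
        also have "\<dots> = noise k 0 w + (\<Sum>j=1..\<tau> w. noise k j w)"
          by (simp add: sum.atLeast_Suc_atMost)
        finally show "(\<Sum>j=1..\<tau> w. target k * noise k j w) = target k * (?V k w + - noise k 0 w)"
          by (simp add: sum_distrib_left)
      qed simp
      finally have eq: "llr (obs w) (\<tau> w) - info * \<tau> w = ?A w + r" .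
      have "\<bar>r\<bar> \<le> (\<Sum>j=1..\<tau> w. \<bar>remainder j w\<bar>)" unfolding r_def by (rule sum_abs)
      also have "\<dots> \<le> (\<Sum>j=1..L. \<bar>remainder j w\<bar>)" using \<tau>w by (intro sum_mono2) auto
      also have "\<dots> = (\<Sum>j=1..L. (1 / sqrt (sqrt j)) * (sqrt (sqrt j) * \<bar>remainder j w\<bar>))"
        by (intro sum.cong) auto
      \<comment> \<open>The weights \<open>j\<close> to the powers \<open>- 1 / 4\<close> and \<open>1 / 4\<close> balance the two factors of the Cauchy-Schwarz
        inequality.\<close>
      finally have "r\<^sup>2 \<le> (\<Sum>j=1..L. (1 / sqrt (sqrt j)) * (sqrt (sqrt j) * \<bar>remainder j w\<bar>))\<^sup>2"
        by (metis abs_ge_zero power_mono power2_abs)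
      also have "\<dots> \<le> (\<Sum>j=1..L. (1 / sqrt (sqrt j))\<^sup>2) * (\<Sum>j=1..L. (sqrt (sqrt j) * \<bar>remainder j w\<bar>)\<^sup>2)"
        by (rule Cauchy_Schwarz_ineq_sum)
      also have "\<dots> = (\<Sum>j=1..L. 1 / sqrt j) * ?R w"
        by (simp add: power_divide power_mult_distrib)
      also have "\<dots> \<le> (2 * sqrt L) * ?R w"
        by (intro mult_right_mono sum_inverse_sqrt_le sum_nonneg) auto
      finally have r: "r\<^sup>2 \<le> 2 * sqrt L * ?R w" .
      have "(?A w + r)\<^sup>2 \<le> 2 * (?A w)\<^sup>2 + 2 * r\<^sup>2"
        using zero_le_power2[of "?A w - r"] unfolding power2_sum power2_diff by linarith
      also have "\<dots> \<le> 2 * (?A w)\<^sup>2 + 4 * sqrt L * ?R w" using r by linarith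
      finally show "(llr (obs w) (\<tau> w) - info * \<tau> w)\<^sup>2 \<le> 2 * (?A w)\<^sup>2 + 4 * sqrt L * ?R w"
        unfolding eq .
    qed auto
  qed
  then show ?thesis using C(1) G by (intro that[of "2 * G + 8 * C"]) auto
qed

lemma mean_le_llr_step_square:
  obtains C where "C > 0" "\<And>j. j \<ge> 1 \<Longrightarrow> mean_le (\<lambda>w. (llr_step (obs w) j)\<^sup>2) C"
proof -
  obtain C where C: "C > 0" "\<And>j. j \<ge> 1 \<Longrightarrow> mean_le (\<lambda>w. (remainder j w)\<^sup>2) (C / j)"
    using mean_le_remainder_square by blast
  define G where "G = real (card {1..K}) * (\<Sum>k=1..K. (target k)\<^sup>2 * 1)"
  have G: "G \<ge> 0" unfolding G_def by (intro mult_nonneg_nonneg sum_nonneg) auto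
  define B where "B = 2 * (2 * info\<^sup>2 + 2 * G) + 2 * C"
  have "mean_le (\<lambda>w. (llr_step (obs w) j)\<^sup>2) B" if j: "j \<ge> 1" for j
  proof -
    have k: "mean_le (\<lambda>w. (target k * noise k j w)\<^sup>2) ((target k)\<^sup>2 * 1)" if "k \<in> {1..K}" for k
      unfolding power_mult_distrib by (intro mean_le_cmult mean_le_noise_square that) auto
    have rem: "mean_le (\<lambda>w. (remainder j w)\<^sup>2) C"
      using C(1) j by (intro mean_le_weaken[OF C(2)[OF j]]) (simp add: divide_le_eq mult_le_cancel_left1)
    show ?thesis
      unfolding llr_step_eq_remainder B_def G_def
      by (intro mean_le_square_add mean_le_square_sum mean_le_const k rem measurable_remainder
          borel_measurable_add borel_measurable_sum borel_measurable_times borel_measurable_const measurable_noise)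
  qed
  moreover have "B > 0" using C(1) G by (simp add: B_def add_nonneg_pos)
  ultimately show ?thesis using that by blast
qed

text \<open>
  Stopping selects an increment in a way that depends on its size, so it is bounded by the maximum over
  all times up to \<open>L\<close>, which in turn is at most a level \<open>D\<close> plus a sum of excesses over \<open>D\<close>. For normal
  variables \<open>z\<close> the excess is bounded by \<open>exp (D * (z - D)) / D\<close>, and at \<open>D = sqrt (2 * ln L)\<close> its mean is of
  order \<open>1 / L\<close>. For the remainders, whose squares have means of order \<open>1 / j\<close>, the bound \<open>z\<^sup>2 / D\<close> suffices:
  the sum of its means is of order \<open>ln L / D\<close>, again of order \<open>D\<close>.
\<close>

lemma mean_le_step_at_stopping:
  obtains C where "C > 0" "\<And>\<tau> L. L \<ge> 2 \<Longrightarrow> bounded_stopping \<tau> L \<Longrightarrow> (\<And>w. w \<in> space Q \<Longrightarrow> \<tau> w \<ge> 1) \<Longrightarrow>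
     mean_le (\<lambda>w. \<bar>llr_step (obs w) (\<tau> w)\<bar>) (C * sqrt (2 * ln (real L)))"
proof -
  obtain C where C: "C > 0" "\<And>j. j \<ge> 1 \<Longrightarrow> mean_le (\<lambda>w. (remainder j w)\<^sup>2) (C / j)"
    using mean_le_remainder_square by blast
  define B where "B = (\<bar>info\<bar> + (\<Sum>k=1..K. \<bar>target k\<bar> * 3)) + (1 + 2 * C)"
  have "mean_le (\<lambda>w. \<bar>llr_step (obs w) (\<tau> w)\<bar>) (B * sqrt (2 * ln (real L)))"
    if L: "L \<ge> 2" and \<tau>: "bounded_stopping \<tau> L" and pos: "\<And>w. w \<in> space Q \<Longrightarrow> \<tau> w \<ge> 1" for \<tau> L
  proof -
    define D where "D = sqrt (2 * ln (real L))"
    have "exp (1 / 2) \<le> real L" using exp_half_le2 L by linarith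
    then have "1 / 2 \<le> ln (real L)" using L by (intro ln_ge_iff[THEN iffD2]) auto
    then have lnL: "2 * ln (real L) \<ge> 1" by simp
    then have D1: "D \<ge> 1" and D2: "D\<^sup>2 = 2 * ln (real L)" by (simp_all add: D_def)
    have expD: "exp (D\<^sup>2 / 2) = L" using L by (simp add: D2)
    have expD': "exp (- D\<^sup>2) = 1 / (real L * real L)"
    proof -
      have "D\<^sup>2 = D\<^sup>2 / 2 + D\<^sup>2 / 2" by simp
      then have "exp (D\<^sup>2) = real L * real L" by (metis exp_add expD)
      then show ?thesis by (simp add: exp_minus inverse_eq_divide)
    qed
    let ?E = "\<lambda>k w. \<Sum>j=1..L. exp (D * \<bar>noise k j w\<bar>)"
    let ?R = "\<lambda>w. \<Sum>j=1..L. (remainder j w)\<^sup>2"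
    have E: "mean_le (\<lambda>w. D + (exp (- D\<^sup>2) / D) * ?E k w) (3 * D)" if "k \<in> {1..K}" for k
    proof -
      have m: "mean_le (\<lambda>w. D + (exp (- D\<^sup>2) / D) * ?E k w) (D + (exp (- D\<^sup>2) / D) * (\<Sum>j=1..L. 2 * exp (D\<^sup>2 / 2)))"
        using D1 by (intro mean_le_add mean_le_const mean_le_cmult mean_le_sum mean_le_exp_noise that) auto
      have e: "(exp (- D\<^sup>2) / D) * (\<Sum>j=1..L. 2 * exp (D\<^sup>2 / 2)) = 2 / D"
        using L by (simp add: expD expD')
      have i: "2 / D \<le> 2 * D" using D1 mult_mono[of 1 D 1 D] by (simp add: divide_le_eq)
      show ?thesis by (rule mean_le_weaken[OF m]) (use e i in linarith)
    qed
    have R: "mean_le (\<lambda>w. D + (1 / D) * ?R w) (D + 2 * C * D)"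
    proof -
      have "mean_le (\<lambda>w. D + (1 / D) * ?R w) (D + (1 / D) * (\<Sum>j=1..L. C / j))"
        using D1 by (intro mean_le_add mean_le_const mean_le_cmult mean_le_sum C(2)) auto
      moreover have "(1 / D) * (\<Sum>j=1..L. C / j) \<le> 2 * C * D"
      proof -
        have "(\<Sum>j=1..L. C / j) = C * harm L" by (simp add: harm_def sum_distrib_left divide_inverse)
        also have "\<dots> \<le> C * (1 + D\<^sup>2 / 2)"
          using C(1) harm_le[of L] L by (intro mult_left_mono) (auto simp: D2)
        also have "\<dots> \<le> C * (2 * D\<^sup>2)"
          using C(1) one_le_power[OF D1, of 2] by (intro mult_left_mono) linarith+
        finally have "(1 / D) * (\<Sum>j=1..L. C / j) \<le> (1 / D) * (C * (2 * D\<^sup>2))"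
          using D1 by (intro mult_left_mono) auto
        also have "\<dots> = 2 * C * D" using D1 by (simp add: power2_eq_square)
        finally show ?thesis .
      qed
      ultimately show ?thesis by (auto intro: mean_le_weaken)
    qed
    have "mean_le (\<lambda>w. (\<bar>info\<bar> + (\<Sum>k=1..K. \<bar>target k\<bar> * (D + (exp (- D\<^sup>2) / D) * ?E k w))) + (D + (1 / D) * ?R w))
       ((\<bar>info\<bar> + (\<Sum>k=1..K. \<bar>target k\<bar> * (3 * D))) + (D + 2 * C * D))"
      by (intro mean_le_add mean_le_const mean_le_sum mean_le_cmult E R) auto
    then have "mean_le (\<lambda>w. (\<bar>info\<bar> + (\<Sum>k=1..K. \<bar>target k\<bar> * (D + (exp (- D\<^sup>2) / D) * ?E k w))) + (D + (1 / D) * ?R w))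
       (B * D)"
    proof (rule mean_le_weaken)
      have "\<bar>info\<bar> * 1 \<le> \<bar>info\<bar> * D" using D1 by (intro mult_left_mono) auto
      then show "(\<bar>info\<bar> + (\<Sum>k=1..K. \<bar>target k\<bar> * (3 * D))) + (D + 2 * C * D) \<le> B * D"
        by (simp add: B_def algebra_simps sum_distrib_left sum_distrib_right)
    qed
    then show ?thesis
      unfolding D_def[symmetric]
    proof (rule mean_le_mono)
      show "(\<lambda>w. \<bar>llr_step (obs w) (\<tau> w)\<bar>) \<in> borel_measurable Q"
        by (rule measurable_stopped[OF \<tau>, of "\<lambda>n w. \<bar>llr_step (obs w) n\<bar>"])
          (use measurable_llr_step_obs in measurable)
      fix w assume w: "w \<in> space Q"
      have \<tau>w: "\<tau> w \<in> {1..L}" using bounded_stopping_le[OF \<tau> w] pos[OF w] by auto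
      have noise: "\<bar>noise k (\<tau> w) w\<bar> \<le> D + (exp (- D\<^sup>2) / D) * ?E k w" for k
      proof -
        define z where "z = \<bar>noise k (\<tau> w) w\<bar>"
        have "D * (z - D) \<le> exp (D * (z - D))" using exp_ge_add_one_self[of "D * (z - D)"] by linarith
        also have "\<dots> = exp (- D\<^sup>2) * exp (D * z)"
          by (simp add: power2_eq_square algebra_simps flip: exp_add)
        also have "\<dots> \<le> exp (- D\<^sup>2) * ?E k w"
          unfolding z_def by (intro mult_left_mono member_le_sum[OF \<tau>w, of "\<lambda>j. exp (D * \<bar>noise k j w\<bar>)"]) auto
        finally have "z - D \<le> exp (- D\<^sup>2) * ?E k w / D" using D1 by (simp add: pos_le_divide_eq mult.commute)
        then show ?thesis by (simp add: z_def)
      qed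
      have rem: "\<bar>remainder (\<tau> w) w\<bar> \<le> D + (1 / D) * ?R w"
      proof -
        define z where "z = \<bar>remainder (\<tau> w) w\<bar>"
        have "D * z \<le> D\<^sup>2 + z\<^sup>2" 
          using zero_le_power2[of "D - z"] zero_le_power2[of D] zero_le_power2[of z]
          unfolding power2_diff by linarith
        also have "z\<^sup>2 \<le> ?R w"
          using member_le_sum[OF \<tau>w, of "\<lambda>j. (remainder j w)\<^sup>2"] by (simp add: z_def)
        finally have "D * z \<le> D\<^sup>2 + ?R w" by simp
        then have "z \<le> (D\<^sup>2 + ?R w) / D" using D1 by (simp add: pos_le_divide_eq mult.commute)
        also have "\<dots> = D + (1 / D) * ?R w" using D1 by (simp add: add_divide_distrib power2_eq_square)
        finally show ?thesis by (simp add: z_def)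
      qed
      have "\<bar>\<Sum>k=1..K. target k * noise k (\<tau> w) w\<bar> \<le> (\<Sum>k=1..K. \<bar>target k * noise k (\<tau> w) w\<bar>)"
        by (rule sum_abs)
      also have "\<dots> \<le> (\<Sum>k=1..K. \<bar>target k\<bar> * (D + (exp (- D\<^sup>2) / D) * ?E k w))"
        unfolding abs_mult by (intro sum_mono mult_left_mono noise) auto
      finally show "\<bar>llr_step (obs w) (\<tau> w)\<bar> \<le> (\<bar>info\<bar> + (\<Sum>k=1..K. \<bar>target k\<bar> * (D + (exp (- D\<^sup>2) / D) * ?E k w))) + (D + (1 / D) * ?R w)"
        unfolding llr_step_eq_remainder using rem by linarith
    qed auto
  qed
  moreover have "B > 0" unfolding B_def using C(1) by (intro add_nonneg_pos add_nonneg_nonneg sum_nonneg) auto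
  ultimately show ?thesis using that by blast
qed

end

section \<open>The mean first passage time\<close>

text \<open>
  Summation by parts: \<open>z i\<close> occurs in the averages with \<open>i < j\<close>, hence with weight \<open>harm n - harm i\<close>.
\<close>

lemma sum_of_averages:
  "(\<Sum>j=1..n. (\<Sum>i<j. z i) / real j) = harm n * (\<Sum>i=0..n. z i) - (\<Sum>i=0..n. harm i * z i)"
  for z :: "nat \<Rightarrow> real"
proof (induction n)
  case (Suc n)
  have W: "(\<Sum>i<Suc n. z i) = (\<Sum>i=0..n. z i)"
    by (simp add: lessThan_Suc_atMost atMost_atLeast0)
  have "(\<Sum>j=1..Suc n. (\<Sum>i<j. z i) / real j) =
      harm n * (\<Sum>i=0..n. z i) - (\<Sum>i=0..n. harm i * z i) + inverse (real (Suc n)) * (\<Sum>i=0..n. z i)"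
    using Suc by (simp add: W[symmetric] divide_inverse mult.commute)
  then show ?case by (simp add: harm_Suc algebra_simps)
qed (simp add: harm_def)

context normal_streams
begin

text \<open>
  After summation by parts, the only term that does not have mean zero is the product of \<open>V\<close>, the stopped
  sum of the noise, with \<open>harm (\<tau> w)\<close>. Subtracting the constant \<open>harm q\<close> changes the mean of the product by
  \<open>0\<close>, and \<open>harm (\<tau> w) - harm q\<close> is at most the distance of \<open>\<tau> w\<close> and \<open>q\<close> divided by \<open>s\<close>. The result is
  stated with a dominating function because the sum of deviations is not of constant sign.
\<close>

lemma linear_drift_bound:
  assumes k: "k \<in> {1..K}" and \<tau>: "bounded_stopping \<tau> L"
    and s: "s \<ge> 1" "\<And>w. w \<in> space Q \<Longrightarrow> s \<le> \<tau> w" "s \<le> q"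
    and v: "mean_le (\<lambda>w. (real (\<tau> w) - real q)\<^sup>2) v"
  obtains g where "mean_le g (\<bar>\<alpha>\<bar> / 2 * ((v + (real L + 1)) / s))"
    and "\<And>w. w \<in> space Q \<Longrightarrow> \<alpha> * (\<Sum>j=1..\<tau> w. dev (obs w) k j) \<le> g w"
proof -
  let ?V = "\<lambda>w. \<Sum>j=0..L. alive \<tau> j w * noise k j w"
  let ?M = "\<lambda>w. \<Sum>j=0..L. alive \<tau> j w * (harm j * noise k j w)"
  let ?g = "\<lambda>w. \<bar>\<alpha>\<bar> / 2 * (1 / s * ((real (\<tau> w) - real q)\<^sup>2 + (?V w)\<^sup>2)) + (\<alpha> * harm q * ?V w - \<alpha> * ?M w)"
  have "integrable Q (\<lambda>w. \<Sum>j=0..L. alive \<tau> j w * (1 * noise k j w))"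
    "expectation (\<lambda>w. \<Sum>j=0..L. alive \<tau> j w * (1 * noise k j w)) = 0"
    by (rule expectation_stopped_sum[OF \<tau> k, of 0 "\<lambda>j w. 1"]; simp)+
  then have V: "integrable Q ?V" "expectation ?V = 0" by (simp_all only: mult_1)
  have M: "integrable Q ?M" "expectation ?M = 0"
    by (rule expectation_stopped_sum[OF \<tau> k, of 0 "\<lambda>j w. harm j"]; simp)+
  have "mean_le ?g (\<bar>\<alpha>\<bar> / 2 * (1 / s * (v + (real L + 1))) + 0)"
  proof (intro mean_le_add mean_le_cmult v mean_le_stopped_square[OF \<tau> k])
    show "mean_le (\<lambda>w. \<alpha> * harm q * ?V w - \<alpha> * ?M w) 0"
    proof (rule mean_leI)
      have i: "integrable Q (\<lambda>w. \<alpha> * harm q * ?V w)" "integrable Q (\<lambda>w. \<alpha> * ?M w)"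
        by (intro integrable_mult_right V M)+
      then show "integrable Q (\<lambda>w. \<alpha> * harm q * ?V w - \<alpha> * ?M w)"
        by (rule Bochner_Integration.integrable_diff)
      have "expectation (\<lambda>w. \<alpha> * harm q * ?V w - \<alpha> * ?M w) = \<alpha> * harm q * expectation ?V - \<alpha> * expectation ?M"
        unfolding Bochner_Integration.integral_diff[OF i] integral_mult_right_zero ..
      then show "expectation (\<lambda>w. \<alpha> * harm q * ?V w - \<alpha> * ?M w) \<le> 0"
        unfolding V(2) M(2) by simp
    qed
  qed auto
  then have "mean_le ?g (\<bar>\<alpha>\<bar> / 2 * ((v + (real L + 1)) / s))"
    by (simp only: add_0_right times_divide_eq_left mult_1)
  moreover have "\<alpha> * (\<Sum>j=1..\<tau> w. dev (obs w) k j) \<le> ?g w" if w: "w \<in> space Q" for w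
  proof -
    have \<tau>w: "\<tau> w \<le> L" by (rule bounded_stopping_le[OF \<tau> w])
    have sumV: "(\<Sum>i=0..\<tau> w. noise k i w) = ?V w"
      by (rule sum_stopped[of \<tau> w L, OF \<tau>w])
    have sumM: "(\<Sum>i=0..\<tau> w. harm i * noise k i w) = ?M w"
      by (rule sum_stopped[of \<tau> w L, OF \<tau>w])
    define h where "h = harm (\<tau> w) - (harm q :: real)"
    have id: "\<alpha> * (\<Sum>j=1..\<tau> w. dev (obs w) k j) = \<alpha> * (h * ?V w) + (\<alpha> * harm q * ?V w - \<alpha> * ?M w)"
      unfolding dev_obs sum_of_averages sumV sumM h_def by (simp add: algebra_simps)
    have sp: "real s > 0" using s(1) by simp
    have "\<bar>h\<bar> \<le> \<bar>real (\<tau> w) - real q\<bar> / s"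
      unfolding h_def by (rule harm_diff_le[OF s(1) s(2)[OF w] s(3)])
    then have "s * \<bar>h\<bar> \<le> \<bar>real (\<tau> w) - real q\<bar>" using sp by (simp add: pos_le_divide_eq mult.commute)
    then have "(s * \<bar>h\<bar>)\<^sup>2 \<le> (real (\<tau> w) - real q)\<^sup>2"
      using sp by (metis abs_ge_zero mult_nonneg_nonneg of_nat_0_le_iff power2_abs power_mono)
    moreover have "2 * (s * \<bar>h\<bar>) * \<bar>?V w\<bar> \<le> (s * \<bar>h\<bar>)\<^sup>2 + (?V w)\<^sup>2"
      using sum_squares_bound[of "s * \<bar>h\<bar>" "\<bar>?V w\<bar>"] by simp
    ultimately have "s * (\<bar>h\<bar> * \<bar>?V w\<bar>) \<le> ((real (\<tau> w) - real q)\<^sup>2 + (?V w)\<^sup>2) / 2"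
      by (simp add: mult.assoc)
    then have hV: "\<bar>h\<bar> * \<bar>?V w\<bar> \<le> (1 / s * ((real (\<tau> w) - real q)\<^sup>2 + (?V w)\<^sup>2)) / 2"
      using sp by (simp add: pos_le_divide_eq mult.commute)
    have "\<alpha> * (h * ?V w) \<le> \<bar>\<alpha>\<bar> * (\<bar>h\<bar> * \<bar>?V w\<bar>)" by (metis abs_ge_self abs_mult)
    also have "\<dots> \<le> \<bar>\<alpha>\<bar> * ((1 / s * ((real (\<tau> w) - real q)\<^sup>2 + (?V w)\<^sup>2)) / 2)"
      by (intro mult_left_mono hV) auto
    finally show ?thesis unfolding id by simp
  qed
  ultimately show ?thesis by (rule that)
qed

text \<open>
  Wald's identity for the passage time \<open>\<tau>\<close>: \<open>info * \<tau>\<close> equals the stopped sum, which is \<open>H\<close> plus the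
  overshoot, plus the stopped deficits, minus stopped noise with predictable weights, which has mean zero.
  The quadratic parts of the deficits give the logarithmic term, their linear parts are covered by
  \<open>linear_drift_bound\<close>, and their parts of fourth order have bounded sum. The second claim is Chebyshev's
  inequality at time \<open>L\<close>, where the sum is centred at a point at or above \<open>2 * H\<close>.
\<close>

lemma mean_passage_bound:
  assumes info: "info > 0"
  defines "r \<equiv> card {k \<in> {1..K}. \<bar>\<mu> k\<bar> > \<omega> k}"
  obtains C H0 where "C > 0"
    and "\<And>H s L. H \<ge> H0 \<Longrightarrow> s = nat \<lfloor>H / (2 * info)\<rfloor> \<Longrightarrow> L = nat \<lceil>2 * H / info\<rceil> \<Longrightarrow>
      mean_le (\<lambda>w. real (passage H s L (obs w)))
        (H / info + real r * a\<^sup>2 / (2 * info) * ln (H / info) + C * sqrt (ln (real L)))"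
    and "\<And>H L. H \<ge> H0 \<Longrightarrow> L = nat \<lceil>2 * H / info\<rceil> \<Longrightarrow> prob {w \<in> space Q. llr (obs w) L < H} \<le> C / real L"
proof -
  obtain C1 where C1: "C1 > 0" "\<And>\<tau> L. L \<ge> 1 \<Longrightarrow> bounded_stopping \<tau> L \<Longrightarrow>
     mean_le (\<lambda>w. (llr (obs w) (\<tau> w) - info * \<tau> w)\<^sup>2) (C1 * real L)"
    using mean_le_stopped_deviation by metis
  obtain C2 where C2: "C2 > 0" "\<And>j. j \<ge> 1 \<Longrightarrow> mean_le (\<lambda>w. (llr_step (obs w) j)\<^sup>2) C2"
    using mean_le_llr_step_square by metis
  obtain C3 where C3: "C3 > 0" "\<And>\<tau> L. L \<ge> 2 \<Longrightarrow> bounded_stopping \<tau> L \<Longrightarrow> (\<And>w. w \<in> space Q \<Longrightarrow> \<tau> w \<ge> 1) \<Longrightarrow>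
     mean_le (\<lambda>w. \<bar>llr_step (obs w) (\<tau> w)\<bar>) (C3 * sqrt (2 * ln (real L)))"
    using mean_le_step_at_stopping by metis
  obtain C4 where C4: "C4 > 0"
    "\<And>k y j. k \<in> {1..K} \<Longrightarrow> j \<ge> 1 \<Longrightarrow>
      (target k - \<mu> k) * (est y k j - target k) + (est y k j - target k)\<^sup>2 / 2
        \<le> (if \<bar>\<mu> k\<bar> > \<omega> k then a * (target k - \<mu> k) * dev y k j + a\<^sup>2 / 2 * (dev y k j)\<^sup>2 else 0)
          + C4 * (dev y k j) ^ 4"
    using est_error_bound by metis
  define e where "e = 3 / info\<^sup>2 * (4 * C1 + C2 + info\<^sup>2)"
  have e0: "e \<ge> 0" using C1 C2 by (simp add: e_def)
  define \<alpha> where "\<alpha> k = a * (target k - \<mu> k)" for k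
  define W where "W = C1 / (4 * info) + (\<Sum>k=1..K. \<bar>\<alpha> k\<bar> / 2 * (12 * e + 24)) + real r * (a\<^sup>2 / 2 * 3) + real K * (C4 * 6)"
  have W0: "W \<ge> 0" unfolding W_def using C1 C4 e0 info by (intro add_nonneg_nonneg sum_nonneg) auto
  define C where "C = (W + C3 * sqrt 2) / info + 4 * C1 / info\<^sup>2"
  have "C > 0" unfolding C_def using W0 C3 C1 info by (intro add_pos_pos divide_pos_pos add_nonneg_pos) auto
  have L_bounds: "2 * (H / info) \<le> real L" "real L \<le> 3 * (H / info)" "8 \<le> real L"
    if "H \<ge> 4 * info" "L = nat \<lceil>2 * H / info\<rceil>" for H L
  proof -
    have n0: "H / info \<ge> 4" using that info by (simp add: pos_le_divide_eq)
    have "real L = of_int \<lceil>2 * H / info\<rceil>" using n0 that by simp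
    then show "2 * (H / info) \<le> real L" "real L \<le> 3 * (H / info)" "8 \<le> real L"
      using n0 le_of_int_ceiling[of "2 * H / info"] of_int_ceiling_le_add_one[of "2 * H / info"]
      unfolding times_divide_eq_right[symmetric] by linarith+
  qed
  show ?thesis
  proof (rule that[of C "4 * info"])
    fix H L assume H: "H \<ge> 4 * info" and L: "L = nat \<lceil>2 * H / info\<rceil>"
    note Lb = L_bounds[OF H L]
    have HL: "2 * H \<le> info * L" using Lb(1) info by (simp add: field_simps)
    have Hpos: "H > 0" using H info by (smt (verit) mult_pos_pos)
    define t where "t = 4 / (info * L)\<^sup>2"
    let ?A = "{w \<in> space Q. llr (obs w) L < H}"
    have A: "?A \<in> events" using measurable_llr_obs[of L] by measurable
    have "mean_le (\<lambda>w. t * (llr (obs w) L - info * L)\<^sup>2) (t * (C1 * L))"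
      using C1(2)[OF _ bounded_stopping_const[of L]] Lb by (intro mean_le_cmult) (auto simp: t_def)
    then have "mean_le (indicator ?A) (t * (C1 * L))"
    proof (rule mean_le_mono)
      fix w assume "w \<in> space Q"
      show "indicator ?A w \<le> t * (llr (obs w) L - info * L)\<^sup>2"
      proof (cases "w \<in> ?A")
        case True
        then have "llr (obs w) L < H" by simp
        then have "info * L / 2 \<le> info * L - llr (obs w) L" using HL by linarith
        then have "(info * L / 2)\<^sup>2 \<le> (info * L - llr (obs w) L)\<^sup>2"
          using HL Hpos by (intro power_mono) auto
        then have "t * (info * L / 2)\<^sup>2 \<le> t * (llr (obs w) L - info * L)\<^sup>2"
          unfolding power2_commute[of "info * L"] by (intro mult_left_mono) (auto simp: t_def)
        moreover have "t * (info * L / 2)\<^sup>2 = 1"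
          using info Lb(3) by (simp add: t_def power_divide)
        ultimately show ?thesis using True by simp
      qed (simp add: t_def)
    qed (use A in auto)
    then have "prob ?A \<le> t * (C1 * L)" using A by (simp add: mean_le_def)
    also have "\<dots> = 4 * C1 / info\<^sup>2 / L"
      using Lb(3) by (simp add: t_def power2_eq_square)
    also have "\<dots> \<le> C / L"
      using Lb(3) W0 C3 info by (intro divide_right_mono) (auto simp: C_def)
    finally show "prob ?A \<le> C / L" .
  next
    fix H s L assume H: "H \<ge> 4 * info" and s: "s = nat \<lfloor>H / (2 * info)\<rfloor>" and L: "L = nat \<lceil>2 * H / info\<rceil>"
    note Lb = L_bounds[OF H L]
    define n0 where "n0 = H / info"
    have n0: "n0 \<ge> 4" using H info by (simp add: n0_def pos_le_divide_eq)
    have Hn: "H = info * n0" using info by (simp add: n0_def)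
    have Hpos: "H > 0" using Hn n0 info by simp
    have "real s = of_int \<lfloor>n0 / 2\<rfloor>" 
    proof -
      have half: "H / (2 * info) = n0 / 2" by (simp add: n0_def mult.commute)
      show ?thesis unfolding s half using n0 by simp
    qed
    then have sb: "real s \<le> n0 / 2" "n0 / 4 \<le> real s"
      using n0 of_int_floor_le[of "n0 / 2"] floor_correct[of "n0 / 2"] by linarith+
    define q where "q = nat \<lfloor>n0\<rfloor>"
    have qb: "real q \<le> n0" "n0 \<le> real q + 1"
      using n0 floor_correct[of n0] by (auto simp: q_def)
    have "real s < real q + 1" using sb qb n0 by linarith
    then have sq: "s \<le> q" by simp
    have s1: "s \<ge> 1" using sb n0 by (cases s) auto
    have sL: "s \<le> L" using sb Lb(1) n0 unfolding n0_def[symmetric] by linarith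
    have Ls: "real L \<le> 12 * s" using sb Lb(2) unfolding n0_def[symmetric] by linarith
    have L8: "real L \<ge> 8" by (rule Lb(3))
    then have L2: "L \<ge> 2" by simp
    define \<tau> where "\<tau> w = passage H s L (obs w)" for w
    have \<tau>: "bounded_stopping \<tau> L" unfolding \<tau>_def by (rule bounded_stopping_passage[OF sL])
    have \<tau>s: "s \<le> \<tau> w" "\<tau> w \<le> L" for w
      using passage_props[OF sL] by (auto simp: \<tau>_def)
    have over: "llr (obs w) (\<tau> w) - H \<le> (llr (obs w) s - info * s)\<^sup>2 / (2 * H) + \<bar>llr_step (obs w) (\<tau> w)\<bar>"
      "\<bar>llr (obs w) (\<tau> w) - H\<bar> \<le> \<bar>llr (obs w) (\<tau> w) - info * \<tau> w\<bar> + \<bar>llr_step (obs w) (\<tau> w)\<bar>" for w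
    proof -
      have 1: "info * s \<le> H / 2" using mult_left_mono[OF sb(1), of info] info by (simp add: Hn)
      have 2: "H \<le> info * L"
        using mult_left_mono[OF Lb(1), of info] info Hpos by simp
      show "llr (obs w) (\<tau> w) - H \<le> (llr (obs w) s - info * s)\<^sup>2 / (2 * H) + \<bar>llr_step (obs w) (\<tau> w)\<bar>"
        "\<bar>llr (obs w) (\<tau> w) - H\<bar> \<le> \<bar>llr (obs w) (\<tau> w) - info * \<tau> w\<bar> + \<bar>llr_step (obs w) (\<tau> w)\<bar>"
        unfolding \<tau>_def using passage_overshoot[OF s1 sL Hpos 1 2] by blast+
    qed
    have m\<tau>: "(\<lambda>w. real (\<tau> w)) \<in> borel_measurable Q"
      using measurable_stopping[OF \<tau>] by measurable
    \<comment> \<open>The passage time is within order \<open>sqrt H\<close> of \<open>q\<close> in mean square, since the stopped sum is close to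
      both \<open>H\<close> and \<open>info * \<tau>\<close>.\<close>
    have spread: "mean_le (\<lambda>w. (real (\<tau> w) - real q)\<^sup>2) (e * L)"
    proof -
      have "mean_le (\<lambda>w. 3 / info\<^sup>2 * ((4 * (llr (obs w) (\<tau> w) - info * \<tau> w)\<^sup>2 + (\<Sum>j=1..L. (llr_step (obs w) j)\<^sup>2)) + info\<^sup>2))
         (3 / info\<^sup>2 * ((4 * (C1 * L) + (\<Sum>j=1..L. C2)) + info\<^sup>2))"
        using L2 by (intro mean_le_cmult mean_le_add mean_le_sum mean_le_const C1(2) C2(2) \<tau>) auto
      then have "mean_le (\<lambda>w. 3 / info\<^sup>2 * ((4 * (llr (obs w) (\<tau> w) - info * \<tau> w)\<^sup>2 + (\<Sum>j=1..L. (llr_step (obs w) j)\<^sup>2)) + info\<^sup>2)) (e * L)"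
      proof (rule mean_le_weaken)
        have "info\<^sup>2 * 1 \<le> info\<^sup>2 * L" using L2 by (intro mult_left_mono) auto
        then have "(4 * (C1 * L) + (\<Sum>j=1..L. C2)) + info\<^sup>2 \<le> (4 * C1 + C2 + info\<^sup>2) * L"
          by (simp add: algebra_simps)
        then have "3 / info\<^sup>2 * ((4 * (C1 * L) + (\<Sum>j=1..L. C2)) + info\<^sup>2) \<le> 3 / info\<^sup>2 * ((4 * C1 + C2 + info\<^sup>2) * L)"
          by (intro mult_left_mono) auto
        then show "3 / info\<^sup>2 * ((4 * (C1 * L) + (\<Sum>j=1..L. C2)) + info\<^sup>2) \<le> e * L"
          by (simp only: e_def mult.assoc)
      qed
      then show ?thesis
      proof (rule mean_le_mono)
        fix w
        define d where "d = llr (obs w) (\<tau> w) - info * \<tau> w"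
        define x where "x = llr_step (obs w) (\<tau> w)"
        have "\<bar>info * (real (\<tau> w) - real q)\<bar> \<le> 2 * \<bar>d\<bar> + \<bar>x\<bar> + info"
        proof -
          have "info * real q \<le> H" "H \<le> info * real q + info"
            using mult_left_mono[OF qb(1), of info] mult_left_mono[OF qb(2), of info] info
            by (simp_all add: Hn algebra_simps)
          then have "\<bar>H - info * real q\<bar> \<le> info" by linarith
          moreover have "\<bar>u - v\<bar> \<le> 2 * \<bar>S - u\<bar> + f + e" if "\<bar>S - h\<bar> \<le> \<bar>S - u\<bar> + f" "\<bar>h - v\<bar> \<le> e"
            for u v S h e f :: real
          proof -
            have "\<bar>u - v\<bar> \<le> \<bar>S - u\<bar> + \<bar>S - h\<bar> + \<bar>h - v\<bar>" by arith
            also have "\<dots> \<le> \<bar>S - u\<bar> + (\<bar>S - u\<bar> + f) + e" using that by (intro add_mono) auto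
            finally show ?thesis by simp
          qed
          ultimately show ?thesis using over(2)[of w] unfolding d_def x_def right_diff_distrib by blast
        qed
        then have "(info * (real (\<tau> w) - real q))\<^sup>2 \<le> (2 * \<bar>d\<bar> + \<bar>x\<bar> + info)\<^sup>2"
          using info by (metis abs_ge_zero power2_abs power_mono)
        also have "\<dots> \<le> 3 * ((4 * d\<^sup>2 + x\<^sup>2) + info\<^sup>2)"
        proof -
          have "(2 * p + v + u)\<^sup>2 \<le> 3 * ((4 * p\<^sup>2 + v\<^sup>2) + u\<^sup>2)" for p u v :: real
            using zero_le_power2[of "2 * p - v"] zero_le_power2[of "2 * p - u"] zero_le_power2[of "u - v"]
            by (simp add: power2_eq_square algebra_simps)
          from this[of "\<bar>d\<bar>" "\<bar>x\<bar>" info] show ?thesis by simp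
        qed
        also have "x\<^sup>2 \<le> (\<Sum>j=1..L. (llr_step (obs w) j)\<^sup>2)"
          unfolding x_def by (rule member_le_sum) (use \<tau>s[of w] s1 in auto)
        finally have "info\<^sup>2 * (real (\<tau> w) - real q)\<^sup>2 \<le> 3 * ((4 * d\<^sup>2 + (\<Sum>j=1..L. (llr_step (obs w) j)\<^sup>2)) + info\<^sup>2)"
          by (simp add: power_mult_distrib)
        then show "(real (\<tau> w) - real q)\<^sup>2 \<le> 3 / info\<^sup>2 * ((4 * (llr (obs w) (\<tau> w) - info * \<tau> w)\<^sup>2 + (\<Sum>j=1..L. (llr_step (obs w) j)\<^sup>2)) + info\<^sup>2)"
          using info by (simp add: d_def pos_le_divide_eq mult.commute)
      qed (use m\<tau> in auto)
    qed
    have "\<exists>g. mean_le g (\<bar>\<alpha> k\<bar> / 2 * (12 * e + 24)) \<and> (\<forall>w\<in>space Q. \<alpha> k * (\<Sum>j=1..\<tau> w. dev (obs w) k j) \<le> g w)"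
      if k: "k \<in> {1..K}" for k
    proof -
      obtain g where g: "mean_le g (\<bar>\<alpha> k\<bar> / 2 * ((e * L + (real L + 1)) / s))"
        "\<And>w. w \<in> space Q \<Longrightarrow> \<alpha> k * (\<Sum>j=1..\<tau> w. dev (obs w) k j) \<le> g w"
        using linear_drift_bound[OF k \<tau> s1 \<tau>s(1) sq spread] by metis
      have "e * L + (real L + 1) \<le> e * (12 * s) + 24 * s"
        using mult_left_mono[OF Ls e0] Ls s1 by linarith
      then have "(e * L + (real L + 1)) / s \<le> 12 * e + 24"
        using s1 by (simp add: divide_le_eq algebra_simps)
      then have "\<bar>\<alpha> k\<bar> / 2 * ((e * L + (real L + 1)) / s) \<le> \<bar>\<alpha> k\<bar> / 2 * (12 * e + 24)"
        by (intro mult_left_mono) auto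
      with g show ?thesis by (meson mean_le_weaken)
    qed
    then obtain g where g: "\<And>k. k \<in> {1..K} \<Longrightarrow> mean_le (g k) (\<bar>\<alpha> k\<bar> / 2 * (12 * e + 24))"
      "\<And>k w. k \<in> {1..K} \<Longrightarrow> w \<in> space Q \<Longrightarrow> \<alpha> k * (\<Sum>j=1..\<tau> w. dev (obs w) k j) \<le> g k w"
      by metis
    let ?y = "\<lambda>k j w. dev (obs w) k j"
    let ?M = "\<lambda>k w. \<Sum>j=1..L. alive \<tau> j w * (est (obs w) k j * noise k j w)"
    define D where "D k w = (if \<bar>\<mu> k\<bar> > \<omega> k then g k w + a\<^sup>2 / 2 * (\<Sum>j=1..L. (?y k j w)\<^sup>2) else 0)
        + C4 * (\<Sum>j=1..L. ?y k j w ^ 4)" for k w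
    define d where "d k = (if \<bar>\<mu> k\<bar> > \<omega> k then \<bar>\<alpha> k\<bar> / 2 * (12 * e + 24) + a\<^sup>2 / 2 * (3 + ln n0) else 0) + C4 * 6" for k
    have harmL: "(\<Sum>j=1..L. 1 / real j) \<le> 3 + ln n0"
    proof -
      have "(\<Sum>j=1..L. 1 / real j) = harm L" by (simp add: harm_def inverse_eq_divide)
      also have "\<dots> \<le> 1 + ln (real L)" using L2 by (intro harm_le) auto
      also have "ln (real L) \<le> ln (3 * n0)" using Lb n0 unfolding n0_def[symmetric] by simp
      also have "ln (3 * n0) = ln 3 + ln n0" using n0 by (simp add: ln_mult)
      finally show ?thesis using ln_le_minus_one[of "3::real"] by simp
    qed
    have D: "mean_le (D k) (d k)" if k: "k \<in> {1..K}" for k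
    proof -
      have "mean_le (\<lambda>w. \<Sum>j=1..L. (?y k j w)\<^sup>2) (\<Sum>j=1..L. 1 / real j)"
        by (intro mean_le_sum mean_le_dev_square k) auto
      then have 2: "mean_le (\<lambda>w. \<Sum>j=1..L. (?y k j w)\<^sup>2) (3 + ln n0)"
        using harmL by (rule mean_le_weaken)
      have "mean_le (\<lambda>w. \<Sum>j=1..L. ?y k j w ^ 4) (\<Sum>j=1..L. 3 / (real j)\<^sup>2)"
        by (intro mean_le_sum mean_le_dev_fourth k) auto
      moreover have "(\<Sum>j=1..L. 3 / (real j)\<^sup>2) \<le> 6"
        using sum_inverse_squares_le[of L] sum_distrib_left[of 3 "\<lambda>j. 1 / (real j)\<^sup>2" "{1..L}"] by simp
      ultimately have 4: "mean_le (\<lambda>w. \<Sum>j=1..L. ?y k j w ^ 4) 6" by (rule mean_le_weaken)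
      show ?thesis
      proof (cases "\<bar>\<mu> k\<bar> > \<omega> k")
        case True
        then show ?thesis unfolding D_def[abs_def] d_def
          using C4(1) by (simp only: if_True) (intro mean_le_add mean_le_cmult g(1) k 2 4, auto)
      next
        case False
        then show ?thesis unfolding D_def[abs_def] d_def
          using C4(1) by (simp only: if_False) (intro mean_le_add mean_le_const mean_le_cmult k 2 4, auto)
      qed
    qed
    have M: "mean_le (\<lambda>w. - ?M k w) 0" if k: "k \<in> {1..K}" for k
      using expectation_stopped_sum[OF \<tau> k, of 1 "\<lambda>j w. est (obs w) k j"] measurable_est_past[OF k] integrable_est[OF k]
      by (intro mean_leI) auto
    let ?v = "\<lambda>w. (llr (obs w) s - info * s)\<^sup>2"
    have "mean_le (\<lambda>w. H + (1 / (2 * H) * ?v w + \<bar>llr_step (obs w) (\<tau> w)\<bar>) + (\<Sum>k=1..K. D k w + - ?M k w))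
      (H + (1 / (2 * H) * (C1 * s) + C3 * sqrt (2 * ln (real L))) + (\<Sum>k=1..K. d k + 0))"
      using Hpos s1 \<tau>s(1) L2
      by (intro mean_le_add mean_le_const mean_le_cmult mean_le_sum D M C1(2) C3(2) \<tau> bounded_stopping_const)
        (auto intro: order_trans)
    from mean_le_cmult[OF this, of "1 / info"]
    have "mean_le (\<lambda>w. 1 / info * (H + (1 / (2 * H) * ?v w + \<bar>llr_step (obs w) (\<tau> w)\<bar>) + (\<Sum>k=1..K. D k w + - ?M k w)))
      (1 / info * (H + (1 / (2 * H) * (C1 * s) + C3 * sqrt (2 * ln (real L))) + (\<Sum>k=1..K. d k + 0)))"
      using info by simp
    then have "mean_le (\<lambda>w. real (\<tau> w))
      (1 / info * (H + (1 / (2 * H) * (C1 * s) + C3 * sqrt (2 * ln (real L))) + (\<Sum>k=1..K. d k + 0)))"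
    proof (rule mean_le_mono)
      fix w assume w: "w \<in> space Q"
      have def: "(\<Sum>j=1..\<tau> w. deficit k j w) \<le> D k w" if k: "k \<in> {1..K}" for k
      proof -
        have "(\<Sum>j=1..\<tau> w. deficit k j w) \<le> (\<Sum>j=1..\<tau> w. (if \<bar>\<mu> k\<bar> > \<omega> k then \<alpha> k * ?y k j w + a\<^sup>2 / 2 * (?y k j w)\<^sup>2 else 0)
          + C4 * ?y k j w ^ 4)"
          unfolding deficit_def \<alpha>_def by (intro sum_mono C4(2) k) auto
        also have "\<dots> = (if \<bar>\<mu> k\<bar> > \<omega> k then \<alpha> k * (\<Sum>j=1..\<tau> w. ?y k j w) + a\<^sup>2 / 2 * (\<Sum>j=1..\<tau> w. (?y k j w)\<^sup>2) else 0)
          + C4 * (\<Sum>j=1..\<tau> w. ?y k j w ^ 4)"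
          by (cases "\<bar>\<mu> k\<bar> > \<omega> k") (simp_all add: sum.distrib sum_distrib_left)
        also have "\<dots> \<le> D k w"
        proof -
          have 2: "a\<^sup>2 / 2 * (\<Sum>j=1..\<tau> w. (?y k j w)\<^sup>2) \<le> a\<^sup>2 / 2 * (\<Sum>j=1..L. (?y k j w)\<^sup>2)"
            using \<tau>s[of w] by (intro mult_left_mono sum_mono2) auto
          have 4: "C4 * (\<Sum>j=1..\<tau> w. ?y k j w ^ 4) \<le> C4 * (\<Sum>j=1..L. ?y k j w ^ 4)"
            using \<tau>s[of w] C4(1) by (intro mult_left_mono sum_mono2) auto
          show ?thesis unfolding D_def using 2 4 g(2)[OF k w] by (cases "\<bar>\<mu> k\<bar> > \<omega> k") auto
        qed
        finally show ?thesis .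
      qed
      have "llr (obs w) (\<tau> w) = info * \<tau> w + (\<Sum>j=1..\<tau> w. \<Sum>k=1..K. est (obs w) k j * noise k j w - deficit k j w)"
        by (simp add: llr_def llr_step_eq sum.distrib)
      also have "(\<Sum>j=1..\<tau> w. \<Sum>k=1..K. est (obs w) k j * noise k j w - deficit k j w) =
          (\<Sum>k=1..K. ?M k w - (\<Sum>j=1..\<tau> w. deficit k j w))"
        by (subst sum.swap) (simp only: sum_subtractf sum_stopped[of \<tau> w L, OF \<tau>s(2)])
      finally have "info * \<tau> w = llr (obs w) (\<tau> w) + (\<Sum>k=1..K. (\<Sum>j=1..\<tau> w. deficit k j w) + - ?M k w)"
        by (simp add: sum_subtractf)
      also have "\<dots> \<le> (H + (1 / (2 * H) * ?v w + \<bar>llr_step (obs w) (\<tau> w)\<bar>)) + (\<Sum>k=1..K. D k w + - ?M k w)"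
        using over(1)[of w] by (intro add_mono sum_mono def) auto
      finally have "info * \<tau> w \<le> (H + (1 / (2 * H) * ?v w + \<bar>llr_step (obs w) (\<tau> w)\<bar>)) + (\<Sum>k=1..K. D k w + - ?M k w)" .
      then show "real (\<tau> w) \<le> 1 / info * (H + (1 / (2 * H) * ?v w + \<bar>llr_step (obs w) (\<tau> w)\<bar>) + (\<Sum>k=1..K. D k w + - ?M k w))"
        using info by (simp add: pos_le_divide_eq mult.commute)
    qed (use m\<tau> in auto)
    then show "mean_le (\<lambda>w. real (passage H s L (obs w)))
        (H / info + real r * a\<^sup>2 / (2 * info) * ln (H / info) + C * sqrt (ln (real L)))"
      unfolding \<tau>_def[symmetric]
    proof (rule mean_le_weaken)
      define l where "l = sqrt (ln (real L))"
      have "exp 1 \<le> real L" using exp_le L8 by linarith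
      then have "1 \<le> ln (real L)" using L2 by (intro ln_ge_iff[THEN iffD2]) auto
      then have l1: "1 \<le> l" by (simp add: l_def)
      have sl: "sqrt (2 * ln (real L)) = sqrt 2 * l" by (simp add: l_def real_sqrt_mult)
      have "1 / (2 * H) * (C1 * s) \<le> 1 / (2 * H) * (C1 * (n0 / 2))"
        using sb C1 Hpos by (intro mult_left_mono) auto
      also have "\<dots> = C1 / (4 * info)" using n0 info by (simp add: Hn)
      finally have 1: "1 / (2 * H) * (C1 * s) \<le> C1 / (4 * info)" .
      have 2: "(\<Sum>k=1..K. d k + 0) \<le> (\<Sum>k=1..K. \<bar>\<alpha> k\<bar> / 2 * (12 * e + 24)) + real r * (a\<^sup>2 / 2 * (3 + ln n0)) + real K * (C4 * 6)"
      proof -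
        have ab: "0 \<le> \<bar>\<alpha> k\<bar> / 2 * (12 * e + 24)" for k using e0 by simp
        have "(\<Sum>k=1..K. d k + 0) \<le> (\<Sum>k=1..K. \<bar>\<alpha> k\<bar> / 2 * (12 * e + 24) + (if \<bar>\<mu> k\<bar> > \<omega> k then a\<^sup>2 / 2 * (3 + ln n0) else 0) + C4 * 6)"
          using ab by (intro sum_mono) (auto simp: d_def)
        also have "\<dots> = (\<Sum>k=1..K. \<bar>\<alpha> k\<bar> / 2 * (12 * e + 24)) + (\<Sum>k=1..K. if \<bar>\<mu> k\<bar> > \<omega> k then a\<^sup>2 / 2 * (3 + ln n0) else 0) + real K * (C4 * 6)"
          by (simp add: sum.distrib)
        also have "(\<Sum>k=1..K. if \<bar>\<mu> k\<bar> > \<omega> k then a\<^sup>2 / 2 * (3 + ln n0) else 0) = real r * (a\<^sup>2 / 2 * (3 + ln n0))"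
          unfolding r_def by (subst sum.inter_filter[symmetric]) auto
        finally show ?thesis .
      qed
      have "H + (1 / (2 * H) * (C1 * s) + C3 * sqrt (2 * ln (real L))) + (\<Sum>k=1..K. d k + 0)
        \<le> H + real r * (a\<^sup>2 / 2 * ln n0) + W + C3 * sqrt 2 * l"
      proof -
        have "real r * (a\<^sup>2 / 2 * (3 + ln n0)) = real r * (a\<^sup>2 / 2 * 3) + real r * (a\<^sup>2 / 2 * ln n0)"
          by (simp only: distrib_left)
        moreover have "C3 * sqrt (2 * ln (real L)) = C3 * sqrt 2 * l" by (simp add: sl)
        ultimately show ?thesis using 1 2 unfolding W_def by linarith
      qed
      also have "W \<le> W * l" using l1 W0 by (simp add: mult_le_cancel_left1)
      also have "H + real r * (a\<^sup>2 / 2 * ln n0) + W * l + C3 * sqrt 2 * l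
          = info * (n0 + real r * a\<^sup>2 / (2 * info) * ln n0 + (W + C3 * sqrt 2) / info * l)"
        using info by (simp add: Hn field_simps)
      also have "\<dots> \<le> info * (n0 + real r * a\<^sup>2 / (2 * info) * ln n0 + C * l)"
        using info l1 C1(1) by (intro mult_left_mono add_left_mono mult_right_mono) (auto simp: C_def)
      finally show "1 / info * (H + (1 / (2 * H) * (C1 * s) + C3 * sqrt (2 * ln (real L))) + (\<Sum>k=1..K. d k + 0))
        \<le> H / info + real r * a\<^sup>2 / (2 * info) * ln (H / info) + C * sqrt (ln (real L))"
        using info by (simp add: n0_def l_def pos_divide_le_eq mult.commute)
    qed
  qed (rule \<open>C > 0\<close>)
qed

end

section \<open>Bounding an essential supremum of conditional expectations\<close>

text \<open>
  It suffices to test with the event \<open>A\<close> that the conditional expectation exceeds \<open>c\<close>. It belongs to \<open>F\<close>, so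
  the integral of the conditional expectation over \<open>A\<close> is that of \<open>f\<close>, which is at most \<open>c\<close> times the
  measure of \<open>A\<close>. The two degenerate cases, a null event \<open>E\<close> and a function that is not measurable, are
  covered: there the conditioned measure or the conditional expectation is \<open>0\<close>.
\<close>

lemma esssup_nn_cond_exp_le:
  assumes N: "prob_space N" and F: "subalgebra N F" and E: "E \<in> sets F"
    and le: "\<And>w. w \<in> E \<Longrightarrow> f w \<le> g w"
    and bound: "\<And>A. A \<in> sets F \<Longrightarrow> (\<integral>\<^sup>+ w. indicator A w * g w \<partial>N) \<le> ennreal c * emeasure N A"
  shows "esssup (uniform_measure N E) (nn_cond_exp (uniform_measure N E) F f) \<le> ennreal c"
proof (rule esssup_I)
  let ?Q = "uniform_measure N E" and ?c = "ennreal c"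
  interpret N: prob_space N by (rule N)
  have EN: "E \<in> sets N" using E F by (auto simp: subalgebra_def)
  show "nn_cond_exp ?Q F f \<in> borel_measurable ?Q" by (rule borel_measurable_nn_cond_exp2)
  show "AE w in ?Q. nn_cond_exp ?Q F f w \<le> ?c"
  proof (cases "emeasure N E = 0 \<or> f \<notin> borel_measurable ?Q")
    case True
    then show ?thesis
    proof
      assume "emeasure N E = 0"
      then have "E \<in> null_sets N" using EN by auto
      from AE_not_in[OF this] show ?thesis
        by (intro AE_uniform_measureI[OF EN]) (auto elim: eventually_mono)
    next
      assume "f \<notin> borel_measurable ?Q"
      then have "nn_cond_exp ?Q F f = (\<lambda>_. 0)" by (simp add: nn_cond_exp_def)
      then show ?thesis by simp
    qed
  next
    case False
    then have E0: "emeasure N E \<noteq> 0" and f: "f \<in> borel_measurable ?Q" by auto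
    interpret Q: prob_space ?Q
      by (rule prob_space_uniform_measure) (use E0 in \<open>auto simp: N.emeasure_eq_measure\<close>)
    interpret finite_measure_subalgebra ?Q F
      by unfold_locales (use F in \<open>auto simp: subalgebra_def\<close>)
    let ?e = "nn_cond_exp ?Q F f"
    define A where "A = {w \<in> space F. ?c < ?e w}"
    have eF: "?e \<in> borel_measurable F" by (rule borel_measurable_nn_cond_exp)
    then have A: "A \<in> sets F" unfolding A_def by measurable
    have AN: "A \<in> sets N" using A F by (auto simp: subalgebra_def)
    have eN: "?e \<in> borel_measurable N"
      using borel_measurable_nn_cond_exp2[of ?Q F f] by simp
    have fN: "f \<in> borel_measurable N" using f by simp
    have "(\<integral>\<^sup>+ w. indicator A w * ?e w \<partial>?Q) = (\<integral>\<^sup>+ w. indicator A w * f w \<partial>?Q)"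
      by (rule nn_cond_exp_intg) (use A f in auto)
    also have "\<dots> = (\<integral>\<^sup>+ w. indicator A w * f w * indicator E w \<partial>N) / emeasure N E"
      by (rule nn_integral_uniform_measure) (use AN fN EN in auto)
    also have "\<dots> \<le> (\<integral>\<^sup>+ w. indicator (A \<inter> E) w * g w \<partial>N) / emeasure N E"
      by (intro divide_right_mono_ennreal nn_integral_mono) (use le in \<open>auto split: split_indicator\<close>)
    also have "\<dots> \<le> (?c * emeasure N (A \<inter> E)) / emeasure N E"
      by (intro divide_right_mono_ennreal bound sets.Int A E)
    also have "\<dots> = ?c * emeasure ?Q A"
      using AN EN by (simp add: ennreal_times_divide Int_commute)
    finally have le: "(\<integral>\<^sup>+ w. indicator A w * ?e w \<partial>?Q) \<le> ?c * emeasure ?Q A" .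
    have "(\<integral>\<^sup>+ w. indicator A w * ?e w \<partial>?Q) = (\<integral>\<^sup>+ w. indicator A w * (?e w - ?c) + ?c * indicator A w \<partial>?Q)"
      by (intro nn_integral_cong) (auto simp: A_def diff_add_self_ennreal split: split_indicator)
    also have "\<dots> = (\<integral>\<^sup>+ w. indicator A w * (?e w - ?c) \<partial>?Q) + ?c * emeasure ?Q A"
      using AN eN by (subst nn_integral_add) (auto simp: nn_integral_cmult_indicator)
    finally have "(\<integral>\<^sup>+ w. indicator A w * (?e w - ?c) \<partial>?Q) + ?c * emeasure ?Q A \<le> 0 + ?c * emeasure ?Q A"
      using le by simp
    moreover have "?c * emeasure ?Q A \<noteq> top"
      by (simp add: ennreal_mult_eq_top_iff Q.emeasure_eq_measure)
    ultimately have "(\<integral>\<^sup>+ w. indicator A w * (?e w - ?c) \<partial>?Q) = 0"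
      by (simp add: ennreal_add_left_cancel_le add.commute)
    then have "AE w in ?Q. indicator A w * (?e w - ?c) = 0"
      using AN eN by (subst (asm) nn_integral_0_iff_AE) auto
    moreover have "AE w in ?Q. w \<in> space F" using F by (auto simp: subalgebra_def)
    ultimately show ?thesis
    proof eventually_elim
      case (elim w)
      show "?e w \<le> ?c"
      proof (rule ccontr)
        assume n: "\<not> ?e w \<le> ?c"
        then have "w \<in> A" using elim(2) by (simp add: A_def)
        then have "?e w - ?c = 0" using elim(1) by simp
        with n show False by (simp add: ennreal_minus_eq_0)
      qed
    qed
  qed
qed

section \<open>All laws of the observations after the change agree\<close>

lemma (in prob_space) indep_vars_reindex_inj:
  assumes X: "indep_vars M' X I" and f: "inj_on f J" "f ` J \<subseteq> I"
  shows "indep_vars (\<lambda>j. M' (f j)) (\<lambda>j. X (f j)) J"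
  unfolding indep_vars_def2
proof (intro conjI ballI)
  show "random_variable (M' (f j)) (X (f j))" if "j \<in> J" for j
    using X f that by (auto simp: indep_vars_def2)
  let ?E = "\<lambda>i. {X i -` A \<inter> space M | A. A \<in> sets (M' i)}"
  have E: "indep_sets ?E I" using X by (simp add: indep_vars_def2)
  show "indep_sets (\<lambda>j. ?E (f j)) J"
  proof (rule indep_setsI)
    show "?E (f j) \<subseteq> events" if "j \<in> J" for j
      using E that f by (auto simp: indep_sets_def)
    fix A G assume G: "G \<noteq> {}" "G \<subseteq> J" "finite G" and A: "\<forall>j\<in>G. A j \<in> ?E (f j)"
    have inj: "inj_on f G" using f(1) G(2) by (rule inj_on_subset)
    let ?A = "\<lambda>i. A (the_inv_into G f i)"
    have inv: "the_inv_into G f (f j) = j" if "j \<in> G" for j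
      using the_inv_into_f_f[OF inj that] .
    have "prob (\<Inter>i\<in>f ` G. ?A i) = (\<Prod>i\<in>f ` G. prob (?A i))"
    proof (rule indep_setsD[OF E])
      show "f ` G \<subseteq> I" using G(2) f(2) by blast
      show "\<forall>i\<in>f ` G. ?A i \<in> ?E i" using A by (simp add: inv)
    qed (use G in auto)
    then show "prob (\<Inter>j\<in>G. A j) = (\<Prod>j\<in>G. prob (A j))"
      by (simp add: prod.reindex[OF inj] inv)
  qed
qed

context shrinkage
begin

lemma llr_cong:
  assumes "\<And>k i. k \<in> {1..K} \<Longrightarrow> y k i = z k i" shows "llr y n = llr z n"
proof -
  have "est y k j = est z k j" if "k \<in> {1..K}" for k j
    using assms[OF that] by (simp add: est_def shrink_est_def window_mean_def)
  then show ?thesis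
    unfolding llr_def llr_step_def by (intro sum.cong refl) (use assms in auto)
qed

lemma passage_cong:
  assumes "\<And>k i. k \<in> {1..K} \<Longrightarrow> y k i = z k i" shows "passage H s L y = passage H s L z"
  unfolding passage_def using llr_cong[of y z, OF assms] by simp

text \<open>
  The common law of the observations from any time after the change on. Constants obtained for one instance
  of \<open>normal_streams\<close> carry over to all others because the two quantities below depend on this law only.
\<close>

definition obs_law :: "(nat \<times> nat \<Rightarrow> real) measure" where
  "obs_law = PiM ({1..K} \<times> UNIV) (\<lambda>(k, i). density lborel (normal_density (\<mu> k) 1))"

definition mean_passage :: "real \<Rightarrow> nat \<Rightarrow> nat \<Rightarrow> real" where
  "mean_passage H s L = (\<integral>y. real (passage H s L (\<lambda>k i. y (k, i))) \<partial>obs_law)"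

definition miss_prob :: "real \<Rightarrow> nat \<Rightarrow> real" where
  "miss_prob H L = measure obs_law {y \<in> space obs_law. llr (\<lambda>k i. y (k, i)) L < H}"

end

context normal_streams
begin

lemma distr_obs:
  assumes "K \<ge> 1"
  shows "distr Q (PiM ({1..K} \<times> UNIV) (\<lambda>_. borel)) (\<lambda>w. \<lambda>p\<in>{1..K} \<times> UNIV. (case p of (k, i) \<Rightarrow> x k i) w) = obs_law"
proof -
  have "distr Q (PiM ({1..K} \<times> UNIV) (\<lambda>_. borel)) (\<lambda>w. \<lambda>p\<in>{1..K} \<times> UNIV. (case p of (k, i) \<Rightarrow> x k i) w) =
      PiM ({1..K} \<times> UNIV) (\<lambda>p. distr Q borel (case p of (k, i) \<Rightarrow> x k i))"
    by (rule indep_vars_iff_distr_eq_PiM'[THEN iffD1, OF _ _ indep_obs])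
      (use assms measurable_obs in auto)
  also have "\<dots> = obs_law"
    unfolding obs_law_def
  proof (rule PiM_cong)
    fix p assume "p \<in> {1..K} \<times> (UNIV :: nat set)"
    then obtain k i where p: "p = (k, i)" "k \<in> {1..K}" by auto
    have "distr Q borel (x k i) = distr Q lborel (x k i)" by (rule distr_cong) auto
    also have "\<dots> = density lborel (normal_density (\<mu> k) 1)"
      using distributed_distr_eq_density[OF normal_obs[OF p(2)]] .
    finally show "distr Q borel (case p of (k, i) \<Rightarrow> x k i) = (case p of (k, i) \<Rightarrow> density lborel (normal_density (\<mu> k) 1))"
      by (simp add: p)
  qed simp
  finally show ?thesis .
qed

lemma
  assumes K: "K \<ge> 1"
  shows expectation_passage: "s \<le> L \<Longrightarrow> expectation (\<lambda>w. real (passage H s L (obs w))) = mean_passage H s L"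
    and prob_miss: "prob {w \<in> space Q. llr (obs w) L < H} = miss_prob H L"
proof -
  let ?J = "{1..K} \<times> (UNIV :: nat set)"
  let ?X = "\<lambda>w. \<lambda>p\<in>?J. (case p of (k, i) \<Rightarrow> x k i) w"
  let ?B = "PiM ?J (\<lambda>_. borel :: real measure)"
  have X: "?X \<in> measurable Q ?B"
    by (intro measurable_restrict) (use measurable_obs in auto)
  have coord: "(\<lambda>y. y (k, i)) \<in> borel_measurable ?B" if "k \<in> {1..K}" for k i
    by (rule measurable_component_singleton) (use that in auto)
  have llrB: "(\<lambda>y. llr (\<lambda>k i. y (k, i)) n) \<in> borel_measurable ?B" for n
    by (intro measurable_llr coord)
  have law: "obs_law = distr Q ?B ?X" using distr_obs[OF K] by simp
  have same: "llr (\<lambda>k i. ?X w (k, i)) n = llr (obs w) n"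
    "passage H s L (\<lambda>k i. ?X w (k, i)) = passage H s L (obs w)" for w n H s L
    by (auto intro!: llr_cong passage_cong simp: obs_def)
  show "expectation (\<lambda>w. real (passage H s L (obs w))) = mean_passage H s L" if sL: "s \<le> L"
  proof -
    have "(\<lambda>y. passage H s L (\<lambda>k i. y (k, i))) \<in> measurable ?B (count_space UNIV)"
    proof (rule measurable_count_space_eq_countable[THEN iffD2], safe)
      fix j
      have ev: "{y \<in> space ?B. i \<le> passage H s L (\<lambda>k i. y (k, i))} \<in> sets ?B" for i
        by (rule sets_le_passage[OF sL]) (rule llrB)
      have "(\<lambda>y. passage H s L (\<lambda>k i. y (k, i))) -` {j} \<inter> space ?B =
          {y \<in> space ?B. j \<le> passage H s L (\<lambda>k i. y (k, i))} - {y \<in> space ?B. Suc j \<le> passage H s L (\<lambda>k i. y (k, i))}"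
        by auto
      then show "(\<lambda>y. passage H s L (\<lambda>k i. y (k, i))) -` {j} \<inter> space ?B \<in> sets ?B"
        using sets.Diff[OF ev[of j] ev[of "Suc j"]] by simp
    qed auto
    then have "(\<lambda>y. real (passage H s L (\<lambda>k i. y (k, i)))) \<in> borel_measurable ?B" by measurable
    from integral_distr[OF X this] show ?thesis
      unfolding mean_passage_def law same by simp
  qed
  have "{y \<in> space ?B. llr (\<lambda>k i. y (k, i)) L < H} \<in> sets ?B" using llrB[of L] by measurable
  then have "measure obs_law {y \<in> space ?B. llr (\<lambda>k i. y (k, i)) L < H} =
      prob (?X -` {y \<in> space ?B. llr (\<lambda>k i. y (k, i)) L < H} \<inter> space Q)"
    unfolding law by (rule measure_distr[OF X])
  also have "?X -` {y \<in> space ?B. llr (\<lambda>k i. y (k, i)) L < H} \<inter> space Q = {w \<in> space Q. llr (obs w) L < H}"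
    using measurable_space[OF X] same(1) by auto
  finally show "prob {w \<in> space Q. llr (obs w) L < H} = miss_prob H L"
    unfolding miss_prob_def by (simp add: law)
qed

end

section \<open>Reduction of the detection delay to the first passage time\<close>

text \<open>
  Under the law with change-point \<open>\<nu>\<close>, each block may be started at any time \<open>m \<ge> \<nu>\<close>.
\<close>

lemma normal_streams_shift:
  assumes model: "change_point_model M P K \<mu> X" and sh: "shrinkage \<omega> \<mu> K" and \<nu>: "1 \<le> \<nu>" "\<nu> \<le> m"
  shows "normal_streams \<omega> \<mu> K (P \<nu>) (\<lambda>k i. X k (m + i))"
proof -
  have P: "prob_space (P \<nu>)"
    and ind: "prob_space.indep_vars (P \<nu>) (\<lambda>_. borel) (\<lambda>(k, n). X k n) ({1..K} \<times> {1..})"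
    and norm: "\<And>k n. k \<in> {1..K} \<Longrightarrow> n \<ge> 1 \<Longrightarrow>
      distributed (P \<nu>) lborel (X k n) (normal_density (if n < \<nu> then 0 else \<mu> k) 1)"
    using model \<nu> by (auto simp: change_point_model_def)
  interpret prob_space "P \<nu>" by (rule P)
  interpret shrinkage 0 0 0 \<omega> \<mu> K by (rule sh)
  show ?thesis
  proof unfold_locales
    have "indep_vars (\<lambda>j. borel) (\<lambda>j. (case (case j of (k, i) \<Rightarrow> (k, m + i)) of (k, n) \<Rightarrow> X k n)) ({1..K} \<times> UNIV)"
      by (rule indep_vars_reindex_inj[OF ind]) (use \<nu> in \<open>auto simp: inj_on_def\<close>)
    then show "indep_vars (\<lambda>_. borel) (\<lambda>(k, i). X k (m + i)) ({1..K} \<times> UNIV)"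
      by (simp add: case_prod_unfold)
    show "distributed (P \<nu>) lborel (X k (m + i)) (normal_density (\<mu> k) 1)" if "k \<in> {1..K}" for k i
      using norm[OF that, of "m + i"] \<nu> by simp
  qed
qed

context shrinkage
begin

lemma srrs_stat_eq:
  "srrs_stat a b c \<omega> K y n = (\<Sum>m=1..n. exp (llr (\<lambda>k i. y k (m + i)) (n - m)))"
  unfolding srrs_stat_def
proof (rule sum.cong)
  fix m assume "m \<in> {1..n}"
  then show "srrs_lr a b c \<omega> K y n m = exp (llr (\<lambda>k i. y k (m + i)) (n - m))"
    using srrs_lr_shift[of y m "n - m"] by simp
qed simp

lemma srrs_time_le:
  assumes "1 \<le> m" "B > 0" "ln B \<le> llr (\<lambda>k i. y k (m + i)) n"
  shows "srrs_time a b c \<omega> K B y \<le> enat (m + n)"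
proof -
  have "B \<le> exp (llr (\<lambda>k i. y k (m + i)) n)"
    using assms by (simp add: ln_le_cancel_iff[symmetric] ln_ge_iff)
  also have "\<dots> = exp (llr (\<lambda>k i. y k (m + i)) (m + n - m))" by simp
  also have "\<dots> \<le> srrs_stat a b c \<omega> K y (m + n)"
    unfolding srrs_stat_eq
    by (rule member_le_sum[of m "{1..m + n}" "\<lambda>m'. exp (llr (\<lambda>k i. y k (m' + i)) (m + n - m'))"]) (use assms in auto)
  finally show ?thesis
    unfolding srrs_time_def using assms(1) by (intro INF_lower) auto
qed

lemma le_srrs_time_iff:
  "enat \<nu> \<le> srrs_time a b c \<omega> K B y \<longleftrightarrow> (\<forall>n\<in>{1..<\<nu>}. srrs_stat a b c \<omega> K y n < B)"
  unfolding srrs_time_def by (auto simp: le_INF_iff not_le[symmetric])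

end

text \<open>
  Block \<open>l\<close> consists of the \<open>L + 1\<close> observations from time \<open>\<nu> + l * (L + 1)\<close> on, and it is missed if the
  likelihood ratio started with it is below \<open>B\<close> at its end. The scheme stops at the latest during the first block that is
  not missed, and each missed block before it delays the alarm by \<open>L + 1\<close>. The first block contributes its
  passage time, which is \<open>L\<close> if that block is missed without an earlier crossing. If all blocks are missed,
  the series is infinite.
\<close>

lemma (in shrinkage) delay_le:
  fixes y :: "nat \<Rightarrow> nat \<Rightarrow> real" and L s \<nu> :: nat
  assumes sL: "s \<le> L" and B: "B > 0" and \<nu>: "1 \<le> \<nu>"
  defines "T \<equiv> srrs_time a b c \<omega> K B y"
  defines "miss \<equiv> \<lambda>l. llr (\<lambda>k i. y k (\<nu> + l * Suc L + i)) L < ln B"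
  shows "ennreal_of_enat (T + 1 - enat \<nu>) \<le>
    ennreal (1 + real (passage (ln B) s L (\<lambda>k i. y k (\<nu> + i)))) +
      ennreal (real (Suc L)) * (\<Sum>i. if \<forall>l\<le>i. miss l then 1 else 0)"
proof -
  let ?n = "passage (ln B) s L (\<lambda>k i. y k (\<nu> + i))"
  have conv: "ennreal_of_enat (T + 1 - enat \<nu>) \<le> ennreal (real (Suc n))" if le: "T \<le> enat (\<nu> + n)" for n
  proof -
    obtain t where t: "T = enat t" "t \<le> \<nu> + n" using le by (cases T) auto
    then have "T + 1 - enat \<nu> = enat (t + 1 - \<nu>)" by (simp add: one_enat_def)
    then have "ennreal_of_enat (T + 1 - enat \<nu>) = ennreal (real (t + 1 - \<nu>))"
      by (simp add: ennreal_of_nat_eq_real_of_nat)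
    also have "\<dots> \<le> ennreal (real (Suc n))"
      by (intro ennreal_leI of_nat_mono) (use t in linarith)
    finally show ?thesis .
  qed
  show ?thesis
  proof (cases "ln B \<le> llr (\<lambda>k i. y k (\<nu> + i)) ?n")
    case True
    have "T \<le> enat (\<nu> + ?n)" unfolding T_def by (rule srrs_time_le[OF \<nu> B True])
    from conv[OF this] have "ennreal_of_enat (T + 1 - enat \<nu>) \<le> ennreal (1 + real ?n)" by (simp add: add.commute)
    then show ?thesis by (rule order_trans) simp
  next
    case False
    then have n: "?n = L" using passage_props(3)[OF sL, of "ln B" "\<lambda>k i. y k (\<nu> + i)"] by auto
    with False have miss0: "miss 0" by (simp add: miss_def)
    show ?thesis
    proof (cases "\<forall>l. miss l")
      case True
      have "(\<Sum>i. if \<forall>l\<le>i. miss l then 1 else 0 :: ennreal) = (\<Sum>i. 1)" using True by simp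
      also have "\<dots> = top"
      proof (rule ccontr)
        assume "(\<Sum>i. 1 :: ennreal) \<noteq> top"
        then obtain r where r: "(\<Sum>i. 1 :: ennreal) = ennreal r" "r \<ge> 0" by (cases "(\<Sum>i. 1 :: ennreal)") auto
        obtain N where N: "r < real N" using reals_Archimedean2 by blast
        have "(\<Sum>i<N. 1 :: ennreal) \<le> (\<Sum>i. 1)" by (intro sum_le_suminf) auto
        then have "ennreal (real N) \<le> ennreal r" using r by (simp add: ennreal_of_nat_eq_real_of_nat)
        then show False using N r by simp
      qed
      finally show ?thesis by (simp add: ennreal_mult_top)
    next
      case False
      define i where "i = (LEAST l. \<not> miss l)"
      have i: "\<not> miss i" unfolding i_def using False by (metis LeastI)
      have before: "miss l" if "l < i" for l using not_less_Least[OF that[unfolded i_def]] by simp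
      have "T \<le> enat ((\<nu> + i * Suc L) + L)"
        unfolding T_def by (rule srrs_time_le) (use \<nu> B i in \<open>auto simp: miss_def not_less\<close>)
      then have T: "ennreal_of_enat (T + 1 - enat \<nu>) \<le> ennreal (real (Suc (i * Suc L + L)))"
        by (intro conv) (simp add: add.assoc)
      have "real (Suc (i * Suc L + L)) = (1 + real ?n) + real (Suc L) * real i"
        unfolding n by (simp add: algebra_simps)
      then have "ennreal (real (Suc (i * Suc L + L))) = ennreal (1 + real ?n) + ennreal (real (Suc L)) * ennreal (real i)"
        by (simp only: ennreal_plus[symmetric] ennreal_mult[symmetric] of_nat_0_le_iff mult_nonneg_nonneg add_nonneg_nonneg zero_le_one)
      also have "ennreal (real i) = (\<Sum>j<i. if \<forall>l\<le>j. miss l then 1 else 0)"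
        using before by (simp add: ennreal_of_nat_eq_real_of_nat)
      also have "\<dots> \<le> (\<Sum>j. if \<forall>l\<le>j. miss l then 1 else 0)"
        by (intro sum_le_suminf) auto
      finally show ?thesis using T by (meson order_trans add_left_mono mult_left_mono zero_le)
    qed
  qed
qed

text \<open>
  The bound of \<open>delay_le\<close> depends on the observations from \<open>\<nu>\<close> on, so over an event \<open>A\<close> of the past it
  integrates to its mean times the probability of \<open>A\<close>. Distinct blocks are independent and missed with the
  same probability \<open>q\<close>, so the number of missed blocks has mean \<open>q / (1 - q)\<close>, which is at most \<open>2 * p\<close>.
\<close>

lemma detection_delay_le:
  fixes a b c :: real and L s K :: nat
  assumes model: "change_point_model M P K \<mu> X" and K: "K \<ge> 1" and sh: "shrinkage \<omega> \<mu> K"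
    and sL: "s \<le> L" and B: "B > 0"
    and mean: "shrinkage.mean_passage a b c \<omega> \<mu> K (ln B) s L \<le> v" 
    and p: "shrinkage.miss_prob a b c \<omega> \<mu> K (ln B) L \<le> p" "p \<le> 1 / 2"
  shows "detection_delay P (obs_filtration M K X) (\<lambda>x. srrs_time a b c \<omega> K B (\<lambda>k n. X k n x))
    \<le> ennreal (1 + v + real (Suc L) * (2 * p))"
  unfolding detection_delay_def Let_def
proof (rule SUP_least)
  fix \<nu> :: nat assume "\<nu> \<in> {1..}"
  then have \<nu>: "1 \<le> \<nu>" by simp
  interpret S: shrinkage a b c \<omega> \<mu> K by (rule sh)
  interpret N: normal_streams a b c \<omega> \<mu> K "P \<nu>" "\<lambda>k i. X k (\<nu> + i)"
    by (rule normal_streams_shift[OF model sh \<nu> order_refl])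
  have sets: "sets (P \<nu>) = sets M"
    and ind: "N.indep_vars (\<lambda>_. borel) (\<lambda>(k, n). X k n) ({1..K} \<times> {1..})"
    and dist: "\<And>k n. k \<in> {1..K} \<Longrightarrow> n \<ge> 1 \<Longrightarrow>
      distributed (P \<nu>) lborel (X k n) (normal_density (if n < \<nu> then 0 else \<mu> k) 1)"
    using model \<nu> by (auto simp: change_point_model_def)
  have space: "space (P \<nu>) = space M" by (rule sets_eq_imp_space_eq[OF sets])
  have mX: "X k n \<in> borel_measurable (P \<nu>)" if "k \<in> {1..K}" "n \<ge> 1" for k n
    using dist[OF that] by (auto dest: distributed_measurable)
  let ?C = "\<lambda>I. coord_algebra (P \<nu>) (\<lambda>(k, n). X k n) ({1..K} \<times> I)"
  let ?F = "obs_filtration M K X (\<nu> - 1)"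
  have F: "sets ?F = sets (?C {1..\<nu> - 1})" "space ?F = space (P \<nu>)"
  proof -
    have "{X k i -` A \<inter> space M | k i A. k \<in> {1..K} \<and> i \<in> {1..\<nu> - 1} \<and> A \<in> sets borel} =
        (\<Union>p\<in>{1..K} \<times> {1..\<nu> - 1}. {(case p of (k, n) \<Rightarrow> X k n) -` A \<inter> space (P \<nu>) | A. A \<in> sets borel})"
    proof (intro subset_antisym subsetI)
      fix S assume "S \<in> {X k i -` A \<inter> space M | k i A. k \<in> {1..K} \<and> i \<in> {1..\<nu> - 1} \<and> A \<in> sets borel}"
      then obtain k i A where "S = X k i -` A \<inter> space M" "k \<in> {1..K}" "i \<in> {1..\<nu> - 1}" "A \<in> sets borel" by blast
      then show "S \<in> (\<Union>p\<in>{1..K} \<times> {1..\<nu> - 1}. {(case p of (k, n) \<Rightarrow> X k n) -` A \<inter> space (P \<nu>) | A. A \<in> sets borel})"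
        by (intro UN_I[of "(k, i)"]) (auto simp: space)
    next
      fix S assume "S \<in> (\<Union>p\<in>{1..K} \<times> {1..\<nu> - 1}. {(case p of (k, n) \<Rightarrow> X k n) -` A \<inter> space (P \<nu>) | A. A \<in> sets borel})"
      then obtain k i A where "S = X k i -` A \<inter> space M" "k \<in> {1..K}" "i \<in> {1..\<nu> - 1}" "A \<in> sets borel"
        unfolding space by force
      then show "S \<in> {X k i -` A \<inter> space M | k i A. k \<in> {1..K} \<and> i \<in> {1..\<nu> - 1} \<and> A \<in> sets borel}" by blast
    qed
    then have eq: "?F = ?C {1..\<nu> - 1}"
      unfolding obs_filtration_def coord_algebra_def space by simp
    show "sets ?F = sets (?C {1..\<nu> - 1})" "space ?F = space (P \<nu>)" unfolding eq by simp_all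
  qed
  have CP: "sets (?C I) \<subseteq> sets (P \<nu>)" if "I \<subseteq> {1..}" for I
    by (rule sets_coord_algebra_subset) (use mX that in auto)
  have cX: "X k n \<in> borel_measurable (?C I)" if "k \<in> {1..K}" "n \<in> I" for k n I
    using measurable_coord[of "(k, n)" "{1..K} \<times> I" "\<lambda>(k, n). X k n" "P \<nu>"] that by simp
  let ?y = "\<lambda>w k n. X k n w"
  let ?T = "\<lambda>w. srrs_time a b c \<omega> K B (?y w)"
  define E where "E = {w \<in> space (P \<nu>). enat \<nu> \<le> ?T w}"
  define miss where "miss l w \<longleftrightarrow> S.llr (\<lambda>k i. ?y w k (\<nu> + l * Suc L + i)) L < ln B" for l w
  define m where "m w = S.passage (ln B) s L (\<lambda>k i. ?y w k (\<nu> + i))" for w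
  let ?g = "\<lambda>w. ennreal (1 + real (m w)) + ennreal (real (Suc L)) * (\<Sum>i. if \<forall>l\<le>i. miss l w then 1 else 0)"
  let ?q = "S.miss_prob (ln B) L"
  have llrC: "(\<lambda>w. S.llr (\<lambda>k i. ?y w k (n + i)) l) \<in> borel_measurable (?C I)"
    if "{n..n + l} \<subseteq> I" for n l I
    by (intro S.measurable_llr cX) (use that in auto)
  have missC: "{w \<in> space (P \<nu>). miss l w} \<in> sets (?C I)" if "{\<nu> + l * Suc L..\<nu> + l * Suc L + L} \<subseteq> I" for l I
  proof -
    note [measurable] = llrC[OF that]
    have "{w \<in> space (?C I). S.llr (\<lambda>k i. ?y w k (\<nu> + l * Suc L + i)) L < ln B} \<in> sets (?C I)"
      by measurable
    then show ?thesis by (simp only: miss_def space_coord_algebra)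
  qed
  have q0: "0 \<le> ?q" by (simp add: S.miss_prob_def)
  have probmiss: "N.prob {w \<in> space (P \<nu>). miss l w} = ?q" for l
  proof -
    interpret Nl: normal_streams a b c \<omega> \<mu> K "P \<nu>" "\<lambda>k i. X k (\<nu> + l * Suc L + i)"
      by (rule normal_streams_shift[OF model sh \<nu>]) simp
    show ?thesis using Nl.prob_miss[OF K, of L "ln B"] unfolding Nl.obs_def miss_def .
  qed
  show "esssup (uniform_measure (P \<nu>) {w \<in> space (P \<nu>). enat \<nu> \<le> ?T w})
      (nn_cond_exp (uniform_measure (P \<nu>) {w \<in> space (P \<nu>). enat \<nu> \<le> ?T w}) ?F
        (\<lambda>w. ennreal_of_enat (?T w + 1 - enat \<nu>)))
    \<le> ennreal (1 + v + real (Suc L) * (2 * p))"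
    unfolding E_def[symmetric]
  proof (rule esssup_nn_cond_exp_le[where g = ?g])
    show "prob_space (P \<nu>)" by unfold_locales
    show "subalgebra (P \<nu>) ?F"
      using CP[of "{1..\<nu> - 1}"] unfolding subalgebra_def F by auto
    show "E \<in> sets ?F"
    proof -
      have "{w \<in> space (?C {1..\<nu> - 1}). \<forall>n\<in>{1..<\<nu>}. srrs_stat a b c \<omega> K (?y w) n < B} \<in> sets (?C {1..\<nu> - 1})"
      proof (rule sets.sets_Collect_finite_All)
        fix n assume n: "n \<in> {1..<\<nu>}"
        have [measurable]: "(\<lambda>w. srrs_stat a b c \<omega> K (?y w) n) \<in> borel_measurable (?C {1..\<nu> - 1})"
          unfolding S.srrs_stat_eq
          by (intro borel_measurable_sum borel_measurable_exp[THEN measurable_compose[rotated]] llrC)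
            (use n in auto)
        show "{w \<in> space (?C {1..\<nu> - 1}). srrs_stat a b c \<omega> K (?y w) n < B} \<in> sets (?C {1..\<nu> - 1})"
          by measurable
      qed simp
      then show ?thesis unfolding F(1) by (simp only: E_def S.le_srrs_time_iff space_coord_algebra)
    qed
    show "ennreal_of_enat (?T w + 1 - enat \<nu>) \<le> ?g w" for w
      unfolding miss_def m_def by (rule S.delay_le[OF sL B \<nu>])
    fix A assume "A \<in> sets ?F"
    then have A: "A \<in> sets (?C {1..\<nu> - 1})" unfolding F(1) .
    have AP: "A \<in> sets (P \<nu>)" using A CP[of "{1..\<nu> - 1}"] by auto
    define G where "G i = {w \<in> space (P \<nu>). \<forall>l<i. miss l w}" for i
    have GC: "A \<inter> G i \<in> sets (?C {1..<\<nu> + i * Suc L})"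
      and Gp: "N.prob (A \<inter> G i) = N.prob A * ?q ^ i" for i
    proof -
      have "A \<inter> G i \<in> sets (?C {1..<\<nu> + i * Suc L}) \<and> N.prob (A \<inter> G i) = N.prob A * ?q ^ i"
      proof (induction i)
        case 0
        have "A \<inter> G 0 = A" using sets.sets_into_space[OF AP] by (auto simp: G_def)
        moreover have "A \<in> sets (?C {1..<\<nu>})"
          using A sets_coord_algebra_mono[of "{1..K} \<times> {1..\<nu> - 1}" "{1..K} \<times> {1..<\<nu>}"] by force
        ultimately show ?case by simp
      next
        case (Suc i)
        let ?b = "\<nu> + i * Suc L"
        let ?e = "{w \<in> space (P \<nu>). miss i w}"
        have split: "A \<inter> G (Suc i) = (A \<inter> G i) \<inter> ?e" by (auto simp: G_def less_Suc_eq)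
        have 1: "A \<inter> G i \<in> sets (?C {1..<?b + Suc L})"
          using Suc sets_coord_algebra_mono[of "{1..K} \<times> {1..<?b}" "{1..K} \<times> {1..<?b + Suc L}"] by force
        have 2: "?e \<in> sets (?C {1..<?b + Suc L})" by (rule missC) (use \<nu> in auto)
        have "N.prob ((A \<inter> G i) \<inter> ?e) = N.prob (A \<inter> G i) * N.prob ?e"
        proof (rule N.prob_Int_coord_algebra[OF ind])
          show "A \<inter> G i \<in> sets (?C {1..<?b})" using Suc by simp
          show "?e \<in> sets (?C {?b..})" by (rule missC) auto
        qed (use \<nu> in auto)
        then have "N.prob (A \<inter> G (Suc i)) = N.prob A * ?q ^ Suc i"
          using Suc probmiss[of i] by (simp only: split) simp
        moreover have "A \<inter> G (Suc i) \<in> sets (?C {1..<\<nu> + Suc i * Suc L})"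
          unfolding split using sets.Int[OF 1 2] by (simp add: add_ac)
        ultimately show ?case by blast
      qed
      then show "A \<inter> G i \<in> sets (?C {1..<\<nu> + i * Suc L})" "N.prob (A \<inter> G i) = N.prob A * ?q ^ i" by auto
    qed
    have GP: "A \<inter> G i \<in> sets (P \<nu>)" for i
      by (rule subsetD[OF CP GC[of i]]) auto
    have bs: "N.bounded_stopping m L"
      using N.bounded_stopping_passage[OF sL, of "ln B"] by (simp add: N.obs_def m_def[abs_def])
    have first: "(\<integral>\<^sup>+ w. indicator A w * ennreal (1 + real (m w)) \<partial>P \<nu>) \<le> ennreal (1 + v) * emeasure (P \<nu>) A"
    proof -
      have mC: "(\<lambda>w. 1 + real (m w)) \<in> borel_measurable (?C {\<nu>..})"
      proof -
        have "m \<in> measurable (?C {\<nu>..}) (count_space UNIV)"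
        proof (rule measurable_count_space_eq_countable[THEN iffD2], safe)
          fix j
          have ev: "{w \<in> space (?C {\<nu>..}). i \<le> m w} \<in> sets (?C {\<nu>..})" for i
            unfolding m_def by (rule S.sets_le_passage[OF sL]) (rule llrC, auto)
          have "m -` {j} \<inter> space (?C {\<nu>..}) = {w \<in> space (?C {\<nu>..}). j \<le> m w} - {w \<in> space (?C {\<nu>..}). Suc j \<le> m w}"
            by auto
          then show "m -` {j} \<inter> space (?C {\<nu>..}) \<in> sets (?C {\<nu>..})"
            using sets.Diff[OF ev[of j] ev[of "Suc j"]] by simp
        qed auto
        then show ?thesis by measurable
      qed
      have mm: "(\<lambda>w. real (m w)) \<in> borel_measurable (P \<nu>)"
        using N.measurable_stopping[OF bs] by measurable
      have intm: "integrable (P \<nu>) (\<lambda>w. real (m w))"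
        by (rule N.integrable_const_bound[of _ "real L"])
          (use mm N.bounded_stopping_le[OF bs] in auto)
      then have int: "integrable (P \<nu>) (\<lambda>w. 1 + real (m w))" by auto
      have intA: "integrable (P \<nu>) (indicator A :: _ \<Rightarrow> real)"
        by (rule N.integrable_const_bound[of _ 1]) (use AP in \<open>auto split: split_indicator\<close>)
      have Am: "(indicator A :: _ \<Rightarrow> real) \<in> borel_measurable (?C {1..\<nu> - 1})" using A by simp
      have J: "{1..K} \<times> {1..\<nu> - 1} \<subseteq> {1..K} \<times> {1..}" "{1..K} \<times> {\<nu>..} \<subseteq> {1..K} \<times> {1..}"
        "({1..K} \<times> {1..\<nu> - 1}) \<inter> ({1..K} \<times> {\<nu>..}) = {}"
        using \<nu> by auto
      have "(\<integral>\<^sup>+ w. indicator A w * ennreal (1 + real (m w)) \<partial>P \<nu>) = (\<integral>\<^sup>+ w. ennreal (indicator A w * (1 + real (m w))) \<partial>P \<nu>)"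
        by (intro nn_integral_cong) (auto split: split_indicator)
      also have "\<dots> = ennreal (N.expectation (\<lambda>w. indicator A w * (1 + real (m w))))"
        by (rule nn_integral_eq_integral[OF N.integrable_mult_coord_algebra[OF ind J Am mC intA int]]) simp
      also have "N.expectation (\<lambda>w. indicator A w * (1 + real (m w))) = N.prob A * (1 + S.mean_passage (ln B) s L)"
        using N.expectation_mult_coord_algebra[OF ind J Am mC intA int] intm AP
          N.expectation_passage[OF K sL, of "ln B"]
        by (simp add: N.obs_def m_def[abs_def] N.prob_space)
      also have "ennreal \<dots> \<le> ennreal (N.prob A * (1 + v))"
        using mean by (intro ennreal_leI mult_left_mono) auto
      also have "\<dots> = ennreal (1 + v) * emeasure (P \<nu>) A"
        by (simp add: N.emeasure_eq_measure ennreal_mult'' mult.commute)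
      finally show ?thesis .
    qed
    have second: "(\<integral>\<^sup>+ w. indicator A w * (\<Sum>i. if \<forall>l\<le>i. miss l w then 1 else 0) \<partial>P \<nu>) \<le> ennreal (2 * p) * emeasure (P \<nu>) A"
    proof -
      have q1: "?q \<le> 1 / 2" using p by linarith
      have "(\<integral>\<^sup>+ w. indicator A w * (\<Sum>i. if \<forall>l\<le>i. miss l w then 1 else 0) \<partial>P \<nu>) = (\<integral>\<^sup>+ w. (\<Sum>i. indicator (A \<inter> G (Suc i)) w) \<partial>P \<nu>)"
      proof (intro nn_integral_cong)
        fix w assume w: "w \<in> space (P \<nu>)"
        show "indicator A w * (\<Sum>i. if \<forall>l\<le>i. miss l w then 1 else 0 :: ennreal) = (\<Sum>i. indicator (A \<inter> G (Suc i)) w)"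
          unfolding ennreal_suminf_cmult[symmetric]
          by (intro suminf_cong) (use w in \<open>auto simp: G_def less_Suc_eq_le split: split_indicator\<close>)
      qed
      also have "\<dots> = (\<Sum>i. \<integral>\<^sup>+ w. indicator (A \<inter> G (Suc i)) w \<partial>P \<nu>)"
        by (rule nn_integral_suminf) (use GP in auto)
      also have "\<dots> = (\<Sum>i. ennreal (N.prob A * ?q ^ Suc i))"
        by (intro suminf_cong) (simp only: nn_integral_indicator[OF GP] N.emeasure_eq_measure Gp)
      also have "\<dots> = ennreal (N.prob A * (?q / (1 - ?q)))"
      proof -
        have "(\<lambda>i. ?q * ?q ^ i) sums (?q * (1 / (1 - ?q)))"
          by (intro sums_mult geometric_sums) (use q0 q1 in auto)
        then have "(\<lambda>i. N.prob A * ?q ^ Suc i) sums (N.prob A * (?q / (1 - ?q)))"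
          using sums_mult[of "\<lambda>i. ?q * ?q ^ i" "?q * (1 / (1 - ?q))" "N.prob A"] by simp
        then show ?thesis using q0 by (intro suminf_ennreal_eq) auto
      qed
      also have "\<dots> \<le> ennreal (N.prob A * (2 * p))"
      proof (intro ennreal_leI mult_left_mono)
        have "?q / (1 - ?q) \<le> ?q / (1 / 2)" using q0 q1 by (intro divide_left_mono) auto
        then show "?q / (1 - ?q) \<le> 2 * p" using p by simp
      qed simp
      also have "\<dots> = ennreal (2 * p) * emeasure (P \<nu>) A"
        unfolding N.emeasure_eq_measure mult.commute[of "N.prob A"] by (rule ennreal_mult'') simp
      finally show ?thesis .
    qed
    have m_meas: "m \<in> measurable (P \<nu>) (count_space UNIV)" by (rule N.measurable_stopping[OF bs])
    have missP: "{w \<in> space (P \<nu>). miss l w} \<in> sets (P \<nu>)" for l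
      using missC[of l "{1..}"] CP[of "{1..}"] \<nu> by auto
    have mm1: "(\<lambda>w. indicator A w * ennreal (1 + real (m w))) \<in> borel_measurable (P \<nu>)"
      using AP m_meas by measurable
    have v0: "0 \<le> v"
    proof -
      have "0 \<le> S.mean_passage (ln B) s L" by (simp add: S.mean_passage_def)
      then show ?thesis using mean by linarith
    qed
    have p0: "0 \<le> p" using q0 p by linarith
    have mS: "(\<lambda>w. \<Sum>i. if \<forall>l\<le>i. miss l w then 1 else 0 :: ennreal) \<in> borel_measurable (P \<nu>)"
    proof (intro borel_measurable_suminf_order measurable_If measurable_const)
      fix i
      have "{w \<in> space (P \<nu>). \<forall>l\<in>{..i}. miss l w} \<in> sets (P \<nu>)"
        by (rule sets.sets_Collect_finite_All) (use missP in auto)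
      then show "{w \<in> space (P \<nu>). \<forall>l\<le>i. miss l w} \<in> sets (P \<nu>)"
        by (simp only: Ball_def atMost_iff)
    qed simp_all
    have aS: "(\<lambda>w. indicator A w * (\<Sum>i. if \<forall>l\<le>i. miss l w then 1 else 0 :: ennreal)) \<in> borel_measurable (P \<nu>)"
      by (intro borel_measurable_times_ennreal borel_measurable_indicator AP mS)
    have "(\<integral>\<^sup>+ w. indicator A w * ?g w \<partial>P \<nu>) = (\<integral>\<^sup>+ w. indicator A w * ennreal (1 + real (m w)) +
        ennreal (real (Suc L)) * (indicator A w * (\<Sum>i. if \<forall>l\<le>i. miss l w then 1 else 0)) \<partial>P \<nu>)"
      by (intro nn_integral_cong) (simp only: distrib_left mult.left_commute)
    also have "\<dots> = (\<integral>\<^sup>+ w. indicator A w * ennreal (1 + real (m w)) \<partial>P \<nu>) +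
        ennreal (real (Suc L)) * (\<integral>\<^sup>+ w. indicator A w * (\<Sum>i. if \<forall>l\<le>i. miss l w then 1 else 0) \<partial>P \<nu>)"
      unfolding nn_integral_add[OF mm1 borel_measurable_times_ennreal[OF borel_measurable_const aS]]
        nn_integral_cmult[OF aS] ..
    also have "\<dots> \<le> ennreal (1 + v) * emeasure (P \<nu>) A + ennreal (real (Suc L)) * (ennreal (2 * p) * emeasure (P \<nu>) A)"
      by (intro add_mono mult_left_mono first second) auto
    also have "\<dots> = ennreal (1 + v + real (Suc L) * (2 * p)) * emeasure (P \<nu>) A"
      using v0 p0 by (simp only: ennreal_plus[of "1 + v" "real (Suc L) * (2 * p)"] ennreal_mult[of "real (Suc L)" "2 * p"]
        distrib_right mult.assoc of_nat_0_le_iff mult_nonneg_nonneg add_nonneg_nonneg zero_le_one zero_le_numeral)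
    finally show "(\<integral>\<^sup>+ w. indicator A w * ?g w \<partial>P \<nu>) \<le> ennreal (1 + v + real (Suc L) * (2 * p)) * emeasure (P \<nu>) A" .
  qed
qed

theorem theorem2:
  fixes M :: "'w measure" and P :: "nat \<Rightarrow> 'w measure" and X :: "nat \<Rightarrow> nat \<Rightarrow> 'w \<Rightarrow> real"
    and K r :: nat and \<mu> \<omega> :: "nat \<Rightarrow> real" and a b c I :: real
  assumes "K \<ge> 1"
    and "change_point_model M P K \<mu> X"
    and "\<And>k. k \<in> {1..K} \<Longrightarrow> \<omega> k > 0"
    and "\<And>k. k \<in> {1..K} \<Longrightarrow> \<bar>\<mu> k\<bar> \<noteq> \<omega> k"
    and "r = card {k \<in> {1..K}. \<bar>\<mu> k\<bar> > \<omega> k}"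
    and "r \<ge> 1"
    and "I = srrs_information a b c \<omega> K \<mu>"
    and "I > 0"
  shows "\<exists>g :: real \<Rightarrow> real. g \<in> o[at_top](\<lambda>B. real r * ln (ln B)) \<and>
           (\<forall>\<^sub>F B in at_top.
              detection_delay P (obs_filtration M K X)
                (\<lambda>x. srrs_time a b c \<omega> K B (\<lambda>k n. X k n x))
              \<le> ennreal (ln B / I + real r * a\<^sup>2 / (2 * I) * ln (ln B / I) + g B))"
proof -
  have sh: "shrinkage \<omega> \<mu> K" using assms(3,4) by unfold_locales
  interpret N: normal_streams a b c \<omega> \<mu> K "P 1" "\<lambda>k i. X k (1 + i)"
    by (rule normal_streams_shift[OF assms(2) sh]) auto
  have I: "I = N.info" using assms(7) N.info_eq by simp
  with \<open>I > 0\<close> have "N.info > 0" by simp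
  show ?thesis
  proof (rule N.mean_passage_bound[OF \<open>N.info > 0\<close>, folded assms(5) I])
    fix C H0 :: real
    assume C: "C > 0"
      and mean: "\<And>H s L. H \<ge> H0 \<Longrightarrow> s = nat \<lfloor>H / (2 * I)\<rfloor> \<Longrightarrow> L = nat \<lceil>2 * H / I\<rceil> \<Longrightarrow>
        N.mean_le (\<lambda>w. real (N.passage H s L (N.obs w)))
          (H / I + real r * a\<^sup>2 / (2 * I) * ln (H / I) + C * sqrt (ln (real L)))"
      and miss: "\<And>H L. H \<ge> H0 \<Longrightarrow> L = nat \<lceil>2 * H / I\<rceil> \<Longrightarrow> N.prob {w \<in> space (P 1). N.llr (N.obs w) L < H} \<le> C / real L"
    \<comment> \<open>The summand \<open>1\<close> stems from counting the observation at the change-point, \<open>4 * C\<close> from missed blocks,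
      and \<open>L\<close> is at most \<open>(ln B)\<^sup>2\<close> for large \<open>B\<close>.\<close>
    define g where "g B = 1 + 4 * C + C * sqrt (2 * ln (ln B))" for B
    have "(\<lambda>B. 1 + 4 * C + C * sqrt (2 * ln (ln B))) \<in> o[at_top](\<lambda>B. ln (ln B))"
      by real_asymp
    then have "g \<in> o[at_top](\<lambda>B. real r * ln (ln B))"
      using \<open>r \<ge> 1\<close> unfolding g_def[abs_def] by simp
    moreover have "\<forall>\<^sub>F B in at_top. detection_delay P (obs_filtration M K X)
          (\<lambda>x. srrs_time a b c \<omega> K B (\<lambda>k n. X k n x))
        \<le> ennreal (ln B / I + real r * a\<^sup>2 / (2 * I) * ln (ln B / I) + g B)"
    proof -
      have "filterlim ln at_top (at_top :: real filter)" by (rule ln_at_top)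
      then have "\<forall>\<^sub>F B in at_top. ln B \<ge> max H0 (max I (max (C * I) (max (3 / I) 1)))"
        unfolding filterlim_at_top by blast
      with eventually_gt_at_top[of 0] show ?thesis
      proof eventually_elim
        case (elim B)
        define H where "H = ln B"
        have H: "H \<ge> H0" "H \<ge> I" "H \<ge> C * I" "H \<ge> 3 / I" "H \<ge> 1" using elim by (auto simp: H_def)
        define s where "s = nat \<lfloor>H / (2 * I)\<rfloor>"
        define L where "L = nat \<lceil>2 * H / I\<rceil>"
        have HI: "1 \<le> H / I" "C \<le> H / I"
          using H \<open>I > 0\<close> by (simp_all add: pos_le_divide_eq)
        have "real L = of_int \<lceil>2 * (H / I)\<rceil>" using HI by (simp add: L_def)
        then have L: "2 * (H / I) \<le> real L" "real L \<le> 3 * (H / I)"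
          using HI le_of_int_ceiling[of "2 * (H / I)"] of_int_ceiling_le_add_one[of "2 * (H / I)"] by linarith+
        have double: "z / 2 \<le> 2 * z" if "1 \<le> z" for z :: real using that by simp
        have "real s \<le> H / (2 * I)" using HI \<open>I > 0\<close> H by (simp add: s_def)
        also have "H / (2 * I) = H / I / 2" by simp
        also have "H / I / 2 \<le> 2 * (H / I)" by (rule double[OF HI(1)])
        also note L(1)
        finally have "real s \<le> real L" .
        then have sL: "s \<le> L" by simp
        have "N.mean_passage H s L \<le> H / I + real r * a\<^sup>2 / (2 * I) * ln (H / I) + C * sqrt (ln (real L))"
          using mean[OF H(1) s_def L_def]
          unfolding N.mean_le_def N.expectation_passage[OF \<open>K \<ge> 1\<close> sL] by (rule conjunct2)
        moreover have "sqrt (ln (real L)) \<le> sqrt (2 * ln H)"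
        proof -
          have "3 \<le> H * I" using H(4) \<open>I > 0\<close> by (simp add: pos_divide_le_eq)
          then have "3 * H \<le> (H * I) * H" using H by (intro mult_right_mono) auto
          then have "3 * (H / I) \<le> H ^ 2" using \<open>I > 0\<close> by (simp add: pos_divide_le_eq power2_eq_square mult.commute mult.left_commute)
          then have "ln (real L) \<le> ln (H ^ 2)" using L HI by (intro ln_mono) linarith+
          also have "\<dots> = 2 * ln H" using H by (simp add: ln_realpow)
          finally show ?thesis by simp
        qed
        then have "C * sqrt (ln (real L)) \<le> C * sqrt (2 * ln H)" using C by (intro mult_left_mono) auto
        ultimately have v: "N.mean_passage H s L \<le> H / I + real r * a\<^sup>2 / (2 * I) * ln (H / I) + C * sqrt (2 * ln H)"
          by linarith
        have q: "N.miss_prob H L \<le> C / real L"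
          using miss[OF H(1) L_def] unfolding N.prob_miss[OF \<open>K \<ge> 1\<close>] .
        have L0: "real L > 0" "1 \<le> real L" using L HI by linarith+
        have "2 * C \<le> 2 * (H / I)" using HI(2) by simp
        also note L(1)
        finally have half: "C / real L \<le> 1 / 2" using L0(1) by (simp add: divide_le_eq)
        have "real (Suc L) * (2 * (C / real L)) \<le> (2 * real L) * (2 * (C / real L))"
          using L0 C by (intro mult_right_mono) auto
        also have "\<dots> = 4 * C" using L0 by simp
        finally have tail: "real (Suc L) * (2 * (C / real L)) \<le> 4 * C" .
        have "detection_delay P (obs_filtration M K X) (\<lambda>x. srrs_time a b c \<omega> K B (\<lambda>k n. X k n x))
           \<le> ennreal (1 + (H / I + real r * a\<^sup>2 / (2 * I) * ln (H / I) + C * sqrt (2 * ln H)) + real (Suc L) * (2 * (C / real L)))"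
          by (rule detection_delay_le[OF assms(2,1) sh sL elim(1) v[unfolded H_def] q[unfolded H_def] half, folded H_def])
        also have "\<dots> \<le> ennreal (H / I + real r * a\<^sup>2 / (2 * I) * ln (H / I) + g B)"
          using tail by (intro ennreal_leI) (simp add: g_def H_def)
        finally show ?case by (simp add: H_def)
      qed
    qed
    ultimately show ?thesis by blast
  qed
qed

end
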